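(* Let $(A,\bullet_i,\Delta)$ be a grafting bialgebra. For $x\in A_n$, $y\in A_m$ and $\gamma\in Sh(n,m)$ with associated compositions $(n_1,\dots,n_r)$ of $n$ and $(m_1,\dots,m_{r+1})$ of $m$ (see context), define $x\bullet_\gamma y=\sum x^{n_1}_{(1)}\bullet_{m_1}\big(x^{n_2}_{(2)}\bullet_{m_1+m_2}\big(\cdots\big(x^{n_r}_{(r)}\bullet_{m_1+\dots+m_r}y\big)\cdots\big)\big)$, where $\sum x^{n_1}_{(1)}\otimes\dots\otimes x^{n_r}_{(r)}$ is the component in $A_{n_1}\otimes\dots\otimes A_{n_r}$ of the iterated coproduct $\Delta^{(r-1)}(x)$ ($\Delta^{(0)}=\mathrm{id}$). Then $(A,\bullet_\gamma,\Delta)$ is a shuffle bialgebra.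
   Context: Permutations $\sigma\in S_n$ are written as words $(\sigma(1),\dots,\sigma(n))$; $1_n$ is the identity, and $\sigma\cdot\tau$ denotes composition, $(\sigma\cdot\tau)(i)=\sigma(\tau(i))$. For $\sigma\in S_n$, $\tau\in S_m$, $\sigma\times\tau\in S_{n+m}$ is $(\sigma(1),\dots,\sigma(n),\tau(1)+n,\dots,\tau(m)+n)$. For nonnegative integers $n_1,\dots,n_r$ with sum $n$, $Sh(n_1,\dots,n_r)$ is the set of $\sigma\in S_n$ such that $\sigma^{-1}(n_1+\dots+n_{k-1}+1)<\dots<\sigma^{-1}(n_1+\dots+n_k)$ for every $k$. For $n,m\ge0$, $\epsilon_{n,m}=(n+1,\dots,n+m,1,\dots,n)\in Sh(n,m)$. Every $\gamma\in Sh(n,m)$ is uniquely the word $(n+1,\dots,n+m_1,\,1,\dots,n_1,\,n+m_1+1,\dots,n+m_1+m_2,\,n_1+1,\dots,n_1+n_2,\dots)$ alternating blocks of consecutive values from $\{n+1,\dots,n+m\}$ of lengths $m_1,\dots,m_{r+1}$ and from $\{1,\dots,n\}$ of lengths $n_1,\dots,n_r$, with $n_j\ge1$, $m_1,m_{r+1}\ge0$, $m_j\ge1$ for $2\le j\le r$. A preshuffle algebra is a graded vector space $A=\bigoplus_{n\ge0}A_n$ with linear maps $\bullet_i:A_n\otimes A_m\to A_{n+m}$ ($0\le i\le m$) such that $(x\bullet_iy)\bullet_jz=x\bullet_{i+j}(y\bullet_jz)$ for $0\le i\le|y|$, $0\le j\le|z|$. A grafting algebra additionally satisfies $x\bullet_i(y\bullet_jz)=y\bullet_{j+|x|}(x\bullet_iz)$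 for $0\le i<j\le|z|$. A preshuffle bialgebra is a preshuffle algebra with $A_0=0$ and a coassociative coproduct $\Delta$ with $\Delta(A_n)\subseteq\bigoplus_{i=1}^{n-1}A_i\otimes A_{n-i}$ (Sweedler notation $\Delta(z)=\sum z_{(1)}\otimes z_{(2)}$) such that for homogeneous $x,y$: (1) $\Delta(x\bullet_0y)=\sum x_{(1)}\otimes(x_{(2)}\bullet_0y)+x\otimes y+\sum(x\bullet_0y_{(1)})\otimes y_{(2)}$; (2) for $1\le i\le|y|-1$: $\Delta(x\bullet_iy)=\sum_{|y_{(1)}|\le i}y_{(1)}\otimes(x\bullet_{i-|y_{(1)}|}y_{(2)})+\sum_{|y_{(1)}|=i}(x_{(1)}\bullet_iy_{(1)})\otimes(x_{(2)}\bullet_0y_{(2)})+\sum_{|y_{(1)}|\ge i}(x\bullet_iy_{(1)})\otimes y_{(2)}$; (3) $\Delta(x\bullet_{|y|}y)=\sum y_{(1)}\otimes(x\bullet_{|y_{(2)}|}y_{(2)})+y\otimes x+\sum(x_{(1)}\bullet_{|y|}y)\otimes x_{(2)}$. A grafting bialgebra is a preshuffle bialgebra whose underlying preshuffle algebra is a grafting algebra. A shuffle algebra is a graded vector space $A=\bigoplus_{n\ge0}A_n$ over a field $K$ with linear maps $\bullet_\gamma:A_n\otimes A_m\to A_{n+m}$ for all $n,m\ge0$ and $\gamma\in Sh(n,m)$, such that for $x\in A_n$, $y\in A_m$, $z\in A_r$ one has $x\bullet_\gamma(y\bullet_\delta z)=(x\bullet_\sigma y)\bullet_\lambda z$ whenever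 $\gamma\in Sh(n,m+r)$, $\delta\in Sh(m,r)$, $\sigma\in Sh(n,m)$, $\lambda\in Sh(n+m,r)$ satisfy $(1_n\times\delta)\cdot\gamma=(\sigma\times1_r)\cdot\lambda$. Decomposition of shuffles: for $\gamma\in Sh(n,m)$ and $0\le r\le n+m$, put $n_1=|\gamma^{-1}(\{1,\dots,n\})\cap\{1,\dots,r\}|$ and $m_1=r-n_1$; there are unique $\gamma^r_{(1)}\in Sh(n_1,m_1)$ and $\gamma^{n+m-r}_{(2)}\in Sh(n-n_1,m-m_1)$ with $\gamma=(1_{n_1}\times\epsilon_{n-n_1,m_1}\times1_{m-m_1})\cdot(\gamma^r_{(1)}\times\gamma^{n+m-r}_{(2)})$. A shuffle bialgebra is a shuffle algebra $A$ with $A_0=0$ together with a coassociative coproduct $\Delta:A\to A\otimes A$ with $\Delta(A_n)\subseteq\bigoplus_{i=1}^{n-1}A_i\otimes A_{n-i}$, such that for $x\in A_n$, $y\in A_m$, $\gamma\in Sh(n,m)$: $\Delta(x\bullet_\gamma y)=\sum_{r=1}^{n+m-1}\sum(x_{(1)}\bullet_{\gamma^r_{(1)}}y_{(1)})\otimes(x_{(2)}\bullet_{\gamma^{n+m-r}_{(2)}}y_{(2)})$, where, with $\Delta_+(z)=z\otimes1+1\otimes z+\Delta(z)$ on $K1\oplus A$ ($1$ of degree $0$), the inner sum is over the homogeneous components $x_{(1)}\otimes x_{(2)}$ of $\Delta_+(x)$ with $|x_{(1)}|=n_1$ and $y_{(1)}\otimes y_{(2)}$ of $\Delta_+(y)$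 with $|y_{(1)}|=m_1$, using the conventions $1\bullet_\tau z=z\bullet_\tau1=z$. *)

theory Defs
  imports Main "HOL.Vector_Spaces"
begin

text \<open>A permutation sigma in S_n is represented by its word [sigma(1),...,sigma(n)].\<close>

definition is_perm_word :: "nat \<Rightarrow> nat list \<Rightarrow> bool" where
  "is_perm_word n s \<longleftrightarrow> length s = n \<and> distinct s \<and> set s = {1..n}"

definition id_word :: "nat \<Rightarrow> nat list" where
  "id_word n = [1..<n+1]"

definition comp_word :: "nat list \<Rightarrow> nat list \<Rightarrow> nat list" where
  "comp_word s t = map (\<lambda>i. s ! (i - 1)) t"

definition cross_word :: "nat list \<Rightarrow> nat list \<Rightarrow> nat list" where
  "cross_word s t = s @ map (\<lambda>j. j + length s) t"

definition inv_at :: "nat list \<Rightarrow> nat \<Rightarrow> nat" where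
  "inv_at s v = (THE p. 1 \<le> p \<and> p \<le> length s \<and> s ! (p - 1) = v)"

definition Sh :: "nat list \<Rightarrow> nat list set" where
  "Sh ns = {s. is_perm_word (sum_list ns) s \<and>
     (\<forall>k < length ns. \<forall>i. sum_list (take k ns) + 1 \<le> i \<and> i < sum_list (take k ns) + ns ! k
        \<longrightarrow> inv_at s i < inv_at s (i + 1))}"

definition eps_word :: "nat \<Rightarrow> nat \<Rightarrow> nat list" where
  "eps_word n m = [n+1..<n+m+1] @ [1..<n+1]"

definition block_word :: "nat \<Rightarrow> nat list \<Rightarrow> nat list \<Rightarrow> nat list" where
  "block_word n ns ms =
     concat (map (\<lambda>j. [n + sum_list (take j ms) + 1 ..< n + sum_list (take (j+1) ms) + 1]
                      @ [sum_list (take j ns) + 1 ..< sum_list (take (j+1) ns) + 1])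
                 [0..<length ns])
     @ [n + sum_list (take (length ns) ms) + 1 ..< n + sum_list ms + 1]"

definition shuffle_comps :: "nat \<Rightarrow> nat \<Rightarrow> nat list \<Rightarrow> nat list \<times> nat list" where
  "shuffle_comps n m g = (THE (ns, ms).
      length ms = length ns + 1 \<and> sum_list ns = n \<and> sum_list ms = m \<and>
      (\<forall>j < length ns. 1 \<le> ns ! j) \<and>
      (\<forall>j. 1 \<le> j \<and> j < length ns \<longrightarrow> 1 \<le> ms ! j) \<and>
      g = block_word n ns ms)"

definition dec_n1 :: "nat \<Rightarrow> nat list \<Rightarrow> nat \<Rightarrow> nat" where
  "dec_n1 n g r = card {p. 1 \<le> p \<and> p \<le> r \<and> g ! (p - 1) \<in> {1..n}}"

definition shuffle_dec :: "nat \<Rightarrow> nat \<Rightarrow> nat list \<Rightarrow> nat \<Rightarrow> nat list \<times> nat list" where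
  "shuffle_dec n m g r = (let n1 = dec_n1 n g r; m1 = r - n1 in
     THE (g1, g2). g1 \<in> Sh [n1, m1] \<and> g2 \<in> Sh [n - n1, m - m1] \<and>
       g = comp_word (cross_word (cross_word (id_word n1) (eps_word (n - n1) m1)) (id_word (m - m1)))
                     (cross_word g1 g2))"

definition graded_vs :: "('k::field \<Rightarrow> 'a::ab_group_add \<Rightarrow> 'a) \<Rightarrow> (nat \<Rightarrow> 'a set) \<Rightarrow> bool" where
  "graded_vs sc G \<longleftrightarrow> vector_space sc \<and> (\<forall>n. 0 \<in> G n \<and> (\<forall>x\<in>G n. \<forall>y\<in>G n. x + y \<in> G n) \<and> (\<forall>c. \<forall>x\<in>G n. sc c x \<in> G n)) \<and>
     (\<forall>a. \<exists>!d. (\<forall>k. d k \<in> G k) \<and> finite {k. d k \<noteq> 0} \<and> a = sum d {k. d k \<noteq> 0})"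

definition proj :: "(nat \<Rightarrow> 'a::ab_group_add set) \<Rightarrow> nat \<Rightarrow> 'a \<Rightarrow> 'a" where
  "proj G k a = (THE d. (\<forall>k. d k \<in> G k) \<and> finite {k. d k \<noteq> 0} \<and> a = sum d {k. d k \<noteq> 0}) k"

definition bilinear_form :: "('k::field \<Rightarrow> 'a::ab_group_add \<Rightarrow> 'a) \<Rightarrow> ('a \<Rightarrow> 'a \<Rightarrow> 'k) \<Rightarrow> bool" where
  "bilinear_form sc f \<longleftrightarrow> (\<forall>a. Vector_Spaces.linear sc (*) (f a)) \<and>
                           (\<forall>b. Vector_Spaces.linear sc (*) (\<lambda>a. f a b))"

definition trilinear_form :: "('k::field \<Rightarrow> 'a::ab_group_add \<Rightarrow> 'a) \<Rightarrow> ('a \<Rightarrow> 'a \<Rightarrow> 'a \<Rightarrow> 'k) \<Rightarrow> bool" where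
  "trilinear_form sc f \<longleftrightarrow> (\<forall>a b. Vector_Spaces.linear sc (*) (f a b)) \<and>
                            (\<forall>a c. Vector_Spaces.linear sc (*) (\<lambda>b. f a b c)) \<and>
                            (\<forall>b c. Vector_Spaces.linear sc (*) (\<lambda>a. f a b c))"

text \<open>Elements of A \<otimes> A are represented by finite lists of pairs (sum of simple tensors);
  two representatives denote the same tensor iff every bilinear form K-valued agrees on them
  (over a field, bilinear forms separate the points of A \<otimes> A).\<close>
definition teq :: "('k::field \<Rightarrow> 'a::ab_group_add \<Rightarrow> 'a) \<Rightarrow> ('a \<times> 'a) list \<Rightarrow> ('a \<times> 'a) list \<Rightarrow> bool" where
  "teq sc t u \<longleftrightarrow> (\<forall>f. bilinear_form sc f \<longrightarrow>
      (\<Sum>(a,b)\<leftarrow>t. f a b) = (\<Sum>(a,b)\<leftarrow>u. f a b))"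

definition teq3 :: "('k::field \<Rightarrow> 'a::ab_group_add \<Rightarrow> 'a) \<Rightarrow> ('a \<times> 'a \<times> 'a) list \<Rightarrow> ('a \<times> 'a \<times> 'a) list \<Rightarrow> bool" where
  "teq3 sc t u \<longleftrightarrow> (\<forall>f. trilinear_form sc f \<longrightarrow>
      (\<Sum>(a,b,c)\<leftarrow>t. f a b c) = (\<Sum>(a,b,c)\<leftarrow>u. f a b c))"

text \<open>A coproduct Delta : A \<rightarrow> A \<otimes> A is given by a function choosing a representative.\<close>
definition coproduct :: "('k::field \<Rightarrow> 'a::ab_group_add \<Rightarrow> 'a) \<Rightarrow> ('a \<Rightarrow> ('a \<times> 'a) list) \<Rightarrow> bool" where
  "coproduct sc D \<longleftrightarrow>
     (\<forall>a b. teq sc (D (a + b)) (D a @ D b)) \<and>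
     (\<forall>c a. teq sc (D (sc c a)) (map (\<lambda>(u,v). (sc c u, v)) (D a)))"

definition coassoc :: "('k::field \<Rightarrow> 'a::ab_group_add \<Rightarrow> 'a) \<Rightarrow> ('a \<Rightarrow> ('a \<times> 'a) list) \<Rightarrow> bool" where
  "coassoc sc D \<longleftrightarrow> (\<forall>a. teq3 sc
      (concat (map (\<lambda>(u,v). map (\<lambda>(c,d). (c,d,v)) (D u)) (D a)))
      (concat (map (\<lambda>(u,v). map (\<lambda>(c,d). (u,c,d)) (D v)) (D a))))"

definition coproduct_graded :: "('k::field \<Rightarrow> 'a::ab_group_add \<Rightarrow> 'a) \<Rightarrow> (nat \<Rightarrow> 'a set) \<Rightarrow> ('a \<Rightarrow> ('a \<times> 'a) list) \<Rightarrow> bool" where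
  "coproduct_graded sc G D \<longleftrightarrow> (\<forall>n x. x \<in> G n \<longrightarrow>
     (\<exists>t. teq sc (D x) t \<and> (\<forall>(u,v) \<in> set t. \<exists>i. 1 \<le> i \<and> i \<le> n - 1 \<and> u \<in> G i \<and> v \<in> G (n - i))))"

definition dcomp :: "(nat \<Rightarrow> 'a::ab_group_add set) \<Rightarrow> ('a \<Rightarrow> ('a \<times> 'a) list) \<Rightarrow> nat \<Rightarrow> 'a \<Rightarrow> nat \<Rightarrow> ('a \<times> 'a) list" where
  "dcomp G D n x k = map (\<lambda>(u,v). (proj G k u, proj G (n - k) v)) (D x)"

definition dall :: "(nat \<Rightarrow> 'a::ab_group_add set) \<Rightarrow> ('a \<Rightarrow> ('a \<times> 'a) list) \<Rightarrow> nat \<Rightarrow> 'a \<Rightarrow> ('a \<times> 'a) list" where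
  "dall G D n x = concat (map (dcomp G D n x) [1..<n])"

definition graded_products :: "('k::field \<Rightarrow> 'a::ab_group_add \<Rightarrow> 'a) \<Rightarrow> (nat \<Rightarrow> 'a set) \<Rightarrow> (nat \<Rightarrow> 'a \<Rightarrow> 'a \<Rightarrow> 'a) \<Rightarrow> bool" where
  "graded_products sc G B \<longleftrightarrow> (\<forall>n m i. i \<le> m \<longrightarrow>
     (\<forall>x\<in>G n. \<forall>y\<in>G m. B i x y \<in> G (n + m)) \<and>
     (\<forall>x\<in>G n. \<forall>y1\<in>G m. \<forall>y2\<in>G m. \<forall>c d. B i x (sc c y1 + sc d y2) = sc c (B i x y1) + sc d (B i x y2)) \<and>
     (\<forall>x1\<in>G n. \<forall>x2\<in>G n. \<forall>y\<in>G m. \<forall>c d. B i (sc c x1 + sc d x2) y = sc c (B i x1 y) + sc d (B i x2 y)))"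

definition preshuffle_algebra :: "('k::field \<Rightarrow> 'a::ab_group_add \<Rightarrow> 'a) \<Rightarrow> (nat \<Rightarrow> 'a set) \<Rightarrow> (nat \<Rightarrow> 'a \<Rightarrow> 'a \<Rightarrow> 'a) \<Rightarrow> bool" where
  "preshuffle_algebra sc G B \<longleftrightarrow> graded_vs sc G \<and> graded_products sc G B \<and>
     (\<forall>n m p x y z i j. x \<in> G n \<and> y \<in> G m \<and> z \<in> G p \<and> i \<le> m \<and> j \<le> p \<longrightarrow>
        B j (B i x y) z = B (i + j) x (B j y z))"

definition grafting_algebra :: "('k::field \<Rightarrow> 'a::ab_group_add \<Rightarrow> 'a) \<Rightarrow> (nat \<Rightarrow> 'a set) \<Rightarrow> (nat \<Rightarrow> 'a \<Rightarrow> 'a \<Rightarrow> 'a) \<Rightarrow> bool" where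
  "grafting_algebra sc G B \<longleftrightarrow> preshuffle_algebra sc G B \<and>
     (\<forall>n m p x y z i j. x \<in> G n \<and> y \<in> G m \<and> z \<in> G p \<and> i < j \<and> j \<le> p \<longrightarrow>
        B i x (B j y z) = B (j + n) y (B i x z))"

definition preshuffle_bialgebra :: "('k::field \<Rightarrow> 'a::ab_group_add \<Rightarrow> 'a) \<Rightarrow> (nat \<Rightarrow> 'a set) \<Rightarrow> (nat \<Rightarrow> 'a \<Rightarrow> 'a \<Rightarrow> 'a) \<Rightarrow> ('a \<Rightarrow> ('a \<times> 'a) list) \<Rightarrow> bool" where
  "preshuffle_bialgebra sc G B D \<longleftrightarrow> preshuffle_algebra sc G B \<and> G 0 = {0} \<and>
     coproduct sc D \<and> coassoc sc D \<and> coproduct_graded sc G D \<and>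
     (\<forall>n m x y. x \<in> G n \<and> y \<in> G m \<longrightarrow>
        \<comment> \<open>(1)\<close>
        teq sc (D (B 0 x y))
          (map (\<lambda>(u,v). (u, B 0 v y)) (dall G D n x) @ [(x, y)] @
           map (\<lambda>(u,v). (B 0 x u, v)) (dall G D m y)) \<and>
        \<comment> \<open>(2)\<close>
        (\<forall>i. 1 \<le> i \<and> i \<le> m - 1 \<longrightarrow>
          teq sc (D (B i x y))
            (concat (map (\<lambda>k. map (\<lambda>(u,v). (u, B (i - k) x v)) (dcomp G D m y k)) [1..<i+1]) @
             concat (map (\<lambda>(u,v). map (\<lambda>(u',v'). (B i u u', B 0 v v')) (dcomp G D m y i)) (dall G D n x)) @
             concat (map (\<lambda>k. map (\<lambda>(u,v). (B i x u, v)) (dcomp G D m y k)) [i..<m]))) \<and>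
        \<comment> \<open>(3)\<close>
        teq sc (D (B m x y))
          (concat (map (\<lambda>k. map (\<lambda>(u,v). (u, B (m - k) x v)) (dcomp G D m y k)) [1..<m]) @ [(y, x)] @
           map (\<lambda>(u,v). (B m u y, v)) (dall G D n x)))"

definition grafting_bialgebra :: "('k::field \<Rightarrow> 'a::ab_group_add \<Rightarrow> 'a) \<Rightarrow> (nat \<Rightarrow> 'a set) \<Rightarrow> (nat \<Rightarrow> 'a \<Rightarrow> 'a \<Rightarrow> 'a) \<Rightarrow> ('a \<Rightarrow> ('a \<times> 'a) list) \<Rightarrow> bool" where
  "grafting_bialgebra sc G B D \<longleftrightarrow> preshuffle_bialgebra sc G B D \<and> grafting_algebra sc G B"

definition shuffle_algebra :: "('k::field \<Rightarrow> 'a::ab_group_add \<Rightarrow> 'a) \<Rightarrow> (nat \<Rightarrow> 'a set) \<Rightarrow> (nat \<Rightarrow> nat \<Rightarrow> nat list \<Rightarrow> 'a \<Rightarrow> 'a \<Rightarrow> 'a) \<Rightarrow> bool" where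
  "shuffle_algebra sc G S \<longleftrightarrow> graded_vs sc G \<and>
     (\<forall>n m g. g \<in> Sh [n, m] \<longrightarrow>
       (\<forall>x\<in>G n. \<forall>y\<in>G m. S n m g x y \<in> G (n + m)) \<and>
       (\<forall>x\<in>G n. \<forall>y1\<in>G m. \<forall>y2\<in>G m. \<forall>c d. S n m g x (sc c y1 + sc d y2) = sc c (S n m g x y1) + sc d (S n m g x y2)) \<and>
       (\<forall>x1\<in>G n. \<forall>x2\<in>G n. \<forall>y\<in>G m. \<forall>c d. S n m g (sc c x1 + sc d x2) y = sc c (S n m g x1 y) + sc d (S n m g x2 y))) \<and>
     (\<forall>n m r x y z g d s l. x \<in> G n \<and> y \<in> G m \<and> z \<in> G r \<and>
        g \<in> Sh [n, m + r] \<and> d \<in> Sh [m, r] \<and> s \<in> Sh [n, m] \<and> l \<in> Sh [n + m, r] \<and>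
        comp_word (cross_word (id_word n) d) g = comp_word (cross_word s (id_word r)) l \<longrightarrow>
        S n (m + r) g x (S m r d y z) = S (n + m) r l (S n m s x y) z)"

text \<open>Homogeneous components of Delta_+(x) = x\<otimes>1 + 1\<otimes>x + Delta(x) on K1 \<oplus> A,
  for x of degree n, in degree (k, n-k); None stands for the unit 1.\<close>
definition dplus_comp :: "(nat \<Rightarrow> 'a::ab_group_add set) \<Rightarrow> ('a \<Rightarrow> ('a \<times> 'a) list) \<Rightarrow> nat \<Rightarrow> 'a \<Rightarrow> nat \<Rightarrow> ('a option \<times> 'a option) list" where
  "dplus_comp G D n x k =
     (if k = 0 then [(None, Some x)]
      else if k = n then [(Some x, None)]
      else if k < n then map (\<lambda>(u,v). (Some u, Some v)) (dcomp G D n x k)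
      else [])"

fun unit_prod :: "(nat \<Rightarrow> nat \<Rightarrow> nat list \<Rightarrow> 'a \<Rightarrow> 'a \<Rightarrow> 'a) \<Rightarrow> nat \<Rightarrow> nat \<Rightarrow> nat list \<Rightarrow> 'a option \<Rightarrow> 'a option \<Rightarrow> 'a::zero" where
  "unit_prod S n m g None (Some v) = v"
| "unit_prod S n m g (Some u) None = u"
| "unit_prod S n m g (Some u) (Some v) = S n m g u v"
| "unit_prod S n m g None None = 0"

definition shuffle_bialgebra :: "('k::field \<Rightarrow> 'a::ab_group_add \<Rightarrow> 'a) \<Rightarrow> (nat \<Rightarrow> 'a set) \<Rightarrow> (nat \<Rightarrow> nat \<Rightarrow> nat list \<Rightarrow> 'a \<Rightarrow> 'a \<Rightarrow> 'a) \<Rightarrow> ('a \<Rightarrow> ('a \<times> 'a) list) \<Rightarrow> bool" where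
  "shuffle_bialgebra sc G S D \<longleftrightarrow> shuffle_algebra sc G S \<and> G 0 = {0} \<and>
     coproduct sc D \<and> coassoc sc D \<and> coproduct_graded sc G D \<and>
     (\<forall>n m x y g. x \<in> G n \<and> y \<in> G m \<and> g \<in> Sh [n, m] \<longrightarrow>
        teq sc (D (S n m g x y))
          (concat (map (\<lambda>r.
             let n1 = dec_n1 n g r; m1 = r - n1; (g1, g2) = shuffle_dec n m g r in
             concat (map (\<lambda>(x1, x2). map (\<lambda>(y1, y2).
                 (unit_prod S n1 m1 g1 x1 y1, unit_prod S (n - n1) (m - m1) g2 x2 y2))
               (dplus_comp G D m y m1))
               (dplus_comp G D n x n1)))
           [1..<n+m])))"

fun icop :: "('a \<Rightarrow> ('a \<times> 'a) list) \<Rightarrow> nat \<Rightarrow> 'a \<Rightarrow> 'a list list" where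
  "icop D 0 x = [[x]]"
| "icop D (Suc k) x = concat (map (\<lambda>t. map (\<lambda>(a,b). a # b # tl t) (D (hd t))) (icop D k x))"

definition icop_comp :: "(nat \<Rightarrow> 'a::ab_group_add set) \<Rightarrow> ('a \<Rightarrow> ('a \<times> 'a) list) \<Rightarrow> nat list \<Rightarrow> 'a \<Rightarrow> 'a list list" where
  "icop_comp G D ns x = (if ns = [] then []
      else map (\<lambda>t. map2 (proj G) ns t) (icop D (length ns - 1) x))"

fun nest :: "(nat \<Rightarrow> 'a \<Rightarrow> 'a \<Rightarrow> 'a) \<Rightarrow> nat list \<Rightarrow> nat \<Rightarrow> 'a list \<Rightarrow> 'a \<Rightarrow> 'a" where
  "nest B ms j [] y = y"
| "nest B ms j (x # xs) y = B (sum_list (take (j + 1) ms)) x (nest B ms (j + 1) xs y)"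

definition graft_shuffle :: "(nat \<Rightarrow> 'a::ab_group_add set) \<Rightarrow> (nat \<Rightarrow> 'a \<Rightarrow> 'a \<Rightarrow> 'a) \<Rightarrow> ('a \<Rightarrow> ('a \<times> 'a) list) \<Rightarrow> nat \<Rightarrow> nat \<Rightarrow> nat list \<Rightarrow> 'a \<Rightarrow> 'a \<Rightarrow> 'a" where
  "graft_shuffle G B D n m g x y = (case shuffle_comps n m g of (ns, ms) \<Rightarrow>
      sum_list (map (\<lambda>t. nest B ms 0 t y) (icop_comp G D ns x)))"

end

(* Adjoin a unit, so that the three coproduct formulas of a preshuffle bialgebra become instances of one
   rule for cutting the word of x \<bullet>_i y at an arbitrary position.  Write a shuffle of n letters x
   and m letters y as the list of the numbers c_j of letters x standing after exactly j letters y.  Then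
   x \<bullet>_c y is x_(0) \<bullet>_0 (x_(1) \<bullet>_1 ( ... (x_(m) \<bullet>_m y))), where x_(j) has degree c_j and factors
   of degree 0 are units.  Its coproduct is computed by induction on c from the cutting rule.
   For associativity, write (x \<bullet>_s y) \<bullet>_l z by splitting x \<bullet>_s y with this coproduct formula, and move
   the factors of y to the right of those of x with the preshuffle and grafting relations. *)
theory Submission
  imports Defs "HOL-Library.Product_Plus" "HOL-Library.Multiset"
begin

text \<open>Tensors occur only as lists of pairs, and two lists name the same tensor when all
  bilinear forms agree on them. Every identity for a coproduct is therefore an identity between sums
  of a bilinear map over such lists, and using it costs a proof of bilinearity. The products are
  linear only on homogeneous components and for admissible indices, so linearity is relative to a
  set (\<open>lin_on\<close>) and degrees are carried along everywhere. The compositions of the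
  statement have positive parts, but a cut may break a block or leave an empty one. One entry per
  gap between letters of y, with zeros allowed, removes these case distinctions; the price is a unit
  in degree 0, paid once by passing to \<open>K 1 + A\<close>. Both sides of the associativity
  condition are one word in three kinds of letters, and all four shuffles are readings of it, so
  their relation can be proved letter by letter. The iterated coproduct of the statement produces
  the last factor of x first, the recursive product the first; coassociativity reconciles
  them.\<close>

definition lin_on :: "('k \<Rightarrow> 'a::ab_group_add \<Rightarrow> 'a) \<Rightarrow> ('k \<Rightarrow> 'b::ab_group_add \<Rightarrow> 'b) \<Rightarrow> 'a set \<Rightarrow> ('a \<Rightarrow> 'b) \<Rightarrow> bool" where
  "lin_on s t S g \<longleftrightarrow> (\<forall>x\<in>S. \<forall>y\<in>S. \<forall>c d. g (s c x + s d y) = t c (g x) + t d (g y))"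

lemma lin_onD:
  "lin_on s t S g \<Longrightarrow> x \<in> S \<Longrightarrow> y \<in> S \<Longrightarrow> g (s c x + s d y) = t c (g x) + t d (g y)"
  by (simp add: lin_on_def)

lemma sum_list_swap:
  fixes F :: "'a \<Rightarrow> 'b \<Rightarrow> 'c::comm_monoid_add"
  shows "(\<Sum>x\<leftarrow>xs. \<Sum>y\<leftarrow>ys. F x y) = (\<Sum>y\<leftarrow>ys. \<Sum>x\<leftarrow>xs. F x y)"
  by (induction xs) (simp_all add: sum_list_addf)

text \<open>Among the terms of a coproduct formula, indexed by the degree j of the left part of the
  element that is cut, at most one has left degree k; \<open>d\<close> is the degree of what is
  multiplied onto that part.\<close>

lemma sum_list_upt_delta:
  fixes F :: "nat \<Rightarrow> 'b::comm_monoid_add"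
  shows "(\<Sum>j\<leftarrow>[a..<c]. if j + d = k then F j else 0) = (if a + d \<le> k \<and> k < c + d then F (k - d) else 0)"
  by (induction c) auto

lemma sum_list_map_concat:
  "(\<Sum>x\<leftarrow>concat xss. f x) = (\<Sum>xs\<leftarrow>xss. \<Sum>x\<leftarrow>xs. (f x :: 'b::monoid_add))"
  by (induction xss) auto

section \<open>Unital grafting bialgebras\<close>

text \<open>A word in three letters of multiplicities \<open>n, m, r\<close>, or a shuffle in \<open>Sh(n, m, r)\<close>, factors in two
  ways: as \<open>\<gamma>\<close> merging the first letter into a shuffle \<open>\<delta>\<close> of the other two, and as \<open>\<lambda>\<close> merging a
  shuffle \<open>\<sigma>\<close> of the first two letters with the third.  The predicate relates the encodings
  \<open>\<sigma>, \<lambda>, \<delta>, \<gamma>\<close> (in this order); a step adds the part of the word up to the first letter of the third kind.\<close>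
inductive factorizations :: "nat list \<Rightarrow> nat list \<Rightarrow> nat list \<Rightarrow> nat list \<Rightarrow> bool" where
  base: "factorizations [0] [] [] []"
| step: "factorizations (h # c') l d g \<Longrightarrow>
    factorizations (c @ (k + h) # c') ((sum_list c + k + length c) # l) (length c # d) (c @ k # g)"

text \<open>Degree bookkeeping for \<open>\<sigma>, \<lambda>, \<delta>, \<gamma>\<close> in
  Sh(n,m), Sh(n+m,r), Sh(m,r), Sh(n,m+r): their encodings have lengths m+1, r+1, r+1, m+r+1 and sums
  n, n+m, m, n. In \<open>base\<close> even the segment after the last letter of the third kind is
  unread, so the lengths r+1 start from 0.\<close>

lemma factorizations_sums:
  assumes "factorizations s l d g"
  shows "s \<noteq> [] \<and> sum_list g = sum_list s \<and> Suc (sum_list d) = length s \<and>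
    Suc (sum_list l) = sum_list s + length s \<and> length d = length l \<and>
    Suc (length g) = length l + length s"
  using assms by induction auto

text \<open>\<open>T k l\<close> is the component of bidegree (k, l) of the unital coproduct, known
  only through a representative, so its axioms are tested on bilinear maps \<open>f\<close>. With x
  inserted after i letters of y, the last three axioms form the cutting rule: the cut lies before x,
  inside x or after x. Their ranges overlap at the ends of x, where the unit makes the cases
  agree.\<close>

locale unital_grafting =
  fixes s :: "'k::field \<Rightarrow> 'v::ab_group_add \<Rightarrow> 'v"
    and H :: "nat \<Rightarrow> 'v set"
    and e :: 'v
    and b :: "nat \<Rightarrow> 'v \<Rightarrow> 'v \<Rightarrow> 'v"
    and T :: "nat \<Rightarrow> nat \<Rightarrow> 'v \<Rightarrow> ('v \<times> 'v) list"
  assumes vs: "vector_space s"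
    and H_zero: "0 \<in> H n"
    and H_add: "x \<in> H n \<Longrightarrow> y \<in> H n \<Longrightarrow> x + y \<in> H n"
    and unit_in: "e \<in> H 0"
    and H0: "x \<in> H 0 \<Longrightarrow> \<exists>c. x = s c e"
    and b_in: "i \<le> m \<Longrightarrow> x \<in> H n \<Longrightarrow> y \<in> H m \<Longrightarrow> b i x y \<in> H (n + m)"
    and b_lin1: "i \<le> m \<Longrightarrow> y \<in> H m \<Longrightarrow> lin_on s s (H n) (\<lambda>x. b i x y)"
    and b_lin2: "i \<le> m \<Longrightarrow> x \<in> H n \<Longrightarrow> lin_on s s (H m) (b i x)"
    and b_unit_left: "i \<le> m \<Longrightarrow> y \<in> H m \<Longrightarrow> b i e y = y"
    and b_assoc: "x \<in> H n \<Longrightarrow> y \<in> H m \<Longrightarrow> z \<in> H p \<Longrightarrow> i \<le> m \<Longrightarrow> j \<le> p \<Longrightarrow>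
      b j (b i x y) z = b (i + j) x (b j y z)"
    and b_graft: "x \<in> H n \<Longrightarrow> y \<in> H m \<Longrightarrow> z \<in> H p \<Longrightarrow> i < j \<Longrightarrow> j \<le> p \<Longrightarrow>
      b i x (b j y z) = b (j + n) y (b i x z)"
    and T_in: "x \<in> H (k + l) \<Longrightarrow> (u, v) \<in> set (T k l x) \<Longrightarrow> u \<in> H k \<and> v \<in> H l"
    and T_lin: "\<And>f. (\<And>u. u \<in> H k \<Longrightarrow> lin_on s s (H l) (f u)) \<Longrightarrow>
      (\<And>v. v \<in> H l \<Longrightarrow> lin_on s s (H k) (\<lambda>u. f u v)) \<Longrightarrow>
      lin_on s s (H (k + l)) (\<lambda>x. \<Sum>(u, v)\<leftarrow>T k l x. f u v)"
    and T_counit_left: "x \<in> H l \<Longrightarrow> (\<Sum>(u, v)\<leftarrow>T 0 l x. f u v) = f e x"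
    and T_counit_right: "x \<in> H k \<Longrightarrow>
      (\<And>u. u \<in> H k \<Longrightarrow> lin_on s s (H 0) (f u)) \<Longrightarrow>
      (\<And>v. v \<in> H 0 \<Longrightarrow> lin_on s s (H k) (\<lambda>u. f u v)) \<Longrightarrow>
      (\<Sum>(u, v)\<leftarrow>T k 0 x. f u v) = f x e"
    and T_coassoc: "\<And>F. x \<in> H (k + l + p) \<Longrightarrow>
      (\<And>u v. u \<in> H k \<Longrightarrow> v \<in> H l \<Longrightarrow> lin_on s s (H p) (F u v)) \<Longrightarrow>
      (\<And>u w. u \<in> H k \<Longrightarrow> w \<in> H p \<Longrightarrow> lin_on s s (H l) (\<lambda>v. F u v w)) \<Longrightarrow>
      (\<And>v w. v \<in> H l \<Longrightarrow> w \<in> H p \<Longrightarrow> lin_on s s (H k) (\<lambda>u. F u v w)) \<Longrightarrow>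
      (\<Sum>(y, w)\<leftarrow>T (k + l) p x. \<Sum>(u, v)\<leftarrow>T k l y. F u v w) =
      (\<Sum>(u, y)\<leftarrow>T k (l + p) x. \<Sum>(v, w)\<leftarrow>T l p y. F u v w)"
    and T_b_left: "\<And>f. x \<in> H n \<Longrightarrow> y \<in> H (p + q) \<Longrightarrow> i \<le> q \<Longrightarrow>
      (\<And>u. u \<in> H p \<Longrightarrow> lin_on s s (H (n + q)) (f u)) \<Longrightarrow>
      (\<And>v. v \<in> H (n + q) \<Longrightarrow> lin_on s s (H p) (\<lambda>u. f u v)) \<Longrightarrow>
      (\<Sum>(u, v)\<leftarrow>T p (n + q) (b (p + i) x y). f u v) = (\<Sum>(u, v)\<leftarrow>T p q y. f u (b i x v))"
    and T_b_middle: "\<And>f. x \<in> H (k + l) \<Longrightarrow> y \<in> H (p + q) \<Longrightarrow>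
      (\<And>u. u \<in> H (k + p) \<Longrightarrow> lin_on s s (H (l + q)) (f u)) \<Longrightarrow>
      (\<And>v. v \<in> H (l + q) \<Longrightarrow> lin_on s s (H (k + p)) (\<lambda>u. f u v)) \<Longrightarrow>
      (\<Sum>(u, v)\<leftarrow>T (k + p) (l + q) (b p x y). f u v) =
      (\<Sum>(u, v)\<leftarrow>T k l x. \<Sum>(u', v')\<leftarrow>T p q y. f (b p u u') (b 0 v v'))"
    and T_b_right: "\<And>f. x \<in> H n \<Longrightarrow> y \<in> H (p + q) \<Longrightarrow> i \<le> p \<Longrightarrow>
      (\<And>u. u \<in> H (n + p) \<Longrightarrow> lin_on s s (H q) (f u)) \<Longrightarrow>
      (\<And>v. v \<in> H q \<Longrightarrow> lin_on s s (H (n + p)) (\<lambda>u. f u v)) \<Longrightarrow>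
      (\<Sum>(u, v)\<leftarrow>T (n + p) q (b i x y). f u v) = (\<Sum>(u, v)\<leftarrow>T p q y. f (b i x u) v)"
begin

sublocale vector_space s by (fact vs)

abbreviation lin :: "'v set \<Rightarrow> ('v \<Rightarrow> 'v) \<Rightarrow> bool" where
  "lin \<equiv> lin_on s s"

definition bil :: "nat \<Rightarrow> nat \<Rightarrow> ('v \<Rightarrow> 'v \<Rightarrow> 'v) \<Rightarrow> bool" where
  "bil k l f \<longleftrightarrow> (\<forall>u\<in>H k. lin (H l) (f u)) \<and> (\<forall>v\<in>H l. lin (H k) (\<lambda>u. f u v))"

text \<open>Sweedler notation: the sum of \<open>f\<close> over x_(1) \<otimes> x_(2) in bidegree
  (k, l).\<close>

definition Sig :: "nat \<Rightarrow> nat \<Rightarrow> ('v \<Rightarrow> 'v \<Rightarrow> 'v) \<Rightarrow> 'v \<Rightarrow> 'v" where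
  "Sig k l f x = (\<Sum>(u, v)\<leftarrow>T k l x. f u v)"

lemma bilI:
  assumes "\<And>u. u \<in> H k \<Longrightarrow> lin (H l) (f u)" "\<And>v. v \<in> H l \<Longrightarrow> lin (H k) (\<lambda>u. f u v)"
  shows "bil k l f"
  using assms by (simp add: bil_def)

lemma Sig_cong:
  assumes "x \<in> H (k + l)" "\<And>u v. u \<in> H k \<Longrightarrow> v \<in> H l \<Longrightarrow> f u v = g u v"
  shows "Sig k l f x = Sig k l g x"
  unfolding Sig_def using T_in[OF assms(1)] assms(2)
  by (intro arg_cong[where f=sum_list] map_cong) auto

lemma sum_list_in_H:
  assumes "\<And>x. x \<in> set xs \<Longrightarrow> f x \<in> H n"
  shows "(\<Sum>x\<leftarrow>xs. f x) \<in> H n"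
  using assms by (induction xs) (auto intro: H_add H_zero)

lemma Sig_in:
  assumes "x \<in> H (k + l)" "\<And>u v. u \<in> H k \<Longrightarrow> v \<in> H l \<Longrightarrow> f u v \<in> H n"
  shows "Sig k l f x \<in> H n"
  unfolding Sig_def using T_in[OF assms(1)] assms(2)
  by (intro sum_list_in_H) auto

lemma lin_zero:
  assumes "lin (H n) g" shows "g 0 = 0"
proof -
  have "g (s 0 0 + s 0 0) = s 0 (g 0) + s 0 (g 0)"
    using assms H_zero unfolding lin_on_def by blast
  then show ?thesis by simp
qed

lemma lin_sum_list:
  assumes "lin (H n) g" "\<And>x. x \<in> set xs \<Longrightarrow> f x \<in> H n"
  shows "g (\<Sum>x\<leftarrow>xs. f x) = (\<Sum>x\<leftarrow>xs. g (f x))"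
  using assms(2)
proof (induction xs)
  case Nil
  then show ?case using lin_zero[OF assms(1)] by simp
next
  case (Cons a xs)
  have "g (s 1 (f a) + s 1 (\<Sum>x\<leftarrow>xs. f x)) = s 1 (g (f a)) + s 1 (g (\<Sum>x\<leftarrow>xs. f x))"
    using Cons.prems sum_list_in_H[of xs f n] by (intro lin_onD[OF assms(1)]) auto
  then have "g (f a + (\<Sum>x\<leftarrow>xs. f x)) = g (f a) + g (\<Sum>x\<leftarrow>xs. f x)" by simp
  then show ?case using Cons by simp
qed

lemma Sig_push:
  assumes "lin (H n) g" "x \<in> H (k + l)" "\<And>u v. u \<in> H k \<Longrightarrow> v \<in> H l \<Longrightarrow> f u v \<in> H n"
  shows "g (Sig k l f x) = Sig k l (\<lambda>u v. g (f u v)) x"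
proof -
  have "g (\<Sum>p\<leftarrow>T k l x. f (fst p) (snd p)) = (\<Sum>p\<leftarrow>T k l x. g (f (fst p) (snd p)))"
    using T_in[OF assms(2)] by (intro lin_sum_list[OF assms(1)] assms(3)) auto
  then show ?thesis by (simp add: Sig_def case_prod_unfold)
qed

lemma Sig_swap:
  "Sig k l (\<lambda>u v. Sig k' l' (F u v) y) x = Sig k' l' (\<lambda>u' v'. Sig k l (\<lambda>u v. F u v u' v') x) y"
  unfolding Sig_def case_prod_unfold by (rule sum_list_swap)

lemma scale_sum_list: "s c (\<Sum>x\<leftarrow>xs. f x) = (\<Sum>x\<leftarrow>xs. s c (f x))"
  by (induction xs) (simp_all add: scale_right_distrib)

lemma lin_comp:
  assumes "lin (H n) h" "lin S g" "\<And>x. x \<in> S \<Longrightarrow> g x \<in> H n"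
  shows "lin S (\<lambda>x. h (g x))"
  using assms by (auto simp: lin_on_def)

lemma lin_id: "lin S (\<lambda>x. x)"
  by (simp add: lin_on_def)

lemma lin_Sig:
  assumes "bil k l f" shows "lin (H (k + l)) (Sig k l f)"
  using T_lin[of k l f] assms by (simp add: Sig_def[abs_def] bil_def)

text \<open>Linearity in a parameter of the summand, whereas in \<open>lin_Sig\<close> the element
  that is cut varies.\<close>

lemma lin_Sig_param:
  assumes "z \<in> H (k + l)" "\<And>u v. u \<in> H k \<Longrightarrow> v \<in> H l \<Longrightarrow> lin S (\<lambda>x. F x u v)"
  shows "lin S (\<lambda>x. Sig k l (F x) z)"
  unfolding lin_on_def
proof (intro ballI allI)
  fix x y c d assume xy: "x \<in> S" "y \<in> S"
  have "Sig k l (F (s c x + s d y)) z = Sig k l (\<lambda>u v. s c (F x u v) + s d (F y u v)) z"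
    using assms(2) xy by (intro Sig_cong[OF assms(1)]) (auto simp: lin_on_def)
  also have "\<dots> = s c (Sig k l (F x) z) + s d (Sig k l (F y) z)"
    unfolding Sig_def case_prod_unfold
    by (simp add: sum_list_addf scale_sum_list)
  finally show "Sig k l (F (s c x + s d y)) z = s c (Sig k l (F x) z) + s d (Sig k l (F y) z)" .
qed

lemma Sig_counit_left: "x \<in> H l \<Longrightarrow> Sig 0 l f x = f e x"
  by (simp add: Sig_def T_counit_left)

lemma Sig_counit_right: "x \<in> H k \<Longrightarrow> bil k 0 f \<Longrightarrow> Sig k 0 f x = f x e"
  by (simp add: Sig_def T_counit_right bil_def)

lemma Sig_coassoc:
  assumes "x \<in> H (k + l + p)"
    "\<And>u v. u \<in> H k \<Longrightarrow> v \<in> H l \<Longrightarrow> lin (H p) (F u v)"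
    "\<And>u w. u \<in> H k \<Longrightarrow> w \<in> H p \<Longrightarrow> lin (H l) (\<lambda>v. F u v w)"
    "\<And>v w. v \<in> H l \<Longrightarrow> w \<in> H p \<Longrightarrow> lin (H k) (\<lambda>u. F u v w)"
  shows "Sig (k + l) p (\<lambda>y w. Sig k l (\<lambda>u v. F u v w) y) x =
    Sig k (l + p) (\<lambda>u y. Sig l p (F u) y) x"
  using T_coassoc[OF assms] by (simp add: Sig_def)

lemma Sig_b_left:
  assumes "x \<in> H n" "y \<in> H (p + q)" "i \<le> q" "bil p (n + q) f"
  shows "Sig p (n + q) f (b (p + i) x y) = Sig p q (\<lambda>u v. f u (b i x v)) y"
  using T_b_left[OF assms(1-3), of f] assms(4) by (simp add: Sig_def bil_def)

lemma Sig_b_middle: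
  assumes "x \<in> H (k + l)" "y \<in> H (p + q)" "bil (k + p) (l + q) f"
  shows "Sig (k + p) (l + q) f (b p x y) =
    Sig k l (\<lambda>u v. Sig p q (\<lambda>u' v'. f (b p u u') (b 0 v v')) y) x"
  using T_b_middle[OF assms(1-2), of f] assms(3) by (simp add: Sig_def bil_def)

lemma Sig_b_right:
  assumes "x \<in> H n" "y \<in> H (p + q)" "i \<le> p" "bil (n + p) q f"
  shows "Sig (n + p) q f (b i x y) = Sig p q (\<lambda>u v. f (b i x u) v) y"
  using T_b_right[OF assms(1-3), of f] assms(4) by (simp add: Sig_def bil_def)

lemma b_scalar_eq:
  assumes "y \<in> H m" "i \<le> m"
  shows "b i (s c e) y = s c y"
proof -
  have "b i (s c e + s 0 e) y = s c (b i e y) + s 0 (b i e y)"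
    using b_lin1[OF assms(2,1)] unit_in unfolding lin_on_def by blast
  then show ?thesis using b_unit_left[OF assms(2,1)] by simp
qed

lemma lin_comp_b1:
  assumes "lin S g" "\<And>x. x \<in> S \<Longrightarrow> g x \<in> H n" "y \<in> H m" "i \<le> m"
  shows "lin S (\<lambda>x. b i (g x) y)"
  using lin_comp[OF b_lin1[OF assms(4,3)] assms(1,2)] .

lemma lin_comp_b2:
  assumes "lin S g" "\<And>x. x \<in> S \<Longrightarrow> g x \<in> H m" "y \<in> H n" "i \<le> m"
  shows "lin S (\<lambda>x. b i y (g x))"
  using lin_comp[OF b_lin2[OF assms(4,3)] assms(1,2)] .

section \<open>The product along an encoded shuffle\<close>

text \<open>A shuffle in \<open>Sh(n, m)\<close> is encoded by the list \<open>c\<close> of length \<open>m + 1\<close> whose entry \<open>c ! j\<close> is the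
  number of letters from \<open>{1..n}\<close> standing after exactly \<open>j\<close> letters from \<open>{n+1..n+m}\<close>.  Zero entries
  are harmless because the component of degree 0 is spanned by the unit.\<close>
fun P :: "nat \<Rightarrow> nat list \<Rightarrow> 'v \<Rightarrow> 'v \<Rightarrow> 'v" where
  "P j [] x y = b 0 x y"
| "P j (a # c) x y = Sig a (sum_list c) (\<lambda>u v. b j u (P (Suc j) c v y)) x"

lemma P_in:
  assumes "x \<in> H (sum_list c)" "y \<in> H m" "j + length c \<le> Suc m"
  shows "P j c x y \<in> H (sum_list c + m)"
  using assms
proof (induction c arbitrary: j x)
  case Nil
  then show ?case using b_in[of 0 m x 0 y] by simp
next
  case (Cons a c)
  have "b j u (P (Suc j) c v y) \<in> H (a + (sum_list c + m))" if "u \<in> H a" "v \<in> H (sum_list c)" for u v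
    using Cons that by (intro b_in) auto
  then show ?case using Cons.prems by (auto intro!: Sig_in simp: add.assoc)
qed

lemma P_lin2:
  assumes "x \<in> H (sum_list c)" "j + length c \<le> Suc m"
  shows "lin (H m) (P j c x)"
  using assms
proof (induction c arbitrary: j x)
  case Nil
  then show ?case using b_lin2[of 0 m x 0] by (simp add: lin_on_def)
next
  case (Cons a c)
  have "lin (H m) (\<lambda>y. b j u (P (Suc j) c v y))" if "u \<in> H a" "v \<in> H (sum_list c)" for u v
    using Cons that
    by (intro lin_comp_b2[where m="sum_list c + m" and n=a, OF Cons.IH] P_in) auto
  then have "lin (H m) (\<lambda>y. Sig a (sum_list c) (\<lambda>u v. b j u (P (Suc j) c v y)) x)"
    using Cons.prems by (intro lin_Sig_param) auto
  then show ?case by simp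
qed

text \<open>Linearity of the tail is a hypothesis so that the same step serves inside the induction
  for \<open>P_lin1\<close> and, once that is available, for \<open>P_bil\<close>.\<close>

lemma P_bil_step:
  assumes "\<And>v. lin (H (sum_list c)) (\<lambda>x. P (Suc j) c x y)" "y \<in> H m" "Suc j + length c \<le> Suc m"
  shows "bil a (sum_list c) (\<lambda>u v. b j u (P (Suc j) c v y))"
  using assms
  by (intro bilI b_lin1[where m="sum_list c + m"] P_in
      lin_comp_b2[where m="sum_list c + m" and n=a, OF assms(1)]) auto

lemma P_lin1:
  assumes "y \<in> H m" "j + length c \<le> Suc m"
  shows "lin (H (sum_list c)) (\<lambda>x. P j c x y)"
  using assms
proof (induction c arbitrary: j)
  case Nil
  then show ?case using b_lin1[of 0 m y 0] by simp
next
  case (Cons a c)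
  have "bil a (sum_list c) (\<lambda>u v. b j u (P (Suc j) c v y))"
    using Cons by (intro P_bil_step[where m=m]) auto
  from lin_Sig[OF this] show ?case by simp
qed

lemma P_bil:
  assumes "y \<in> H m" "Suc j + length c \<le> Suc m"
  shows "bil a (sum_list c) (\<lambda>u v. b j u (P (Suc j) c v y))"
  using assms by (intro P_bil_step[where m=m] P_lin1) auto

lemma P_single:
  assumes "x \<in> H a" "y \<in> H m" "j \<le> m"
  shows "P j [a] x y = b j x y"
proof -
  have "bil a 0 (\<lambda>u v. b j u (P (Suc j) [] v y))"
    using P_bil[where c="[]" and a=a] assms by simp
  then show ?thesis using assms by (simp add: Sig_counit_right b_unit_left)
qed

text \<open>By the left counit an empty block contributes the unit as factor.\<close>

lemma P_Cons_zero:
  assumes "x \<in> H (sum_list c)" "y \<in> H m" "Suc j + length c \<le> Suc m"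
  shows "P j (0 # c) x y = P (Suc j) c x y"
proof -
  have "P (Suc j) c x y \<in> H (sum_list c + m)" by (rule P_in) (use assms in auto)
  then show ?thesis using assms by (simp add: Sig_counit_left b_unit_left[where m="sum_list c + m"])
qed

lemma lin_comp_P1:
  assumes "lin S g" "\<And>x. x \<in> S \<Longrightarrow> g x \<in> H (sum_list c)" "y \<in> H m" "j + length c \<le> Suc m"
  shows "lin S (\<lambda>x. P j c (g x) y)"
  using lin_comp[OF P_lin1[OF assms(3,4)] assms(1,2)] .

lemma lin_comp_P2:
  assumes "lin S g" "\<And>x. x \<in> S \<Longrightarrow> g x \<in> H m" "y \<in> H (sum_list c)" "j + length c \<le> Suc m"
  shows "lin S (\<lambda>x. P j c y (g x))"
  using lin_comp[OF P_lin2[OF assms(3,4)] assms(1,2)] .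

text \<open>Coassociativity in iterated form. Peeling off first factors nests to the right; one use
  of coassociativity regroups a | (k | l) as (a | k) | l.\<close>

lemma P_append:
  assumes "x \<in> H (sum_list c + sum_list c')" "y \<in> H m" "j + length c + length c' \<le> Suc m"
  shows "P j (c @ c') x y =
    Sig (sum_list c) (sum_list c') (\<lambda>u v. P j c u (P (j + length c) c' v y)) x"
  using assms
proof (induction c arbitrary: j x)
  case Nil
  have "P j c' x y \<in> H (sum_list c' + m)" by (rule P_in) (use Nil in auto)
  then show ?case using Nil by (simp add: Sig_counit_left b_unit_left)
next
  case (Cons a c)
  let ?k = "sum_list c" and ?l = "sum_list c'" and ?j = "Suc (j + length c)"
  have Q_in: "P ?j c' v y \<in> H (?l + m)" if "v \<in> H ?l" for v
    using Cons.prems that by (intro P_in) auto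
  have Q_lin: "lin (H ?l) (\<lambda>v. P ?j c' v y)"
    using Cons.prems by (intro P_lin1) auto
  have R_in: "P (Suc j) c u (P ?j c' v y) \<in> H (?k + (?l + m))" if "u \<in> H ?k" "v \<in> H ?l" for u v
    using Cons.prems that by (intro P_in Q_in) auto
  have "P j ((a # c) @ c') x y = Sig a (?k + ?l) (\<lambda>u v. b j u (P (Suc j) (c @ c') v y)) x"
    by simp
  also have "\<dots> = Sig a (?k + ?l) (\<lambda>u v. Sig ?k ?l (\<lambda>v w. b j u (P (Suc j) c v (P ?j c' w y))) v) x"
  proof (rule Sig_cong)
    show "x \<in> H (a + (?k + ?l))" using Cons.prems by (simp add: add.assoc)
    fix u v assume uv: "u \<in> H a" "v \<in> H (?k + ?l)"
    have "P (Suc j) (c @ c') v y = Sig ?k ?l (\<lambda>v w. P (Suc j) c v (P ?j c' w y)) v"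
      using Cons.IH[of v "Suc j"] Cons.prems uv by simp
    moreover have "b j u (Sig ?k ?l (\<lambda>v w. P (Suc j) c v (P ?j c' w y)) v) =
        Sig ?k ?l (\<lambda>v w. b j u (P (Suc j) c v (P ?j c' w y))) v"
      using uv Cons.prems
      by (intro Sig_push[where g="b j u" and n="?k + (?l + m)"] b_lin2 R_in) auto
    ultimately show "b j u (P (Suc j) (c @ c') v y) =
        Sig ?k ?l (\<lambda>v w. b j u (P (Suc j) c v (P ?j c' w y))) v"
      by (rule trans[OF arg_cong])
  qed
  also have "\<dots> = Sig (a + ?k) ?l (\<lambda>z w. Sig a ?k (\<lambda>u v. b j u (P (Suc j) c v (P ?j c' w y))) z) x"
  proof (rule Sig_coassoc[symmetric])
    show "x \<in> H (a + ?k + ?l)" using Cons.prems by simp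
  next
    fix u v assume uv: "u \<in> H a" "v \<in> H ?k"
    show "lin (H ?l) (\<lambda>w. b j u (P (Suc j) c v (P ?j c' w y)))"
    proof (rule lin_comp_b2[OF lin_comp_P2[OF Q_lin Q_in uv(2)] _ uv(1)])
      fix w assume "w \<in> H ?l"
      then show "P (Suc j) c v (P ?j c' w y) \<in> H (?k + (?l + m))" by (rule R_in[OF uv(2)])
    qed (use Cons.prems in auto)
  next
    fix u w assume uw: "u \<in> H a" "w \<in> H ?l"
    show "lin (H ?k) (\<lambda>v. b j u (P (Suc j) c v (P ?j c' w y)))"
    proof (rule lin_comp_b2[OF lin_comp_P1[OF lin_id _ Q_in[OF uw(2)]] _ uw(1)])
      fix v assume "v \<in> H ?k"
      then show "P (Suc j) c v (P ?j c' w y) \<in> H (?k + (?l + m))" using R_in uw(2) by blast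
    qed (use Cons.prems in auto)
  next
    fix v w assume vw: "v \<in> H ?k" "w \<in> H ?l"
    show "lin (H a) (\<lambda>u. b j u (P (Suc j) c v (P ?j c' w y)))"
      by (rule lin_comp_b1[OF lin_id _ R_in[OF vw]]) (use Cons.prems in auto)
  qed
  finally show ?case by (simp only: P.simps sum_list.Cons list.size One_nat_def add_Suc_right add_0_right)
qed

section \<open>Coproduct of the product along an encoded shuffle\<close>

lemma Sig_push_Sig:
  assumes "bil k l f" "x \<in> H (p + q)" "\<And>u v. u \<in> H p \<Longrightarrow> v \<in> H q \<Longrightarrow> g u v \<in> H (k + l)"
  shows "Sig k l f (Sig p q g x) = Sig p q (\<lambda>u v. Sig k l f (g u v)) x"
  using Sig_push[OF lin_Sig[OF assms(1)] assms(2,3)] .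

lemma bil_lin1: "bil k l f \<Longrightarrow> v \<in> H l \<Longrightarrow> lin (H k) (\<lambda>u. f u v)"
  and bil_lin2: "bil k l f \<Longrightarrow> u \<in> H k \<Longrightarrow> lin (H l) (f u)"
  by (auto simp: bil_def)

lemma bil_compose:
  assumes "bil k l f" "lin (H k') g" "lin (H l') h"
    "\<And>u. u \<in> H k' \<Longrightarrow> g u \<in> H k" "\<And>v. v \<in> H l' \<Longrightarrow> h v \<in> H l"
  shows "bil k' l' (\<lambda>u v. f (g u) (h v))"
proof (rule bilI)
  fix u assume "u \<in> H k'"
  with assms show "lin (H l') (\<lambda>v. f (g u) (h v))"
    by (intro lin_comp[OF bil_lin2[OF assms(1)]]) auto
next
  fix v assume "v \<in> H l'"
  with assms show "lin (H k') (\<lambda>u. f (g u) (h v))"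
    by (intro lin_comp[OF bil_lin1[OF assms(1)]]) auto
qed

text \<open>When at least p letters of y precede all of x, a cut after p letters meets only y.
  \<open>Sig_b_left\<close> passes the blocks of x to the right one at a time; a block already
  passed is absorbed into the second argument of \<open>f\<close>, hence \<open>f\<close> is
  arbitrary in the induction.\<close>

lemma Sig_P_left:
  assumes "x \<in> H (sum_list c)" "y \<in> H (p + q)" "j + length c \<le> Suc q" "bil p (sum_list c + q) f"
  shows "Sig p (sum_list c + q) f (P (p + j) c x y) = Sig p q (\<lambda>u v. f u (P j c x v)) y"
  using assms
proof (induction c arbitrary: j x f)
  case Nil
  then obtain c where c: "x = s c e" using H0 by auto
  have "Sig p (0 + q) f (b 0 x y) = Sig p q (\<lambda>u v. f u (b 0 x v)) y"
  proof -
    \<comment> \<open>A multiple of the unit may be inserted anywhere; this gives the index the form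
      that \<open>Sig_b_left\<close> expects.\<close>
    have "b 0 x y = b (p + 0) x y"
      using Nil c b_scalar_eq[of y "p + q"] by simp
    then show ?thesis using Sig_b_left[of x 0 y p q 0 f] Nil by simp
  qed
  then show ?case by simp
next
  case (Cons a c)
  let ?n = "sum_list c"
  let ?P = "\<lambda>v. P (Suc (p + j)) c v y"
  have P_in': "?P v \<in> H (?n + (p + q))" if "v \<in> H ?n" for v
    using Cons.prems that by (intro P_in) auto
  have f: "bil p (a + (?n + q)) f" using Cons.prems by (simp add: add.assoc)
  have "Sig p (sum_list (a # c) + q) f (P (p + j) (a # c) x y) =
      Sig p (a + (?n + q)) f (Sig a ?n (\<lambda>u v. b (p + j) u (?P v)) x)"
    by (simp add: add.assoc)
  also have "\<dots> = Sig a ?n (\<lambda>u v. Sig p (a + (?n + q)) f (b (p + j) u (?P v))) x"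
  proof (rule Sig_push_Sig[OF f])
    fix u v assume uv: "u \<in> H a" "v \<in> H ?n"
    have "b (p + j) u (?P v) \<in> H (a + (?n + (p + q)))"
      using Cons.prems by (intro b_in uv P_in') auto
    then show "b (p + j) u (?P v) \<in> H (p + (a + (?n + q)))" by (simp add: algebra_simps)
  qed (use Cons.prems in auto)
  also have "\<dots> = Sig a ?n (\<lambda>u v. Sig p q (\<lambda>y z. f y (b j u (P (Suc j) c v z))) y) x"
  proof (rule Sig_cong)
    fix u v assume uv: "u \<in> H a" "v \<in> H ?n"
    have "Sig p (a + (?n + q)) f (b (p + j) u (?P v)) = Sig p (?n + q) (\<lambda>y z. f y (b j u z)) (?P v)"
      using Cons.prems P_in'[OF uv(2)]
      by (intro Sig_b_left uv f) (auto simp: algebra_simps)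
    also have "bil p (?n + q) (\<lambda>y z. f y (b j u z))"
      using Cons.prems uv
      by (intro bil_compose[OF f] lin_id b_in b_lin2[where n=a]) auto
    then have "Sig p (?n + q) (\<lambda>y z. f y (b j u z)) (?P v) =
        Sig p q (\<lambda>y z. f y (b j u (P (Suc j) c v z))) y"
      using Cons.IH[of v "Suc j" "\<lambda>y z. f y (b j u z)"] Cons.prems uv by simp
    finally show "Sig p (a + (?n + q)) f (b (p + j) u (?P v)) =
        Sig p q (\<lambda>y z. f y (b j u (P (Suc j) c v z))) y" .
  qed (use Cons.prems in auto)
  also have "\<dots> = Sig p q (\<lambda>y z. Sig a ?n (\<lambda>u v. f y (b j u (P (Suc j) c v z))) x) y"
    by (rule Sig_swap)
  also have "\<dots> = Sig p q (\<lambda>y z. f y (P j (a # c) x z)) y"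
  proof (rule Sig_cong)
    fix y z assume yz: "y \<in> H p" "z \<in> H q"
    have "f y (Sig a ?n (\<lambda>u v. b j u (P (Suc j) c v z)) x) =
        Sig a ?n (\<lambda>u v. f y (b j u (P (Suc j) c v z))) x"
      using Cons.prems yz
      by (intro Sig_push[OF bil_lin2[OF f]] b_in P_in) auto
    then show "Sig a ?n (\<lambda>u v. f y (b j u (P (Suc j) c v z))) x = f y (P j (a # c) x z)" by simp
  qed (use Cons.prems in auto)
  finally show ?case .
qed

lemma lin_comp_bil1:
  assumes "bil k l f" "lin S g" "\<And>x. x \<in> S \<Longrightarrow> g x \<in> H k" "v \<in> H l"
  shows "lin S (\<lambda>x. f (g x) v)"
  using lin_comp[OF bil_lin1[OF assms(1,4)] assms(2,3)] .

lemma lin_comp_bil2: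
  assumes "bil k l f" "lin S g" "\<And>x. x \<in> S \<Longrightarrow> g x \<in> H l" "u \<in> H k"
  shows "lin S (\<lambda>x. f u (g x))"
  using lin_comp[OF bil_lin2[OF assms(1,4)] assms(2,3)] .

text \<open>The first block stands after exactly p letters of y and is cut into k and l by
  \<open>Sig_b_middle\<close>. All later blocks lie beyond the cut and pass to the right by
  \<open>Sig_P_left\<close>.\<close>

lemma Sig_P_at_head:
  assumes x: "x \<in> H (k + l + sum_list c)" and y: "y \<in> H (p + q)" and c: "length c \<le> q"
    and f: "bil (k + p) (l + sum_list c + q) f"
  shows "Sig (k + p) (l + sum_list c + q) f (P p ((k + l) # c) x y) =
    Sig k (l + sum_list c) (\<lambda>u v. Sig p q (\<lambda>y z. f (P p [k] u y) (P 0 (l # c) v z)) y) x"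
proof -
  let ?n = "sum_list c"
  let ?P = "\<lambda>v. P (Suc p) c v y"
  let ?Q = "\<lambda>v z. P (Suc 0) c v z"
  have P_in': "?P v \<in> H (p + (?n + q))" if "v \<in> H ?n" for v
  proof -
    have "?P v \<in> H (?n + (p + q))" using that y c by (intro P_in) auto
    then show ?thesis by (simp add: algebra_simps)
  qed
  have Q_in: "?Q v z \<in> H (?n + q)" if "v \<in> H ?n" "z \<in> H q" for v z
    using that c by (intro P_in) auto
  have bQ_in: "b 0 u (?Q v z) \<in> H (l + (?n + q))" if "u \<in> H l" "v \<in> H ?n" "z \<in> H q" for u v z
    using that by (intro b_in Q_in) auto
  have bp_in: "b p u z \<in> H (k + p)" if "u \<in> H k" "z \<in> H p" for u z
    using that by (intro b_in) auto
  have f': "bil (k + p) (l + (?n + q)) f" using f by (simp add: add.assoc)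
  have "Sig (k + p) (l + ?n + q) f (P p ((k + l) # c) x y) =
      Sig (k + p) (l + (?n + q)) f (Sig (k + l) ?n (\<lambda>u v. b p u (?P v)) x)"
    by (simp add: add.assoc)
  also have "\<dots> = Sig (k + l) ?n (\<lambda>u v. Sig (k + p) (l + (?n + q)) f (b p u (?P v))) x"
  proof (rule Sig_push_Sig[OF f' x])
    fix u v assume uv: "u \<in> H (k + l)" "v \<in> H ?n"
    have "b p u (?P v) \<in> H ((k + l) + (p + (?n + q)))" by (intro b_in uv P_in') auto
    then show "b p u (?P v) \<in> H ((k + p) + (l + (?n + q)))" by (simp add: algebra_simps)
  qed
  also have "\<dots> = Sig (k + l) ?n (\<lambda>w v. Sig k l (\<lambda>u u'. Sig p q (\<lambda>y z.
      f (b p u y) (b 0 u' (?Q v z))) y) w) x"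
  proof (rule Sig_cong[OF x])
    fix w v assume wv: "w \<in> H (k + l)" "v \<in> H ?n"
    have "Sig (k + p) (l + (?n + q)) f (b p w (?P v)) =
        Sig k l (\<lambda>u u'. Sig p (?n + q) (\<lambda>y z. f (b p u y) (b 0 u' z)) (?P v)) w"
      by (intro Sig_b_middle wv P_in' f')
    also have "\<dots> = Sig k l (\<lambda>u u'. Sig p q (\<lambda>y z. f (b p u y) (b 0 u' (?Q v z))) y) w"
    proof (rule Sig_cong[OF wv(1)])
      fix u u' assume u: "u \<in> H k" "u' \<in> H l"
      have "bil p (?n + q) (\<lambda>y z. f (b p u y) (b 0 u' z))"
        using u by (intro bil_compose[OF f'] b_lin2[where n=l] b_lin2[where n=k] b_in lin_id) auto
      \<comment> \<open>The tail begins at \<open>Suc p\<close>, one letter of y beyond the cut,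
        hence at index 1 on the right.\<close>
      then show "Sig p (?n + q) (\<lambda>y z. f (b p u y) (b 0 u' z)) (?P v) =
          Sig p q (\<lambda>y z. f (b p u y) (b 0 u' (?Q v z))) y"
        using Sig_P_left[OF wv(2) y, of 1] c by simp
    qed
    finally show "Sig (k + p) (l + (?n + q)) f (b p w (?P v)) =
        Sig k l (\<lambda>u u'. Sig p q (\<lambda>y z. f (b p u y) (b 0 u' (?Q v z))) y) w" .
  qed
  \<comment> \<open>Coassociativity attaches the second half of the cut block to the tail, where it
    becomes the head of \<open>l # c'\<close>.\<close>
  also have "\<dots> = Sig k (l + ?n) (\<lambda>u w. Sig l ?n (\<lambda>u' v. Sig p q (\<lambda>y z.
      f (b p u y) (b 0 u' (?Q v z))) y) w) x"
  proof (rule Sig_coassoc[OF x])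
    fix u u' assume u: "u \<in> H k" "u' \<in> H l"
    show "lin (H ?n) (\<lambda>v. Sig p q (\<lambda>y z. f (b p u y) (b 0 u' (?Q v z))) y)"
    proof (rule lin_Sig_param[OF y])
      fix y z assume yz: "y \<in> H p" "z \<in> H q"
      show "lin (H ?n) (\<lambda>v. f (b p u y) (b 0 u' (?Q v z)))"
        by (intro lin_comp_bil2[OF f' lin_comp_b2[OF lin_comp_P1[OF lin_id _ yz(2)] Q_in[OF _ yz(2)] u(2)]]
            bQ_in bp_in u yz) (use c in auto)
    qed
  next
    fix u v assume u: "u \<in> H k" "v \<in> H ?n"
    show "lin (H l) (\<lambda>u'. Sig p q (\<lambda>y z. f (b p u y) (b 0 u' (?Q v z))) y)"
    proof (rule lin_Sig_param[OF y])
      fix y z assume yz: "y \<in> H p" "z \<in> H q"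
      show "lin (H l) (\<lambda>u'. f (b p u y) (b 0 u' (?Q v z)))"
        by (intro lin_comp_bil2[OF f' lin_comp_b1[OF lin_id _ Q_in[OF u(2) yz(2)]]]
            bQ_in bp_in u yz) auto
    qed
  next
    fix u' v assume u: "u' \<in> H l" "v \<in> H ?n"
    show "lin (H k) (\<lambda>u. Sig p q (\<lambda>y z. f (b p u y) (b 0 u' (?Q v z))) y)"
    proof (rule lin_Sig_param[OF y])
      fix y z assume yz: "y \<in> H p" "z \<in> H q"
      show "lin (H k) (\<lambda>u. f (b p u y) (b 0 u' (?Q v z)))"
        by (intro lin_comp_bil1[OF f' lin_comp_b1[OF lin_id _ yz(1)]] bQ_in bp_in u yz) auto
    qed
  qed
  also have "\<dots> = Sig k (l + ?n) (\<lambda>u v. Sig p q (\<lambda>y z. f (P p [k] u y) (P 0 (l # c) v z)) y) x"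
  proof (rule Sig_cong)
    show "x \<in> H (k + (l + ?n))" using x by (simp add: add.assoc)
    fix u w assume u: "u \<in> H k" "w \<in> H (l + ?n)"
    have "Sig l ?n (\<lambda>u' v. Sig p q (\<lambda>y z. f (b p u y) (b 0 u' (?Q v z))) y) w =
        Sig p q (\<lambda>y z. Sig l ?n (\<lambda>u' v. f (b p u y) (b 0 u' (?Q v z))) w) y"
      by (rule Sig_swap)
    also have "\<dots> = Sig p q (\<lambda>y z. f (P p [k] u y) (P 0 (l # c) w z)) y"
    proof (rule Sig_cong[OF y])
      fix y z assume yz: "y \<in> H p" "z \<in> H q"
      have "f (b p u y) (Sig l ?n (\<lambda>u' v. b 0 u' (?Q v z)) w) =
          Sig l ?n (\<lambda>u' v. f (b p u y) (b 0 u' (?Q v z))) w"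
        by (intro Sig_push[OF bil_lin2[OF f']] bQ_in bp_in u yz)
      then show "Sig l ?n (\<lambda>u' v. f (b p u y) (b 0 u' (?Q v z))) w =
          f (P p [k] u y) (P 0 (l # c) w z)"
        using P_single[OF u(1) yz(1), of p] by (simp del: P.simps(2) add: P.simps(2)[of 0 l c])
    qed
    finally show "Sig l ?n (\<lambda>u' v. Sig p q (\<lambda>y z. f (b p u y) (b 0 u' (?Q v z))) y) w =
        Sig p q (\<lambda>y z. f (P p [k] u y) (P 0 (l # c) w z)) y" .
  qed
  finally show ?thesis .
qed

text \<open>The general cut: p letters of y lie before it, and the entry of index p in the absolute
  count is divided into k and l. As k and l may be zero, every cut of the word has this form. Blocks
  before the cut are peeled off to the left by \<open>Sig_b_right\<close> until the divided block is
  the head.\<close>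

lemma Sig_P:
  assumes "x \<in> H (sum_list c + (k + l) + sum_list c')" "y \<in> H (p + q)"
    and "p = j + length c" "length c' \<le> q"
    and "bil (sum_list c + k + p) (l + sum_list c' + q) f"
  shows "Sig (sum_list c + k + p) (l + sum_list c' + q) f (P j (c @ (k + l) # c') x y) =
    Sig (sum_list c + k) (l + sum_list c')
      (\<lambda>u v. Sig p q (\<lambda>y z. f (P j (c @ [k]) u y) (P 0 (l # c') v z)) y) x"
  using assms
proof (induction c arbitrary: j x f)
  case Nil
  then show ?case using Sig_P_at_head[of x k l c' y p q f] by simp
next
  case (Cons a c)
  let ?k = "sum_list c + k" and ?l = "l + sum_list c'"
  let ?P = "\<lambda>v. P (Suc j) (c @ (k + l) # c') v y"
  let ?Q = "\<lambda>v y. P (Suc j) (c @ [k]) v y"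
  let ?R = "\<lambda>v z. P 0 (l # c') v z"
  note y = Cons.prems(2)
  have x: "x \<in> H (a + (?k + ?l))" using Cons.prems(1) by (simp add: algebra_simps)
  have f: "bil (a + (?k + p)) (?l + q) f" using Cons.prems(5) by (simp add: algebra_simps)
  have P_in': "?P v \<in> H ((?k + p) + (?l + q))" if "v \<in> H (?k + ?l)" for v
  proof -
    have "?P v \<in> H (sum_list (c @ (k + l) # c') + (p + q))"
      using that Cons.prems by (intro P_in) (auto simp: algebra_simps)
    then show ?thesis by (simp add: algebra_simps)
  qed
  have Q_in: "?Q v y \<in> H (?k + p)" if "v \<in> H ?k" "y \<in> H p" for v y
  proof -
    have "?Q v y \<in> H (sum_list (c @ [k]) + p)"
      using that Cons.prems by (intro P_in) auto
    then show ?thesis by simp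
  qed
  have bQ_in: "b j u (?Q v y) \<in> H (a + (?k + p))" if "u \<in> H a" "v \<in> H ?k" "y \<in> H p" for u v y
    using that Cons.prems by (intro b_in Q_in) auto
  have R_in: "?R v z \<in> H (?l + q)" if "v \<in> H ?l" "z \<in> H q" for v z
  proof -
    have "?R v z \<in> H (sum_list (l # c') + q)"
      using that Cons.prems by (intro P_in) auto
    then show ?thesis by simp
  qed
  have "Sig (sum_list (a # c) + k + p) (l + sum_list c' + q) f (P j ((a # c) @ (k + l) # c') x y) =
      Sig (a + (?k + p)) (?l + q) f (Sig a (?k + ?l) (\<lambda>u v. b j u (?P v)) x)"
    by (simp add: algebra_simps)
  also have "\<dots> = Sig a (?k + ?l) (\<lambda>u v. Sig (a + (?k + p)) (?l + q) f (b j u (?P v))) x"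
  proof (rule Sig_push_Sig[OF f x])
    fix u v assume uv: "u \<in> H a" "v \<in> H (?k + ?l)"
    have "b j u (?P v) \<in> H (a + ((?k + p) + (?l + q)))"
      using Cons.prems by (intro b_in uv P_in') auto
    then show "b j u (?P v) \<in> H (a + (?k + p) + (?l + q))" by (simp add: algebra_simps)
  qed
  also have "\<dots> = Sig a (?k + ?l) (\<lambda>u w. Sig ?k ?l (\<lambda>v v'. Sig p q (\<lambda>y z.
      f (b j u (?Q v y)) (?R v' z)) y) w) x"
  proof (rule Sig_cong[OF x])
    fix u w assume uw: "u \<in> H a" "w \<in> H (?k + ?l)"
    \<comment> \<open>The block \<open>u\<close> lies before the cut, so it is absorbed into the
      left argument of the test map before the induction hypothesis is used.\<close>
    let ?f = "\<lambda>y z. f (b j u y) z"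
    have "Sig (a + (?k + p)) (?l + q) f (b j u (?P w)) = Sig (?k + p) (?l + q) ?f (?P w)"
      using Cons.prems by (intro Sig_b_right uw P_in' f) auto
    also have "bil (?k + p) (?l + q) ?f"
      using Cons.prems uw by (intro bil_compose[OF f] b_lin2[where n=a] b_in lin_id) auto
    then have "Sig (?k + p) (?l + q) ?f (?P w) =
        Sig ?k ?l (\<lambda>v v'. Sig p q (\<lambda>y z. ?f (?Q v y) (?R v' z)) y) w"
      by (intro Cons.IH) (use Cons.prems uw in \<open>auto simp: algebra_simps\<close>)
    finally show "Sig (a + (?k + p)) (?l + q) f (b j u (?P w)) =
        Sig ?k ?l (\<lambda>v v'. Sig p q (\<lambda>y z. f (b j u (?Q v y)) (?R v' z)) y) w" .
  qed
  \<comment> \<open>Coassociativity joins the block just peeled off to the rest of the left part of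
    x.\<close>
  also have "\<dots> = Sig (a + ?k) ?l (\<lambda>w v'. Sig a ?k (\<lambda>u v. Sig p q (\<lambda>y z.
      f (b j u (?Q v y)) (?R v' z)) y) w) x"
  proof (rule Sig_coassoc[symmetric])
    show "x \<in> H (a + ?k + ?l)" using x by (simp add: add.assoc)
  next
    fix u v assume u: "u \<in> H a" "v \<in> H ?k"
    show "lin (H ?l) (\<lambda>v'. Sig p q (\<lambda>y z. f (b j u (?Q v y)) (?R v' z)) y)"
    proof (rule lin_Sig_param[OF y])
      fix y z assume yz: "y \<in> H p" "z \<in> H q"
      have "lin (H ?l) (\<lambda>v'. ?R v' z)"
        using P_lin1[OF yz(2), of 0 "l # c'"] Cons.prems by simp
      then show "lin (H ?l) (\<lambda>v'. f (b j u (?Q v y)) (?R v' z))"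
        by (intro lin_comp_bil2[OF f] R_in bQ_in u yz)
    qed
  next
    fix u v' assume u: "u \<in> H a" "v' \<in> H ?l"
    show "lin (H ?k) (\<lambda>v. Sig p q (\<lambda>y z. f (b j u (?Q v y)) (?R v' z)) y)"
    proof (rule lin_Sig_param[OF y])
      fix y z assume yz: "y \<in> H p" "z \<in> H q"
      have "lin (H ?k) (\<lambda>v. ?Q v y)"
        using P_lin1[OF yz(1), of "Suc j" "c @ [k]"] Cons.prems by simp
      then show "lin (H ?k) (\<lambda>v. f (b j u (?Q v y)) (?R v' z))"
        using Cons.prems
        by (intro lin_comp_bil1[OF f lin_comp_b2[OF _ Q_in u(1)]] R_in bQ_in u yz) auto
    qed
  next
    fix v v' assume u: "v \<in> H ?k" "v' \<in> H ?l"
    show "lin (H a) (\<lambda>u. Sig p q (\<lambda>y z. f (b j u (?Q v y)) (?R v' z)) y)"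
    proof (rule lin_Sig_param[OF y])
      fix y z assume yz: "y \<in> H p" "z \<in> H q"
      show "lin (H a) (\<lambda>u. f (b j u (?Q v y)) (?R v' z))"
        using Cons.prems
        by (intro lin_comp_bil1[OF f lin_comp_b1[OF lin_id _ Q_in]] R_in bQ_in u yz) auto
    qed
  qed
  also have "\<dots> = Sig (a + ?k) ?l (\<lambda>w v'. Sig p q (\<lambda>y z. f (P j (a # c @ [k]) w y) (?R v' z)) y) x"
  proof (rule Sig_cong)
    show "x \<in> H (a + ?k + ?l)" using x by (simp add: add.assoc)
    fix w v' assume u: "w \<in> H (a + ?k)" "v' \<in> H ?l"
    have "Sig a ?k (\<lambda>u v. Sig p q (\<lambda>y z. f (b j u (?Q v y)) (?R v' z)) y) w =
        Sig p q (\<lambda>y z. Sig a ?k (\<lambda>u v. f (b j u (?Q v y)) (?R v' z)) w) y"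
      by (rule Sig_swap)
    also have "\<dots> = Sig p q (\<lambda>y z. f (P j (a # c @ [k]) w y) (?R v' z)) y"
    proof (rule Sig_cong[OF y])
      fix y z assume yz: "y \<in> H p" "z \<in> H q"
      have "f (Sig a ?k (\<lambda>u v. b j u (?Q v y)) w) (?R v' z) =
          Sig a ?k (\<lambda>u v. f (b j u (?Q v y)) (?R v' z)) w"
        by (intro Sig_push[OF bil_lin1[OF f]] R_in bQ_in u yz)
      then show "Sig a ?k (\<lambda>u v. f (b j u (?Q v y)) (?R v' z)) w =
          f (P j (a # c @ [k]) w y) (?R v' z)"
        by simp
    qed
    finally show "Sig a ?k (\<lambda>u v. Sig p q (\<lambda>y z. f (b j u (?Q v y)) (?R v' z)) y) w =
        Sig p q (\<lambda>y z. f (P j (a # c @ [k]) w y) (?R v' z)) y" .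
  qed
  finally show ?case by (simp add: add.assoc)
qed

section \<open>Associativity of the products\<close>

text \<open>The preshuffle relation applied to each block in turn: inserting the whole product into
  w at j shifts the index of every block by j.\<close>

lemma b_P:
  assumes "x \<in> H (sum_list c)" "y \<in> H m" "w \<in> H q" "i + length c \<le> Suc m" "j \<le> q" "i \<le> m"
  shows "b j (P i c x y) w = P (i + j) c x (b j y w)"
  using assms
proof (induction c arbitrary: i x)
  case Nil
  then show ?case using b_assoc[of x 0 y m w q 0 j] Nil.prems(1) H0[of x]
      b_scalar_eq[of "b j y w" "m + q"] b_in[of j q y m w] by auto
next
  case (Cons a c)
  let ?n = "sum_list c"
  let ?P = "\<lambda>v. P (Suc i) c v y"
  have x: "x \<in> H (a + ?n)" using Cons.prems by simp
  have P_in': "?P v \<in> H (?n + m)" if "v \<in> H ?n" for v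
    using that Cons.prems by (intro P_in) auto
  have "b j (Sig a ?n (\<lambda>u v. b i u (?P v)) x) w = Sig a ?n (\<lambda>u v. b j (b i u (?P v)) w) x"
    using Cons.prems
    by (intro Sig_push[where g="\<lambda>z. b j z w" and n="a + (?n + m)"] b_lin1[where m=q] x b_in P_in') auto
  also have "\<dots> = Sig a ?n (\<lambda>u v. b (i + j) u (P (Suc (i + j)) c v (b j y w))) x"
  proof (rule Sig_cong[OF x])
    fix u v assume uv: "u \<in> H a" "v \<in> H ?n"
    have "b j (b i u (?P v)) w = b (i + j) u (b j (?P v) w)"
      using Cons.prems by (intro b_assoc[OF uv(1) P_in'[OF uv(2)]]) auto
    also have "b j (?P v) w = P (Suc (i + j)) c v (b j y w)"
    proof (cases "Suc i \<le> m")
      case True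
      then show ?thesis using Cons.IH[of v "Suc i"] Cons.prems uv by simp
    next
      case False
      \<comment> \<open>A product along \<open>[]\<close> does not depend on its index, so the
        induction hypothesis is taken at index 0, where its bound holds.\<close>
      then have "c = []" using Cons.prems by (cases c) auto
      then show ?thesis using Cons.IH[of v 0] Cons.prems uv by simp
    qed
    finally show "b j (b i u (?P v)) w = b (i + j) u (P (Suc (i + j)) c v (b j y w))" .
  qed
  finally show ?case by simp
qed

text \<open>The grafting relation applied to each block in turn: all blocks of x stand to the right
  of position j, so y can be inserted first, and its m letters shift their indices.\<close>

lemma b_P_commute:
  assumes "x \<in> H (sum_list c)" "y \<in> H m" "w \<in> H q" "k + length c \<le> Suc q" "j < k" "j \<le> q"
  shows "b j y (P k c x w) = P (k + m) c x (b j y w)"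
  using assms
proof (induction c arbitrary: k x)
  case Nil
  then obtain c where c: "x = s c e" using H0 by auto
  have "b j y (s c w + s 0 w) = s c (b j y w) + s 0 (b j y w)"
    using Nil by (intro lin_onD[OF lin_comp_b2[OF lin_id _ Nil.prems(2)]]) auto
  then have "b j y (s c w) = s c (b j y w)" by simp
  then show ?case using Nil b_scalar_eq[of w q 0 c] b_scalar_eq[of "b j y w" "m + q" 0 c]
      b_in[of j q y m w] c by simp
next
  case (Cons a c)
  let ?n = "sum_list c"
  let ?P = "\<lambda>v. P (Suc k) c v w"
  have x: "x \<in> H (a + ?n)" using Cons.prems by simp
  have P_in': "?P v \<in> H (?n + q)" if "v \<in> H ?n" for v
    using that Cons.prems by (intro P_in) auto
  have "b j y (Sig a ?n (\<lambda>u v. b k u (?P v)) x) = Sig a ?n (\<lambda>u v. b j y (b k u (?P v))) x"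
    using Cons.prems
    by (intro Sig_push[where g="b j y" and n="a + (?n + q)"] b_lin2[OF _ Cons.prems(2)]
        x b_in P_in') auto
  also have "\<dots> = Sig a ?n (\<lambda>u v. b (k + m) u (P (Suc (k + m)) c v (b j y w))) x"
  proof (rule Sig_cong[OF x])
    fix u v assume uv: "u \<in> H a" "v \<in> H ?n"
    have "b j y (b k u (?P v)) = b (k + m) u (b j y (?P v))"
      using Cons.prems by (intro b_graft[OF _ uv(1) P_in'[OF uv(2)]]) auto
    also have "b j y (?P v) = P (Suc (k + m)) c v (b j y w)"
      using Cons.IH[of v "Suc k"] Cons.prems uv by simp
    finally show "b j y (b k u (?P v)) = b (k + m) u (P (Suc (k + m)) c v (b j y w))" .
  qed
  finally show ?case by simp
qed

lemma P_unit:
  assumes "sum_list c = 0" "y \<in> H m" "j + length c \<le> Suc m"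
  shows "P j c e y = y"
  using assms
proof (induction c arbitrary: j)
  case Nil
  then show ?case by (simp add: b_unit_left)
next
  case (Cons a c)
  then have c: "a = 0" "sum_list c = 0" by auto
  have "P j (0 # c) e y = P (Suc j) c e y"
    using Cons.prems unit_in by (intro P_Cons_zero[where m=m]) (auto simp only: c list.size)
  also have "\<dots> = y" using Cons.IH[OF c(2) Cons.prems(2)] Cons.prems(3) by simp
  finally show ?case by (simp only: c)
qed

lemma P_append_bil:
  assumes "y \<in> H m" "j + length c + length c' \<le> Suc m"
  shows "bil (sum_list c) (sum_list c') (\<lambda>u v. P j c u (P (j + length c) c' v y))"
proof (rule bilI)
  fix u assume "u \<in> H (sum_list c)"
  then show "lin (H (sum_list c')) (\<lambda>v. P j c u (P (j + length c) c' v y))"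
    using assms by (intro lin_comp_P2[where m="sum_list c' + m"] P_lin1 P_in) auto
next
  fix v assume "v \<in> H (sum_list c')"
  then show "lin (H (sum_list c)) (\<lambda>u. P j c u (P (j + length c) c' v y))"
    using assms by (intro P_lin1[where m="sum_list c' + m"] P_in) auto
qed

text \<open>The right counit gives the empty blocks at the end the unit as their common
  factor.\<close>

lemma P_append_zeros:
  assumes "sum_list c' = 0" "x \<in> H (sum_list c)" "y \<in> H m" "j + length c + length c' \<le> Suc m"
  shows "P j (c @ c') x y = P j c x y"
proof -
  have x: "x \<in> H (sum_list c + sum_list c')" unfolding assms(1) using assms(2) by simp
  have "P j (c @ c') x y = P j c x (P (j + length c) c' e y)"
    using P_append[OF x assms(3,4)] Sig_counit_right[OF assms(2) P_append_bil[OF assms(3,4), unfolded assms(1)]]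
    unfolding assms(1) by simp
  then show ?thesis using assms by (simp add: P_unit[OF assms(1,3)])
qed

lemma P_zeros_append:
  assumes "x \<in> H (sum_list c)" "y \<in> H m" "j + k + length c \<le> Suc m"
  shows "P j (replicate k 0 @ c) x y = P (j + k) c x y"
  using assms
proof (induction k arbitrary: j)
  case (Suc k)
  then show ?case
    using P_Cons_zero[of x "replicate k 0 @ c" y m j] by (simp add: sum_list_replicate)
qed simp

text \<open>Recursion from the last block, to match the order in which the iterated coproduct
  produces its factors. The form \<open>c @ [0]\<close> is the encoding of the word before the last
  block when that word ends in a letter of y.\<close>

lemma P_snoc:
  assumes "x \<in> H (sum_list c + n)" "y \<in> H m" "j + length c \<le> m"
    and "j + length c + k \<le> m"
  shows "P j (c @ n # replicate k 0) x y =
    Sig (sum_list c) n (\<lambda>u v. P j (c @ [0]) u (b (j + length c) v y)) x"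
proof -
  have "P j (c @ n # replicate k 0) x y = P j (c @ [n]) x y"
    using P_append_zeros[of "replicate k 0" x "c @ [n]" y m j] assms by (simp add: sum_list_replicate)
  also have "\<dots> = Sig (sum_list c) n (\<lambda>u v. P j c u (P (j + length c) [n] v y)) x"
    using P_append[of x c "[n]" y m j] assms by simp
  also have "\<dots> = Sig (sum_list c) n (\<lambda>u v. P j (c @ [0]) u (b (j + length c) v y)) x"
  proof (rule Sig_cong[OF assms(1)])
    fix u v assume uv: "u \<in> H (sum_list c)" "v \<in> H n"
    have "b (j + length c) v y \<in> H (n + m)" using assms uv by (intro b_in)
    then have "P j (c @ [0]) u (b (j + length c) v y) = P j c u (b (j + length c) v y)"
      using assms uv by (intro P_append_zeros[where m="n + m"]) auto
    then show "P j c u (P (j + length c) [n] v y) = P j (c @ [0]) u (b (j + length c) v y)"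
      using P_single[OF uv(2) assms(2,3)] by simp
  qed
  finally show ?thesis .
qed

text \<open>Induction over the segments ended by letters of z; \<open>j\<close> counts the letters
  of z already passed. In each segment the y-part is separated from the x-part, moved past all later
  blocks of x, and collected into the product of y with z.\<close>

theorem P_assoc:
  assumes "factorizations sg l d g" "x \<in> H (sum_list sg)" "y \<in> H (sum_list d)" "z \<in> H r"
    and "j + length l = Suc r"
  shows "P j l (P 0 sg x y) z = P j g x (P j d y z)"
  using assms
proof (induction arbitrary: x y j rule: factorizations.induct)
  case base
  then show ?case
    using b_assoc[of x 0 y 0 z r 0 0] P_single[of x 0 y 0 0] by (simp del: P.simps(2) add: P.simps(1))
next
  case (step h c' l d g c k)
  let ?l = "sum_list c + k + length c"
  let ?p = "length c" and ?q = "length c'" and ?h = "h + sum_list c'"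
  note sums = factorizations_sums[OF step.hyps]
  have sum_d: "sum_list d = ?q" and sum_g: "sum_list g = ?h" and sum_l: "sum_list l = ?h + ?q"
    and len_d: "length d = length l" and len_g: "length g = length l + ?q"
    using sums by auto
  have x: "x \<in> H (sum_list c + k + ?h)" using step.prems by (simp add: algebra_simps)
  have y: "y \<in> H (?p + ?q)" using step.prems sum_d by simp
  have j: "j \<le> r" "Suc j + length l = Suc r" using step.prems by auto
  let ?z = "\<lambda>v. P (Suc j) d v z"
  let ?f = "\<lambda>u v. b j u (P (Suc j) l v z)"
  have z_in: "?z v \<in> H (?q + r)" if "v \<in> H ?q" for v
    unfolding sum_d[symmetric] by (rule P_in) (use that sum_d step.prems j len_d in auto)
  have Pg_in: "P (Suc j) g u w \<in> H (?h + (?q + r))" if "u \<in> H ?h" "w \<in> H (?q + r)" for u w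
    unfolding sum_g[symmetric] by (rule P_in) (use that sum_g j len_g in auto)
  have bz_in: "b j u (?z v) \<in> H (?p + (?q + r))" if "u \<in> H ?p" "v \<in> H ?q" for u v
    using that j by (intro b_in z_in) auto
  have f: "bil (?l) (?h + ?q) ?f"
    using P_bil[OF step.prems(3), of j l ?l] j sum_l by simp
  have "P j (?l # l) (P 0 (c @ (k + h) # c') x y) z = Sig ?l (?h + ?q) ?f (P 0 (c @ (k + h) # c') x y)"
    using sum_l by simp
  \<comment> \<open>The first entry of the outer shuffle is the length of the first segment, so it
    cuts x \<bullet> y exactly at the end of that segment: between k and h in x, after
    \<open>length c\<close> letters in y.\<close>
  also have "\<dots> = Sig (sum_list c + k) ?h (\<lambda>u v. Sig ?p ?q (\<lambda>y y'.
      ?f (P 0 (c @ [k]) u y) (P 0 (h # c') v y')) y) x"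
    using Sig_P[of x c k h c' y ?p ?q 0 ?f] x y f by (simp add: algebra_simps)
  also have "\<dots> = Sig (sum_list c + k) ?h (\<lambda>u v. P j (c @ [k]) u
      (P (Suc (j + ?p)) g v (P j (?p # d) y z))) x"
  proof (rule Sig_cong[OF x])
    fix u v assume uv: "u \<in> H (sum_list c + k)" "v \<in> H ?h"
    have u: "u \<in> H (sum_list (c @ [k]))" and v: "v \<in> H (sum_list g)"
      using uv sum_g by auto
    let ?G = "\<lambda>w. P j (c @ [k]) u (P (Suc (j + ?p)) g v w)"
    have G: "lin (H (?p + (?q + r))) ?G"
    proof (rule lin_comp_P2[OF P_lin2[OF v] _ u])
      fix w assume "w \<in> H (?p + (?q + r))"
      then show "P (Suc (j + ?p)) g v w \<in> H (sum_list g + (?p + (?q + r)))"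
        using j len_g by (intro P_in[OF v]) auto
    qed (use j len_g in auto)
    have "Sig ?p ?q (\<lambda>y y'. ?f (P 0 (c @ [k]) u y) (P 0 (h # c') v y')) y =
        Sig ?p ?q (\<lambda>y y'. ?G (b j y (?z y'))) y"
    proof (rule Sig_cong[OF y])
      fix y y' assume yy: "y \<in> H ?p" "y' \<in> H ?q"
      have "P (Suc j) l (P 0 (h # c') v y') z = P (Suc j) g v (?z y')"
        using uv yy step.prems j sum_d by (intro step.IH) auto
      then have "?f (P 0 (c @ [k]) u y) (P 0 (h # c') v y') =
          b j (P 0 (c @ [k]) u y) (P (Suc j) g v (?z y'))" by simp
      \<comment> \<open>The preshuffle relation takes the x-part of the segment out of the left
        factor.\<close>
      also have "\<dots> = P (0 + j) (c @ [k]) u (b j y (P (Suc j) g v (?z y')))"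
        using j by (intro b_P[OF u yy(1) Pg_in[OF uv(2) z_in[OF yy(2)]]]) auto
      \<comment> \<open>The grafting relation then exchanges the y-part of the segment with all
        later blocks of x, which moves them by \<open>length c\<close>.\<close>
      also have "b j y (P (Suc j) g v (?z y')) = P (Suc j + ?p) g v (b j y (?z y'))"
        using j len_g by (intro b_P_commute[OF v yy(1) z_in[OF yy(2)]]) auto
      finally show "?f (P 0 (c @ [k]) u y) (P 0 (h # c') v y') = ?G (b j y (?z y'))" by simp
    qed
    also have "\<dots> = ?G (Sig ?p ?q (\<lambda>y y'. b j y (?z y')) y)"
      by (rule Sig_push[OF G y bz_in, symmetric])
    finally show "Sig ?p ?q (\<lambda>y y'. ?f (P 0 (c @ [k]) u y) (P 0 (h # c') v y')) y =
        P j (c @ [k]) u (P (Suc (j + ?p)) g v (P j (?p # d) y z))"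
      using sum_d by simp
  qed
  also have "\<dots> = P j ((c @ [k]) @ g) x (P j (?p # d) y z)"
  proof -
    have "P j (?p # d) y z \<in> H (sum_list (?p # d) + r)"
      using step.prems j len_d by (intro P_in) auto
    then show ?thesis
      using P_append[of x "c @ [k]" g "P j (?p # d) y z" "sum_list (?p # d) + r" j]
        x sum_g sum_d j len_g by (simp add: add.assoc)
  qed
  finally show ?case by simp
qed

end

section \<open>Shuffles as lattice paths\<close>

primrec interleave :: "bool list \<Rightarrow> 'a list \<Rightarrow> 'a list \<Rightarrow> 'a list" where
  "interleave [] xs ys = []"
| "interleave (b # bs) xs ys =
    (if b then hd xs # interleave bs (tl xs) ys else hd ys # interleave bs xs (tl ys))"

lemma count_list_bool: "count_list bs True + count_list bs False = length bs"
  by (induction bs) auto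

lemma count_list_replicate: "count_list (replicate n x) y = (if x = y then n else 0)"
  by (induction n) auto

lemma interleave_filter: "interleave (map p xs) (filter p xs) (filter (\<lambda>x. \<not> p x) xs) = xs"
  by (induction xs) auto

lemma count_map_bool:
  "count_list (map p xs) True = length (filter p xs)"
  "count_list (map p xs) False = length (filter (\<lambda>x. \<not> p x) xs)"
  by (induction xs) auto

lemma map_interleave:
  assumes "length xs = count_list bs True" "length ys = count_list bs False"
  shows "map f (interleave bs xs ys) = interleave bs (map f xs) (map f ys)"
  using assms
proof (induction bs arbitrary: xs ys)
  case (Cons b bs)
  show ?case
    using Cons.IH[of "tl xs" ys] Cons.IH[of xs "tl ys"] Cons.prems
    by (cases xs; cases ys; cases b) (simp_all split: if_splits)
qed simp

lemma interleave_append: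
  assumes "length xs = count_list bs True" "length ys = count_list bs False"
  shows "interleave (bs @ bs') (xs @ xs') (ys @ ys') = interleave bs xs ys @ interleave bs' xs' ys'"
  using assms
proof (induction bs arbitrary: xs ys)
  case (Cons b bs)
  show ?case
    using Cons.IH[of "tl xs" ys] Cons.IH[of xs "tl ys"] Cons.prems
    by (cases xs; cases ys; cases b) (simp_all split: if_splits)
qed simp

text \<open>A predicate that separates the two lists recovers the path and both lists; injectivity
  of the encoding by paths and the reading of words by thresholds rest on this.\<close>

lemma interleave_separated:
  assumes "length xs = count_list bs True" "length ys = count_list bs False"
    and "\<forall>x\<in>set xs. p x" "\<forall>y\<in>set ys. \<not> p y"
  shows "map p (interleave bs xs ys) = bs \<and> filter p (interleave bs xs ys) = xs \<and>
    filter (\<lambda>x. \<not> p x) (interleave bs xs ys) = ys"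
  using assms
proof (induction bs arbitrary: xs ys)
  case (Cons b bs)
  show ?case
  proof (cases b)
    case True
    then obtain x xs' where "xs = x # xs'" using Cons.prems by (cases xs) auto
    then show ?thesis using Cons.IH[of xs' ys] Cons.prems True by simp
  next
    case False
    then obtain y ys' where "ys = y # ys'" using Cons.prems by (cases ys) auto
    then show ?thesis using Cons.IH[of xs ys'] Cons.prems False by simp
  qed
qed simp

lemma length_interleave [simp]: "length (interleave bs xs ys) = length bs"
  by (induction bs arbitrary: xs ys) auto

lemma interleave_replicate_True: "interleave (replicate (length xs) True) xs ys = xs"
  by (induction xs) auto

lemma interleave_replicate_False: "interleave (replicate (length ys) False) xs ys = ys"
  by (induction ys) auto

section \<open>Shuffles of two blocks\<close>

text \<open>A shuffle is known once each position is marked as small (\<open>True\<close>) or large,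
  since small and large letters both appear in increasing order.\<close>

definition shuffle_word :: "nat \<Rightarrow> nat \<Rightarrow> bool list \<Rightarrow> nat list" where
  "shuffle_word n m bs = interleave bs [1..<n + 1] [n + 1..<n + m + 1]"

definition path :: "nat \<Rightarrow> nat \<Rightarrow> bool list \<Rightarrow> bool" where
  "path n m bs \<longleftrightarrow> count_list bs True = n \<and> count_list bs False = m"

lemma path_length: "path n m bs \<Longrightarrow> length bs = n + m"
  using count_list_bool[of bs] by (simp add: path_def)

lemma
  assumes "path n m bs"
  shows map_shuffle_word: "map (\<lambda>v. v \<le> n) (shuffle_word n m bs) = bs"
    and filter_le_shuffle_word: "filter (\<lambda>v. v \<le> n) (shuffle_word n m bs) = [1..<n + 1]"
    and filter_gt_shuffle_word: "filter (\<lambda>v. \<not> v \<le> n) (shuffle_word n m bs) = [n + 1..<n + m + 1]"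
  unfolding shuffle_word_def
  using assms interleave_separated[of "[1..<n + 1]" bs "[n + 1..<n + m + 1]" "\<lambda>v. v \<le> n"]
  by (auto simp: path_def simp del: upt_Suc)

lemma sorted_filter_iff:
  "sorted (filter p xs) \<longleftrightarrow> sorted_wrt (\<lambda>x y. p x \<longrightarrow> p y \<longrightarrow> x \<le> y) xs"
  by (induction xs) auto

lemma inv_at_perm_word:
  assumes "is_perm_word N g" "v \<in> {1..N}"
  obtains p where "p < N" "g ! p = v" "inv_at g v = Suc p"
proof -
  from assms obtain p where p: "p < N" "g ! p = v"
    by (metis in_set_conv_nth is_perm_word_def)
  have "inv_at g v = Suc p"
    unfolding inv_at_def
  proof (rule the_equality)
    fix q assume q: "1 \<le> q \<and> q \<le> length g \<and> g ! (q - 1) = v"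
    then have "q - 1 < length g" by auto
    then have "q - 1 = p" using q p assms(1) nth_eq_iff_index_eq[of g "q - 1" p]
      by (auto simp: is_perm_word_def)
    then show "q = Suc p" using q by auto
  qed (use p assms in \<open>auto simp: is_perm_word_def\<close>)
  with p that show ?thesis by blast
qed

text \<open>Increasing positions of consecutive letters chain to all pairs of letters in the block,
  which says that the block appears in increasing order as a subsequence.\<close>

lemma inv_at_increasing_iff:
  assumes g: "is_perm_word N g" and ak: "a + k \<le> N"
  shows "(\<forall>i. a + 1 \<le> i \<and> i < a + k \<longrightarrow> inv_at g i < inv_at g (i + 1)) \<longleftrightarrow>
    sorted (filter (\<lambda>v. a < v \<and> v \<le> a + k) g)"
proof
  assume incr: "\<forall>i. a + 1 \<le> i \<and> i < a + k \<longrightarrow> inv_at g i < inv_at g (i + 1)"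
  have less: "inv_at g i < inv_at g j" if "a < i" "i < j" "j \<le> a + k" for i j
    using that
  proof (induction j)
    case (Suc j)
    have "inv_at g j < inv_at g (j + 1)" using incr Suc.prems by auto
    moreover have "inv_at g i \<le> inv_at g j"
      using Suc by (cases "i = j") (simp_all add: less_Suc_eq less_imp_le)
    ultimately show ?case by simp
  qed simp
  show "sorted (filter (\<lambda>v. a < v \<and> v \<le> a + k) g)"
    unfolding sorted_filter_iff unfolding sorted_wrt_iff_nth_less
  proof (intro allI impI, rule ccontr)
    fix p q assume pq: "p < q" "q < length g" and bounds: "a < g ! p \<and> g ! p \<le> a + k"
      "a < g ! q \<and> g ! q \<le> a + k" and "\<not> g ! p \<le> g ! q"
    then have *: "inv_at g (g ! q) < inv_at g (g ! p)" using less by auto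
    have inv: "inv_at g (g ! r) = Suc r" if "r < length g" for r
    proof -
      have "g ! r \<in> {1..N}" using g that nth_mem unfolding is_perm_word_def by blast
      then obtain r' where "r' < N" "g ! r' = g ! r" "inv_at g (g ! r) = Suc r'"
        using inv_at_perm_word[OF g] by metis
      then show ?thesis using g that by (auto simp: is_perm_word_def nth_eq_iff_index_eq)
    qed
    show False using * pq inv by auto
  qed
next
  assume sorted: "sorted (filter (\<lambda>v. a < v \<and> v \<le> a + k) g)"
  show "\<forall>i. a + 1 \<le> i \<and> i < a + k \<longrightarrow> inv_at g i < inv_at g (i + 1)"
  proof (intro allI impI)
    fix i assume i: "a + 1 \<le> i \<and> i < a + k"
    obtain p where p: "p < N" "g ! p = i" "inv_at g i = Suc p"
      by (rule inv_at_perm_word[OF g, of i]) (use i ak in auto)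
    obtain q where q: "q < N" "g ! q = i + 1" "inv_at g (i + 1) = Suc q"
      by (rule inv_at_perm_word[OF g, of "i + 1"]) (use i ak in auto)
    have "\<not> q < p"
    proof
      assume "q < p"
      moreover have "p < length g" using p g by (simp add: is_perm_word_def)
      ultimately have "a < g ! q \<and> g ! q \<le> a + k \<longrightarrow> a < g ! p \<and> g ! p \<le> a + k \<longrightarrow> g ! q \<le> g ! p"
        using sorted unfolding sorted_filter_iff unfolding sorted_wrt_iff_nth_less by blast
      then show False using i p q by simp
    qed
    moreover have "p \<noteq> q" using p q by auto
    ultimately show "inv_at g i < inv_at g (i + 1)" using p q by simp
  qed
qed

lemma Sh_two_iff:
  "g \<in> Sh [n, m] \<longleftrightarrow> is_perm_word (n + m) g \<and>
    sorted (filter (\<lambda>v. v \<le> n) g) \<and> sorted (filter (\<lambda>v. \<not> v \<le> n) g)"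
proof (cases "is_perm_word (n + m) g")
  case True
  then have set: "set g = {1..n + m}" by (simp add: is_perm_word_def)
  have f1: "filter (\<lambda>v. 0 < v \<and> v \<le> 0 + n) g = filter (\<lambda>v. v \<le> n) g"
    and f2: "filter (\<lambda>v. n < v \<and> v \<le> n + m) g = filter (\<lambda>v. \<not> v \<le> n) g"
    using set by (auto intro!: filter_cong)
  have "g \<in> Sh [n, m] \<longleftrightarrow> (\<forall>i. 0 + 1 \<le> i \<and> i < 0 + n \<longrightarrow> inv_at g i < inv_at g (i + 1)) \<and>
      (\<forall>i. n + 1 \<le> i \<and> i < n + m \<longrightarrow> inv_at g i < inv_at g (i + 1))"
    using True by (auto simp: Sh_def less_Suc_eq numeral_2_eq_2 all_conj_distrib)
  also have "\<dots> \<longleftrightarrow> sorted (filter (\<lambda>v. v \<le> n) g) \<and> sorted (filter (\<lambda>v. \<not> v \<le> n) g)"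
    using inv_at_increasing_iff[OF True, of 0 n] inv_at_increasing_iff[OF True, of n m] f1 f2 by simp
  finally show ?thesis using True by simp
qed (auto simp: Sh_def)

text \<open>The word is a permutation because, as a multiset, it is the union of its small and its
  large letters, and these are two adjoining intervals.\<close>

lemma shuffle_word_in_Sh:
  assumes "path n m bs"
  shows "shuffle_word n m bs \<in> Sh [n, m]"
proof -
  let ?g = "shuffle_word n m bs"
  note le = filter_le_shuffle_word[OF assms] and gt = filter_gt_shuffle_word[OF assms]
  have mset: "mset ?g = mset [1..<n + 1] + mset [n + 1..<n + m + 1]"
    unfolding le[symmetric] gt[symmetric] mset_filter by (rule multiset_partition)
  have "mset ?g = mset [1..<n + m + 1]"
    unfolding mset mset_append[symmetric] using upt_add_eq_append[of 1 "n + 1" m]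
    by (simp add: add.commute add.left_commute del: upt_Suc mset_append)
  then have "distinct ?g" "set ?g = set [1..<n + m + 1]"
    using mset_eq_imp_distinct_iff distinct_upt mset_eq_setD by blast+
  moreover have "length ?g = n + m" using path_length[OF assms] by (simp add: shuffle_word_def)
  moreover have "set [1..<n + m + 1] = {1..n + m}" by auto
  ultimately have "is_perm_word (n + m) ?g" by (simp only: is_perm_word_def)
  then show ?thesis unfolding Sh_two_iff le gt by (simp del: upt_Suc)
qed

text \<open>A sorted list without repetitions is determined by its set, so the small and the large
  letters of \<open>g\<close> form the two intervals.\<close>

lemma Sh_two_shuffle_word:
  assumes "g \<in> Sh [n, m]"
  obtains bs where "path n m bs" "g = shuffle_word n m bs"
proof -
  let ?bs = "map (\<lambda>v. v \<le> n) g"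
  have g: "distinct g" "set g = {1..n + m}"
    and s: "sorted (filter (\<lambda>v. v \<le> n) g)" "sorted (filter (\<lambda>v. \<not> v \<le> n) g)"
    using assms by (auto simp: Sh_two_iff is_perm_word_def)
  have "filter (\<lambda>v. v \<le> n) g = [1..<n + 1]"
    using g s by (intro sorted_distinct_set_unique) (auto simp del: upt_Suc)
  moreover have "filter (\<lambda>v. \<not> v \<le> n) g = [n + 1..<n + m + 1]"
    using g s by (intro sorted_distinct_set_unique) (auto simp del: upt_Suc)
  ultimately have "g = shuffle_word n m ?bs" "path n m ?bs"
    using interleave_filter[of "\<lambda>v. v \<le> n" g] count_map_bool[of "\<lambda>v. v \<le> n" g]
    by (simp_all add: shuffle_word_def path_def del: upt_Suc)
  then show ?thesis using that by blast
qed


section \<open>From paths to encoding lists\<close>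

fun comps :: "bool list \<Rightarrow> nat list" where
  "comps [] = [0]"
| "comps (True # bs) = Suc (hd (comps bs)) # tl (comps bs)"
| "comps (False # bs) = 0 # comps bs"

lemma comps_not_Nil [simp]: "comps bs \<noteq> []"
  by (induction bs rule: comps.induct) auto

lemma comps_sums: "length (comps bs) = Suc (count_list bs False) \<and> sum_list (comps bs) = count_list bs True"
proof (induction bs rule: comps.induct)
  case (2 bs)
  then show ?case by (cases "comps bs") auto
qed auto

text \<open>No letter \<open>False\<close> stands at the seam, so the two entries meeting there are
  added; this is the pattern \<open>k + l\<close> of \<open>Sig_P\<close>.\<close>

lemma comps_append_butlast:
  "comps (bs @ bs') = butlast (comps bs) @ (last (comps bs) + hd (comps bs')) # tl (comps bs')"
proof (induction bs rule: comps.induct)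
  case (2 bs)
  obtain a c where "comps bs = a # c" by (meson comps_not_Nil neq_Nil_conv)
  with 2 show ?case by (cases c) simp_all
qed simp_all

lemma comps_append:
  assumes "comps bs = c @ [k]" "comps bs' = l # c'"
  shows "comps (bs @ bs') = c @ (k + l) # c'"
  using comps_append_butlast[of bs bs'] assms by simp

lemma comps_replicate_False: "comps (replicate m False @ bs) = replicate m 0 @ comps bs"
  by (induction m) auto

lemma comps_replicate_True: "comps (replicate n True @ bs) = (n + hd (comps bs)) # tl (comps bs)"
  by (induction n) auto

text \<open>Prepending a letter of the first, second or third kind. The first two change only the
  first segment, which is exposed by inverting the last step; a letter of the third kind starts a
  new empty segment.\<close>

lemma factorizations_Cons:
  assumes "factorizations sg (l # ls) (d # ds) (g # gs)"
  shows "factorizations (Suc (hd sg) # tl sg) (Suc l # ls) (d # ds) (Suc g # gs)"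
    and "factorizations (0 # sg) (Suc l # ls) (Suc d # ds) (0 # g # gs)"
    and "factorizations sg (0 # l # ls) (0 # d # ds) (0 # g # gs)"
proof -
  from assms obtain h c' c k gs' where f: "factorizations (h # c') ls ds gs'"
    and eq: "sg = c @ (k + h) # c'" "l = sum_list c + k + length c" "d = length c" "g # gs = c @ k # gs'"
    by (cases rule: factorizations.cases) auto
  show "factorizations (Suc (hd sg) # tl sg) (Suc l # ls) (d # ds) (Suc g # gs)"
  \<comment> \<open>The new letter is counted in the first entry of the segment, which is k when the
    segment has no letter of the second kind.\<close>
  proof (cases c)
    case Nil
    then show ?thesis using factorizations.step[OF f, of "[]" "Suc k"] eq by auto
  next
    case (Cons a c'')
    then show ?thesis using factorizations.step[OF f, of "Suc a # c''" k] eq by auto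
  qed
  show "factorizations (0 # sg) (Suc l # ls) (Suc d # ds) (0 # g # gs)"
    using factorizations.step[OF f, of "0 # c" k] eq by auto
  obtain h' c0 where "sg = h' # c0" using eq by (cases c) auto
  then show "factorizations sg (0 # l # ls) (0 # d # ds) (0 # g # gs)"
    using factorizations.step[of h' c0 "l # ls" "d # ds" "g # gs" "[]" 0] assms by auto
qed

text \<open>Here \<open>p\<close> marks letters of the first kind and \<open>q\<close> those of the
  first two kinds; the four lists are readings of the one word \<open>w\<close>.\<close>

lemma factorizations_word:
  assumes "\<And>x. p x \<Longrightarrow> q x"
  shows "factorizations (comps (map p (filter q w))) (comps (map q w))
    (comps (map q (filter (\<lambda>x. \<not> p x) w))) (comps (map p w))"
proof (induction w)
  case Nil
  show ?case using factorizations.step[OF factorizations.base, of "[]" 0] by simp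
next
  case (Cons x w)
  obtain l ls d ds g gs where eq: "comps (map q w) = l # ls"
    "comps (map q (filter (\<lambda>x. \<not> p x) w)) = d # ds" "comps (map p w) = g # gs"
    using comps_not_Nil by (metis neq_Nil_conv)
  note f = factorizations_Cons[OF Cons.IH[unfolded eq]]
  consider "p x" "q x" | "\<not> p x" "q x" | "\<not> p x" "\<not> q x" using assms by blast
  then show ?case using f eq by cases simp_all
qed

section \<open>Block lengths of a shuffle\<close>

text \<open>The two block lengths of a shuffle are the lengths of the runs of its path.\<close>
fun runs_path :: "nat list \<Rightarrow> nat list \<Rightarrow> bool list" where
  "runs_path [] ms = replicate (hd ms) False"
| "runs_path (n # ns) ms = replicate (hd ms) False @ replicate n True @ runs_path ns (tl ms)"

text \<open>Inverse to \<open>runs_path\<close>. A letter \<open>True\<close> opens a new run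
  exactly when the next letter is \<open>False\<close> or missing; otherwise it lengthens the run
  that follows.\<close>

fun runs :: "bool list \<Rightarrow> nat list \<times> nat list" where
  "runs [] = ([], [0])"
| "runs (False # bs) = (case runs bs of (ns, ms) \<Rightarrow> (ns, Suc (hd ms) # tl ms))"
| "runs (True # bs) = (case runs bs of (ns, ms) \<Rightarrow>
    if ns \<noteq> [] \<and> hd ms = 0 then (Suc (hd ns) # tl ns, ms) else (1 # ns, 0 # ms))"

text \<open>The normalisation in \<open>shuffle_comps\<close>: only the first and the last run of
  large letters may be empty, which makes the run lengths unique.\<close>

definition proper_runs :: "nat list \<Rightarrow> nat list \<Rightarrow> bool" where
  "proper_runs ns ms \<longleftrightarrow> length ms = length ns + 1 \<and> (\<forall>j < length ns. 1 \<le> ns ! j) \<and>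
    (\<forall>j. 1 \<le> j \<and> j < length ns \<longrightarrow> 1 \<le> ms ! j)"

lemma proper_runs_Nil [simp]: "proper_runs [] ms \<longleftrightarrow> length ms = 1"
  by (auto simp: proper_runs_def)

lemma proper_runs_Cons [simp]:
  "proper_runs (n # ns) (m # ms) \<longleftrightarrow> 1 \<le> n \<and> proper_runs ns ms \<and> (ns \<noteq> [] \<longrightarrow> 1 \<le> hd ms)"
proof -
  have "(\<forall>j. 1 \<le> j \<and> j < Suc (length ns) \<longrightarrow> 1 \<le> (m # ms) ! j) \<longleftrightarrow> (\<forall>j<length ns. 1 \<le> ms ! j)"
    by (metis One_nat_def Suc_le_mono Suc_less_eq diff_Suc_1 gr0_conv_Suc le_add1 less_eq_Suc_le nth_Cons_Suc plus_1_eq_Suc)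
  moreover have "(\<forall>j<length ns. 1 \<le> ms ! j) \<longleftrightarrow>
      (\<forall>j. 1 \<le> j \<and> j < length ns \<longrightarrow> 1 \<le> ms ! j) \<and> (ns \<noteq> [] \<longrightarrow> 1 \<le> ms ! 0)"
    by (metis One_nat_def gr_zeroI length_greater_0_conv less_one not_le)
  moreover have "length ms = length ns + 1 \<Longrightarrow> ms ! 0 = hd ms" by (cases ms) auto
  moreover have "(\<forall>j<Suc (length ns). 1 \<le> (n # ns) ! j) \<longleftrightarrow> 1 \<le> n \<and> (\<forall>j<length ns. 1 \<le> ns ! j)"
    by (auto simp: less_Suc_eq_0_disj)
  ultimately show ?thesis unfolding proper_runs_def by auto
qed

text \<open>Existence of the block lengths of a shuffle.\<close>

lemma runs_proper:
  "case runs bs of (ns, ms) \<Rightarrow> proper_runs ns ms \<and> runs_path ns ms = bs"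
proof (induction bs rule: runs.induct)
  case (2 bs)
  obtain ns ms where r: "runs bs = (ns, ms)" by force
  obtain m ms' where "ms = m # ms'" using 2 r by (cases ms) (auto simp: proper_runs_def)
  with 2 r show ?case by (cases ns) auto
next
  case (3 bs)
  obtain ns ms where r: "runs bs = (ns, ms)" by force
  obtain m ms' where "ms = m # ms'" using 3 r by (cases ms) (auto simp: proper_runs_def)
  with 3 r show ?case by (cases ns) auto
qed auto

lemma runs_replicate_False:
  assumes "runs bs = (ns, ms)" "ms \<noteq> []"
  shows "runs (replicate k False @ bs) = (ns, (k + hd ms) # tl ms)"
  using assms by (induction k) auto

text \<open>The side condition keeps the new run from merging with a following run of
  \<open>True\<close>.\<close>

lemma runs_replicate_True:
  assumes "runs bs = (ns, ms)" "ns \<noteq> [] \<longrightarrow> 1 \<le> hd ms"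
  shows "runs (replicate (Suc k) True @ bs) = (Suc k # ns, 0 # ms)"
  using assms by (induction k) auto

text \<open>Uniqueness of the block lengths of a shuffle.\<close>

lemma runs_runs_path:
  assumes "proper_runs ns ms"
  shows "runs (runs_path ns ms) = (ns, ms)"
  using assms
proof (induction ns arbitrary: ms)
  case Nil
  then obtain m where "ms = [m]" by (cases ms) auto
  then show ?case using runs_replicate_False[of "[]" "[]" "[0]" m] by simp
next
  case (Cons n ns)
  then obtain m ms' where ms: "ms = m # ms'" by (cases ms) (auto simp: proper_runs_def)
  then obtain n' where n: "n = Suc n'" using Cons.prems by (cases n) auto
  have "runs (replicate n True @ runs_path ns ms') = (n # ns, 0 # ms')"
    unfolding n using Cons ms by (intro runs_replicate_True) auto
  from runs_replicate_False[OF this, of m] show ?case using ms by simp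
qed

lemma path_runs_path:
  assumes "length ms = length ns + 1"
  shows "path (sum_list ns) (sum_list ms) (runs_path ns ms)"
  using assms
proof (induction ns arbitrary: ms)
  case Nil
  then obtain m where "ms = [m]" by (cases ms) auto
  then show ?case by (simp add: path_def count_list_replicate)
next
  case (Cons n ns)
  then obtain m ms' where "ms = m # ms'" by (cases ms) auto
  with Cons show ?case by (auto simp: path_def count_list_replicate)
qed

text \<open>The proof generalises over the least letters x and y of the two alphabets, since they
  have advanced by n and m after the first pair of blocks.\<close>

lemma block_word_runs_path:
  assumes "length ms = length ns + 1"
  shows "block_word (sum_list ns) ns ms = shuffle_word (sum_list ns) (sum_list ms) (runs_path ns ms)"
proof -
  have "concat (map (\<lambda>j. [y + sum_list (take j ms) ..< y + sum_list (take (j+1) ms)]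
                      @ [x + sum_list (take j ns) ..< x + sum_list (take (j+1) ns)]) [0..<length ns])
     @ [y + sum_list (take (length ns) ms) ..< y + sum_list ms] =
     interleave (runs_path ns ms) [x..<x + sum_list ns] [y..<y + sum_list ms]" for x y
    using assms
  proof (induction ns arbitrary: ms x y)
    case Nil
    then obtain m where "ms = [m]" by (cases ms) auto
    then show ?case using interleave_replicate_False[of "[y..<y + m]"] by simp
  next
    case (Cons n ns)
    then obtain m ms' where ms: "ms = m # ms'" "length ms' = length ns + 1" by (cases ms) auto
    have split: "[a..<a + (k + l)] = [a..<a + k] @ [a + k..<a + k + l]" for a k l :: nat
      using upt_add_eq_append[of a "a + k" l] by (simp add: add.assoc)
    have "interleave (runs_path (n # ns) ms) [x..<x + (n + sum_list ns)] [y..<y + (m + sum_list ms')] =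
      [y..<y + m] @ [x..<x + n] @ interleave (runs_path ns ms') [x + n..<x + n + sum_list ns]
        [y + m..<y + m + sum_list ms']"
      using interleave_append[of "[]" "replicate m False" "[y..<y + m]"
          "replicate n True @ runs_path ns ms'" "[x..<x + (n + sum_list ns)]" "[y + m..<y + m + sum_list ms']"]
        interleave_append[of "[x..<x + n]" "replicate n True" "[]" "runs_path ns ms'"
          "[x + n..<x + n + sum_list ns]" "[y + m..<y + m + sum_list ms']"]
        interleave_replicate_False[of "[y..<y + m]" "[]"] interleave_replicate_True[of "[x..<x + n]" "[]"] ms
      by (simp add: count_list_replicate split)
    also have "\<dots> = [y..<y + m] @ [x..<x + n] @
      concat (map (\<lambda>j. [y + m + sum_list (take j ms') ..< y + m + sum_list (take (j+1) ms')]
                      @ [x + n + sum_list (take j ns) ..< x + n + sum_list (take (j+1) ns)]) [0..<length ns])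
      @ [y + m + sum_list (take (length ns) ms') ..< y + m + sum_list ms']"
      using Cons.IH[OF ms(2), of "y + m" "x + n"] by simp
    finally show ?case
      by (simp add: ms map_upt_Suc add.assoc del: upt_Suc)
  qed
  from this[of "sum_list ns + 1" 1] show ?thesis
    by (simp add: block_word_def shuffle_word_def add.commute add.left_commute)
qed

text \<open>Existence and uniqueness of proper run lengths evaluate the definite description in
  \<open>shuffle_comps\<close>.\<close>

lemma shuffle_comps_shuffle_word:
  assumes "path n m bs"
  shows "shuffle_comps n m (shuffle_word n m bs) = runs bs"
proof -
  obtain ns ms where r: "runs bs = (ns, ms)" by force
  have rp: "proper_runs ns ms" "runs_path ns ms = bs" using runs_proper[of bs] r by auto
  have sums: "sum_list ns = n" "sum_list ms = m"
    using path_runs_path[of ms ns] rp assms by (auto simp: path_def proper_runs_def)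
  show ?thesis
    unfolding shuffle_comps_def
  proof (rule the_equality)
    show "case runs bs of (ns, ms) \<Rightarrow> length ms = length ns + 1 \<and> sum_list ns = n \<and> sum_list ms = m \<and>
      (\<forall>j<length ns. 1 \<le> ns ! j) \<and> (\<forall>j. 1 \<le> j \<and> j < length ns \<longrightarrow> 1 \<le> ms ! j) \<and>
      shuffle_word n m bs = block_word n ns ms"
      unfolding r prod.case using rp sums block_word_runs_path[of ms ns]
      unfolding proper_runs_def by simp
  next
    fix q
    assume q: "case q of (ns, ms) \<Rightarrow> length ms = length ns + 1 \<and> sum_list ns = n \<and> sum_list ms = m \<and>
      (\<forall>j<length ns. 1 \<le> ns ! j) \<and> (\<forall>j. 1 \<le> j \<and> j < length ns \<longrightarrow> 1 \<le> ms ! j) \<and>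
      shuffle_word n m bs = block_word n ns ms"
    obtain ns' ms' where q': "q = (ns', ms')" by force
    have p': "proper_runs ns' ms'" and s': "sum_list ns' = n" "sum_list ms' = m"
      and eq: "shuffle_word n m bs = block_word n ns' ms'"
      using q q' by (auto simp: proper_runs_def)
    have l': "length ms' = length ns' + 1" using p' by (simp add: proper_runs_def)
    have "shuffle_word n m bs = shuffle_word n m (runs_path ns' ms')"
      using eq block_word_runs_path[OF l'] s' by simp
    moreover have "path n m (runs_path ns' ms')" using path_runs_path[OF l'] s' by simp
    then have "map (\<lambda>v. v \<le> n) (shuffle_word n m (runs_path ns' ms')) = runs_path ns' ms'" by (rule map_shuffle_word)
    ultimately have "bs = runs_path ns' ms'" using map_shuffle_word[OF assms] by simp
    then show "q = runs bs" using runs_runs_path[OF p'] q' by simp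
  qed
qed

section \<open>Composition and decomposition of shuffles\<close>

lemma map_nth_block:
  assumes "length us = a" "length vs = k"
  shows "map (\<lambda>i. (us @ vs @ ws) ! (i - 1)) [a + 1..<a + k + 1] = vs"
  using assms by (intro nth_equalityI) (auto simp: nth_append simp del: upt_Suc)

lemma length_id_word [simp]: "length (id_word n) = n"
  by (simp add: id_word_def)

lemma path_lengths:
  assumes "path n m bs"
  shows "length [a + 1..<a + n + 1] = count_list bs True" "length [a + 1..<a + m + 1] = count_list bs False"
  using assms by (auto simp: path_def simp del: upt_Suc)

text \<open>Composition on the left substitutes letters: small ones become \<open>us\<close>, large
  ones \<open>vs\<close>, and the path stays the same.\<close>

lemma comp_cross_shuffle_word:
  assumes "path n m bs" "length us = n" "length vs = m"
  shows "comp_word (us @ vs) (shuffle_word n m bs) = interleave bs us vs"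
proof -
  have "map (\<lambda>i. (us @ vs) ! (i - 1)) [1..<n + 1] = us"
    using map_nth_block[of "[]" 0 us n vs] assms by (simp del: upt_Suc)
  moreover have "map (\<lambda>i. (us @ vs) ! (i - 1)) [n + 1..<n + m + 1] = vs"
    using map_nth_block[of us n vs m "[]"] assms by (simp del: upt_Suc)
  ultimately show ?thesis
    unfolding comp_word_def shuffle_word_def
    using path_lengths(1)[OF assms(1), of 0] path_lengths(2)[OF assms(1), of n]
    by (simp add: map_interleave del: upt_Suc)
qed

text \<open>The common value \<open>w\<close> of the two composites is a word in three kinds of
  letters, divided by the thresholds n and n + m. Reading it by these thresholds returns the paths
  of the four given shuffles.\<close>

lemma factorizations_Sh:
  assumes paths: "path n (m + r) gb" "path m r db" "path n m sb" "path (n + m) r lb"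
    and eq: "comp_word (cross_word (id_word n) (shuffle_word m r db)) (shuffle_word n (m + r) gb) =
      comp_word (cross_word (shuffle_word n m sb) (id_word r)) (shuffle_word (n + m) r lb)"
  shows "factorizations (comps sb) (comps lb) (comps db) (comps gb)"
proof -
  let ?p = "\<lambda>v. v \<le> n" and ?q = "\<lambda>v. v \<le> n + m"
  let ?d = "map (\<lambda>j. j + n) (shuffle_word m r db)" and ?z = "map (\<lambda>j. j + (n + m)) (id_word r)"
  define w where "w = interleave gb (id_word n) ?d"
  have len_d: "length (shuffle_word m r db) = m + r" and len_s: "length (shuffle_word n m sb) = n + m"
    using paths path_length by (simp_all add: shuffle_word_def)
  have w1: "comp_word (cross_word (id_word n) (shuffle_word m r db)) (shuffle_word n (m + r) gb) = w"
    unfolding cross_word_def w_def using len_d by (subst comp_cross_shuffle_word[OF paths(1)]) auto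
  have w2: "w = interleave lb (shuffle_word n m sb) ?z"
    using w1[unfolded eq, symmetric] comp_cross_shuffle_word[OF paths(4) len_s, of ?z] len_s
    by (simp add: cross_word_def)
  have set_d: "set (shuffle_word m r db) = {1..m + r}" and set_s: "set (shuffle_word n m sb) = {1..n + m}"
    using shuffle_word_in_Sh paths(2,3) by (auto simp: Sh_two_iff is_perm_word_def)
  have "map ?p w = gb \<and> filter ?p w = id_word n \<and> filter (\<lambda>v. \<not> ?p v) w = ?d"
    unfolding w_def using paths(1) len_d set_d
    by (intro interleave_separated) (auto simp: path_def id_word_def simp del: upt_Suc)
  moreover have "map ?q w = lb \<and> filter ?q w = shuffle_word n m sb \<and> filter (\<lambda>v. \<not> ?q v) w = ?z"
    unfolding w2 using paths(4) len_s set_s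
    by (intro interleave_separated) (auto simp: path_def id_word_def simp del: upt_Suc)
  \<comment> \<open>In \<open>w\<close> the letters of \<open>\<delta>\<close> are raised by n, so
    its threshold m appears as n + m.\<close>
  moreover have "map ?q ?d = db"
    using map_shuffle_word[OF paths(2)] by (simp add: o_def add.commute)
  ultimately show ?thesis
    using factorizations_word[of ?p ?q w] map_shuffle_word[OF paths(3)] by simp
qed

lemma card_less_nth: "card {p. p < length xs \<and> xs ! p} = count_list xs True"
proof (induction xs)
  case (Cons x xs)
  have "{p. p < length (x # xs) \<and> (x # xs) ! p} =
      (if x then {0} else {}) \<union> Suc ` {p. p < length xs \<and> xs ! p}"
    by (auto simp: less_Suc_eq_0_disj)
  also have "card \<dots> = (if x then 1 else 0) + card (Suc ` {p. p < length xs \<and> xs ! p})"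
    by (subst card_Un_disjoint) auto
  finally show ?case using Cons by (simp add: card_image)
qed simp

lemma dec_n1_shuffle_word:
  assumes "path n m bs" "r \<le> n + m"
  shows "dec_n1 n (shuffle_word n m bs) r = count_list (take r bs) True"
proof -
  let ?g = "shuffle_word n m bs"
  have len: "length bs = n + m" "length ?g = n + m"
    using path_length[OF assms(1)] by (simp_all add: shuffle_word_def)
  have set: "set ?g = {1..n + m}"
    using shuffle_word_in_Sh[OF assms(1)] by (simp add: Sh_two_iff is_perm_word_def)
  have bs: "bs ! p \<longleftrightarrow> ?g ! p \<in> {1..n}" if "p < n + m" for p
  proof -
    have "bs ! p = (map (\<lambda>v. v \<le> n) ?g) ! p" by (simp only: map_shuffle_word[OF assms(1)])
    also have "\<dots> \<longleftrightarrow> ?g ! p \<le> n" using that len(2) by simp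
    also have "\<dots> \<longleftrightarrow> ?g ! p \<in> {1..n}"
      using nth_mem[of p ?g] that len(2) unfolding set by simp
    finally show ?thesis .
  qed
  have "{p. 1 \<le> p \<and> p \<le> r \<and> ?g ! (p - 1) \<in> {1..n}} = Suc ` {p. p < length (take r bs) \<and> take r bs ! p}"
  proof (rule set_eqI)
    fix p
    show "p \<in> {p. 1 \<le> p \<and> p \<le> r \<and> ?g ! (p - 1) \<in> {1..n}} \<longleftrightarrow>
      p \<in> Suc ` {p. p < length (take r bs) \<and> take r bs ! p}"
    proof (cases p)
      case (Suc q)
      have "q < r \<and> ?g ! q \<in> {1..n} \<longleftrightarrow> q < r \<and> take r bs ! q"
        using bs[of q] assms(2) by auto
      then show ?thesis using Suc len assms(2) by (simp add: inj_image_mem_iff Suc_le_eq)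
    qed simp
  qed
  then show ?thesis unfolding dec_n1_def card_less_nth[symmetric] by (simp only: card_image[OF inj_Suc])
qed

text \<open>The word of 1 \<times> \<open>\<epsilon>\<close> \<times> 1 consists of four intervals
  A, B, C, D: the first n1 small, the first m1 large, the other small and the other large values.
  The first shuffle merges A with B, the second C with D, so the paths are concatenated.\<close>

lemma comp_eps_shuffle_word:
  assumes "path n1 m1 b1" "path n2 m2 b2"
  shows "comp_word (cross_word (cross_word (id_word n1) (eps_word n2 m1)) (id_word m2))
      (cross_word (shuffle_word n1 m1 b1) (shuffle_word n2 m2 b2)) = shuffle_word (n1 + n2) (m1 + m2) (b1 @ b2)"
proof -
  let ?N = "n1 + n2"
  let ?A = "[1..<n1 + 1]" and ?B = "[?N + 1..<?N + m1 + 1]" and ?C = "[n1 + 1..<n1 + n2 + 1]"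
    and ?D = "[?N + m1 + 1..<?N + m1 + m2 + 1]"
  have shift: "map (\<lambda>j. j + k) [i..<j] = [k + i..<k + j]" for i j k
    by (induction j) (auto simp: add.commute)
  have E: "cross_word (cross_word (id_word n1) (eps_word n2 m1)) (id_word m2) = ?A @ ?B @ ?C @ ?D"
    by (simp add: cross_word_def id_word_def eps_word_def shift algebra_simps del: upt_Suc)
  let ?f = "\<lambda>i. (?A @ ?B @ ?C @ ?D) ! (i - 1)"
  have A: "map ?f [1..<n1 + 1] = ?A"
    using map_nth_block[of "[]" 0 ?A n1 "?B @ ?C @ ?D"] by (simp del: upt_Suc)
  have B: "map ?f [n1 + 1..<n1 + m1 + 1] = ?B"
    using map_nth_block[of ?A n1 ?B m1 "?C @ ?D"] by (simp del: upt_Suc)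
  have C: "map ?f [(n1 + m1) + 1..<(n1 + m1) + n2 + 1] = ?C"
    using map_nth_block[of "?A @ ?B" "n1 + m1" ?C n2 "?D"] by (simp del: upt_Suc)
  have D: "map ?f [(n1 + m1 + n2) + 1..<(n1 + m1 + n2) + m2 + 1] = ?D"
    using map_nth_block[of "?A @ ?B @ ?C" "n1 + m1 + n2" ?D m2 "[]"] by (simp del: upt_Suc)
  have len: "length (shuffle_word n1 m1 b1) = n1 + m1" using path_length[OF assms(1)] by (simp add: shuffle_word_def)
  have "map (\<lambda>j. j + (n1 + m1)) (shuffle_word n2 m2 b2) =
      interleave b2 [(n1 + m1) + 1..<(n1 + m1) + n2 + 1] [(n1 + m1 + n2) + 1..<(n1 + m1 + n2) + m2 + 1]"
    unfolding shuffle_word_def using path_lengths(1)[OF assms(2), of 0] path_lengths(2)[OF assms(2), of n2]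
    by (simp add: map_interleave shift algebra_simps del: upt_Suc)
  then have "comp_word (?A @ ?B @ ?C @ ?D) (cross_word (shuffle_word n1 m1 b1) (shuffle_word n2 m2 b2)) =
      map ?f (shuffle_word n1 m1 b1) @ map ?f (interleave b2 [(n1 + m1) + 1..<(n1 + m1) + n2 + 1]
        [(n1 + m1 + n2) + 1..<(n1 + m1 + n2) + m2 + 1])"
    using len by (simp only: comp_word_def cross_word_def map_append)
  also have "\<dots> = interleave b1 ?A ?B @ interleave b2 ?C ?D"
    unfolding shuffle_word_def
      map_interleave[OF path_lengths(1)[OF assms(1), of 0, simplified add_0] path_lengths(2)[OF assms(1)]]
      map_interleave[OF path_lengths(1)[OF assms(2)] path_lengths(2)[OF assms(2)]] A B C D ..
  also have "\<dots> = interleave (b1 @ b2) (?A @ ?C) (?B @ ?D)"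
    using path_lengths(1)[OF assms(1), of 0] path_lengths(2)[OF assms(1), of ?N]
    by (intro interleave_append[symmetric]) simp_all
  also have "?A @ ?C = [1..<?N + 1]"
    using upt_add_eq_append[of 1 "n1 + 1" n2] by (simp add: algebra_simps del: upt_Suc)
  also have "?B @ ?D = [?N + 1..<?N + (m1 + m2) + 1]"
    using upt_add_eq_append[of "?N + 1" "?N + m1 + 1" m2] by (simp add: algebra_simps del: upt_Suc)
  finally show ?thesis unfolding E shuffle_word_def .
qed

text \<open>Decomposing a shuffle is cutting its path. Another solution would give the same
  concatenated path with a first part of the same length.\<close>

lemma shuffle_dec_shuffle_word:
  assumes "path n1 m1 b1" "path n2 m2 b2"
  shows "shuffle_dec (n1 + n2) (m1 + m2) (shuffle_word (n1 + n2) (m1 + m2) (b1 @ b2)) (n1 + m1) =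
    (shuffle_word n1 m1 b1, shuffle_word n2 m2 b2)"
proof -
  have len: "length b1 = n1 + m1" by (rule path_length[OF assms(1)])
  have p: "path (n1 + n2) (m1 + m2) (b1 @ b2)" using assms by (auto simp: path_def)
  have n1: "dec_n1 (n1 + n2) (shuffle_word (n1 + n2) (m1 + m2) (b1 @ b2)) (n1 + m1) = n1"
    using dec_n1_shuffle_word[OF p, of "n1 + m1"] len assms(1) by (simp add: path_def)
  show ?thesis
    unfolding shuffle_dec_def n1 Let_def add_diff_cancel_left'
  proof (rule the_equality)
    show "case (shuffle_word n1 m1 b1, shuffle_word n2 m2 b2) of (g1, g2) \<Rightarrow> g1 \<in> Sh [n1, m1] \<and> g2 \<in> Sh [n2, m2] \<and>
        shuffle_word (n1 + n2) (m1 + m2) (b1 @ b2) =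
        comp_word (cross_word (cross_word (id_word n1) (eps_word n2 m1)) (id_word m2)) (cross_word g1 g2)"
      using comp_eps_shuffle_word[OF assms] shuffle_word_in_Sh assms by simp
  next
    fix q assume q: "case q of (g1, g2) \<Rightarrow> g1 \<in> Sh [n1, m1] \<and> g2 \<in> Sh [n2, m2] \<and>
        shuffle_word (n1 + n2) (m1 + m2) (b1 @ b2) =
        comp_word (cross_word (cross_word (id_word n1) (eps_word n2 m1)) (id_word m2)) (cross_word g1 g2)"
    obtain g1 g2 where g: "q = (g1, g2)" by force
    with q have "g1 \<in> Sh [n1, m1]" "g2 \<in> Sh [n2, m2]" by auto
    then obtain b1' b2' where b': "path n1 m1 b1'" "g1 = shuffle_word n1 m1 b1'" "path n2 m2 b2'" "g2 = shuffle_word n2 m2 b2'"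
      using Sh_two_shuffle_word by metis
    then have eq: "shuffle_word (n1 + n2) (m1 + m2) (b1 @ b2) = shuffle_word (n1 + n2) (m1 + m2) (b1' @ b2')"
      using q g comp_eps_shuffle_word[of n1 m1 b1' n2 m2 b2'] by simp
    have "path (n1 + n2) (m1 + m2) (b1' @ b2')" using b' by (auto simp: path_def)
    from map_shuffle_word[OF this] map_shuffle_word[OF p] eq have "b1 @ b2 = b1' @ b2'" by simp
    moreover have "length b1' = length b1" using len path_length[OF b'(1)] by simp
    ultimately show "q = (shuffle_word n1 m1 b1, shuffle_word n2 m2 b2)" using g b' by simp
  qed
qed

section \<open>Iterated coproducts and nested products, read from the last factor\<close>

lemma concat_map_concat:
  "concat (map f (concat (map g xs))) = concat (map (\<lambda>x. concat (map f (g x))) xs)"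
  by (induction xs) auto

lemma length_icop: "t \<in> set (icop D k x) \<Longrightarrow> length t = Suc k"
  by (induction k arbitrary: t) fastforce+

text \<open>The iterated coproduct splits the first tensor factor at each step, so all factors but the last
  one arise from the first factor of the first splitting.\<close>
lemma icop_Suc_last:
  "icop D (Suc k) x = concat (map (\<lambda>(u, v). map (\<lambda>t. t @ [v]) (icop D k u)) (D x))"
proof (induction k)
  case 0
  show ?case by (simp add: case_prod_unfold concat_map_singleton)
next
  case (Suc k)
  let ?split = "\<lambda>t. map (\<lambda>(a, b). a # b # tl t) (D (hd t))"
  have split: "?split (t @ [v]) = map (\<lambda>t. t @ [v]) (?split t)" if "t \<in> set (icop D k u)" for t u v
    using length_icop[OF that] by (cases t) auto
  have "icop D (Suc (Suc k)) x = concat (map ?split (icop D (Suc k) x))" by simp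
  also have "\<dots> = concat (map ?split (concat (map (\<lambda>(u, v). map (\<lambda>t. t @ [v]) (icop D k u)) (D x))))"
    by (simp only: Suc.IH)
  also have "\<dots> = concat (map (\<lambda>(u, v). concat (map (\<lambda>t. ?split (t @ [v])) (icop D k u))) (D x))"
    by (simp add: concat_map_concat o_def case_prod_unfold)
  also have "\<dots> = concat (map (\<lambda>(u, v). concat (map (\<lambda>t. map (\<lambda>t. t @ [v]) (?split t)) (icop D k u))) (D x))"
    by (intro arg_cong[where f=concat] map_cong refl) (auto simp only: split intro!: arg_cong[where f=concat] map_cong)
  also have "\<dots> = concat (map (\<lambda>(u, v). map (\<lambda>t. t @ [v]) (icop D (Suc k) u)) (D x))"
    by (simp add: map_concat o_def)
  finally show ?case .
qed

lemma nest_snoc: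
  "nest B ms j (t @ [v]) y = nest B ms j t (B (sum_list (take (Suc (j + length t)) ms)) v y)"
  by (induction t arbitrary: j) auto

lemma nest_append:
  "j + length t \<le> length ms \<Longrightarrow> nest B (ms @ ms') j t y = nest B ms j t y"
  by (induction t arbitrary: j) auto

text \<open>Removing the last block turns an inner run of large letters into the final one, so that
  final run is nonempty.\<close>

lemma proper_runs_snocD:
  assumes "proper_runs (ns @ [n]) (ms @ [m])"
  shows "proper_runs ns ms" "ns \<noteq> [] \<longrightarrow> 1 \<le> last ms"
proof -
  have len: "length ms = Suc (length ns)" using assms by (simp add: proper_runs_def)
  have ns: "1 \<le> ns ! j" if "j < length ns" for j
    using assms that by (auto simp: proper_runs_def nth_append dest!: spec[of _ j])
  have ms: "1 \<le> ms ! j" if "1 \<le> j" "j \<le> length ns" for j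
    using assms that len unfolding proper_runs_def by (auto simp: nth_append dest!: spec[of _ j])
  show "proper_runs ns ms" using ns ms len by (simp add: proper_runs_def)
  have "last ms = ms ! length ns" using len by (cases "ms = []") (auto simp: last_conv_nth)
  then show "ns \<noteq> [] \<longrightarrow> 1 \<le> last ms" using ms[of "length ns"] by (cases ns) auto
qed

lemma runs_path_snoc:
  assumes "length ms = Suc (length ns)"
  shows "runs_path (ns @ [n]) (ms @ [m]) = runs_path ns ms @ replicate n True @ replicate m False"
  using assms
proof (induction ns arbitrary: ms)
  case Nil
  then show ?case by (cases ms) auto
next
  case (Cons a ns)
  then show ?case by (cases ms) auto
qed

lemma runs_path_last:
  assumes "length ms = Suc (length ns)"
  obtains bs where "runs_path ns ms = bs @ replicate (last ms) False"
proof (cases ns rule: rev_cases)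
  case Nil
  then show ?thesis using assms that[of "[]"] by (cases ms) auto
next
  case (snoc ns' n)
  then obtain ms' m where "ms = ms' @ [m]" "length ms' = Suc (length ns')"
    using assms by (cases ms rule: rev_cases) auto
  then show ?thesis using snoc runs_path_snoc that[of "runs_path ns' ms' @ replicate n True"] by simp
qed

text \<open>The path ends in \<open>False\<close>, after which no letter \<open>True\<close>
  stands.\<close>

lemma comps_runs_path_last:
  assumes "length ms = Suc (length ns)" "1 \<le> last ms"
  obtains c where "comps (runs_path ns ms) = c @ [0]"
proof -
  obtain k where k: "last ms = Suc k" using assms(2) by (cases "last ms") auto
  obtain bs where "runs_path ns ms = bs @ replicate (last ms) False" by (rule runs_path_last[OF assms(1)])
  then have *: "runs_path ns ms = (bs @ replicate k False) @ [False]"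
    using k by (simp add: replicate_append_same)
  obtain c l where "comps (bs @ replicate k False) = c @ [l]"
    by (metis comps_not_Nil rev_exhaust)
  then have "comps (runs_path ns ms) = c @ (l + 0) # [0]" unfolding * by (rule comps_append) simp
  then show ?thesis using that[of "c @ [l]"] by simp
qed

lemma comps_block: "comps (replicate n True @ replicate m False) = n # replicate m 0"
proof -
  have "comps (replicate m False @ []) = replicate m 0 @ [0]" by (simp only: comps_replicate_False comps.simps)
  then have "comps (replicate m False) = 0 # replicate m 0" by (simp add: replicate_append_same)
  then show ?thesis by (simp add: comps_replicate_True)
qed

section \<open>Adjoining a unit to a grafting bialgebra\<close>

lemma linear_iff_lin_on:
  "Vector_Spaces.linear s t g \<longleftrightarrow> vector_space s \<and> vector_space t \<and> lin_on s t UNIV g"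
proof
  assume "Vector_Spaces.linear s t g"
  then show "vector_space s \<and> vector_space t \<and> lin_on s t UNIV g"
    by (simp add: linear_iff lin_on_def)
next
  assume *: "vector_space s \<and> vector_space t \<and> lin_on s t UNIV g"
  interpret s: vector_space s using * by blast
  interpret t: vector_space t using * by blast
  have g: "g (s c x + s d y) = t c (g x) + t d (g y)" for c d x y
    using * by (simp add: lin_on_def)
  show "Vector_Spaces.linear s t g"
    using * g[of 1 _ 1] g[of _ _ 0] by (auto simp: linear_iff)
qed

text \<open>If x and y differ, the independent set \<open>{x - y}\<close> extends to a basis, and a
  functional can take the value 1 on it.\<close>

lemma linear_forms_separate:
  fixes s :: "'k::field \<Rightarrow> 'v::ab_group_add \<Rightarrow> 'v"
  assumes "vector_space s" "\<And>\<phi>. Vector_Spaces.linear s (*) \<phi> \<Longrightarrow> \<phi> x = \<phi> y"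
  shows "x = y"
proof (rule ccontr)
  assume "x \<noteq> y"
  interpret s: vector_space s by fact
  interpret k: vector_space "(*) :: 'k \<Rightarrow> 'k \<Rightarrow> 'k" by unfold_locales (auto simp: algebra_simps)
  interpret vector_space_pair s "(*) :: 'k \<Rightarrow> 'k \<Rightarrow> 'k" ..
  have "s.independent {x - y}" using \<open>x \<noteq> y\<close> by (simp add: s.independent_insert)
  then obtain \<phi> where \<phi>: "Vector_Spaces.linear s (*) \<phi>" "\<phi> (x - y) = 1"
    using linear_independent_extend[of "{x - y}" "\<lambda>_. 1"] by auto
  then have "\<phi> x - \<phi> y = 1" using linear_diff[of \<phi> x y] by simp
  then show False using assms(2)[OF \<phi>(1)] by simp
qed

lemma lin_on_compose:
  "lin_on s t S g \<Longrightarrow> lin_on t u UNIV h \<Longrightarrow> lin_on s u S (\<lambda>x. h (g x))"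
  by (simp add: lin_on_def)

lemma linear_sum_list:
  assumes "Vector_Spaces.linear s t g"
  shows "g (\<Sum>x\<leftarrow>xs. f x) = (\<Sum>x\<leftarrow>xs. g (f x))"
proof -
  have add: "g (x + y) = g x + g y" for x y using assms by (simp add: linear_iff)
  have "g 0 = 0" using add[of 0 0] by simp
  then show ?thesis using add by (induction xs) auto
qed

text \<open>Bilinear and trilinear forms are scalar valued in the definitions of equality of tensors;
  composing with functionals extends the equality to all multilinear maps.\<close>
lemma teq_bilinear:
  fixes sc :: "'b::field \<Rightarrow> 'c::ab_group_add \<Rightarrow> 'c"
  assumes "teq sc t t'" "vector_space sc" "vector_space s"
    and "\<And>u. lin_on sc s UNIV (f u)" "\<And>v. lin_on sc s UNIV (\<lambda>u. f u v)"
  shows "(\<Sum>(u, v)\<leftarrow>t. f u v) = (\<Sum>(u, v)\<leftarrow>t'. f u v)"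
proof (rule linear_forms_separate[OF assms(3)])
  fix \<phi> assume \<phi>: "Vector_Spaces.linear s (*) \<phi>"
  then have "vector_space ((*) :: 'b \<Rightarrow> 'b \<Rightarrow> 'b)" "lin_on s (*) UNIV \<phi>"
    by (simp_all add: linear_iff_lin_on)
  then have "bilinear_form sc (\<lambda>u v. \<phi> (f u v))"
    unfolding bilinear_form_def linear_iff_lin_on
    using assms(2) lin_on_compose[OF assms(4)] lin_on_compose[OF assms(5)] by blast
  with assms(1) have "(\<Sum>(u, v)\<leftarrow>t. \<phi> (f u v)) = (\<Sum>(u, v)\<leftarrow>t'. \<phi> (f u v))"
    unfolding teq_def by blast
  then show "\<phi> (\<Sum>(u, v)\<leftarrow>t. f u v) = \<phi> (\<Sum>(u, v)\<leftarrow>t'. f u v)"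
    by (simp add: linear_sum_list[OF \<phi>] case_prod_unfold)
qed

lemma teq3_trilinear:
  fixes sc :: "'b::field \<Rightarrow> 'c::ab_group_add \<Rightarrow> 'c"
  assumes "teq3 sc t t'" "vector_space sc" "vector_space s"
    and "\<And>u v. lin_on sc s UNIV (f u v)" "\<And>u w. lin_on sc s UNIV (\<lambda>v. f u v w)"
    "\<And>v w. lin_on sc s UNIV (\<lambda>u. f u v w)"
  shows "(\<Sum>(u, v, w)\<leftarrow>t. f u v w) = (\<Sum>(u, v, w)\<leftarrow>t'. f u v w)"
proof (rule linear_forms_separate[OF assms(3)])
  fix \<phi> assume \<phi>: "Vector_Spaces.linear s (*) \<phi>"
  then have "vector_space ((*) :: 'b \<Rightarrow> 'b \<Rightarrow> 'b)" "lin_on s (*) UNIV \<phi>"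
    by (simp_all add: linear_iff_lin_on)
  then have "trilinear_form sc (\<lambda>u v w. \<phi> (f u v w))"
    unfolding trilinear_form_def linear_iff_lin_on
    using assms(2) lin_on_compose[OF assms(4)] lin_on_compose[OF assms(5)] lin_on_compose[OF assms(6)]
    by blast
  with assms(1) have "(\<Sum>(u, v, w)\<leftarrow>t. \<phi> (f u v w)) = (\<Sum>(u, v, w)\<leftarrow>t'. \<phi> (f u v w))"
    unfolding teq3_def by blast
  then show "\<phi> (\<Sum>(u, v, w)\<leftarrow>t. f u v w) = \<phi> (\<Sum>(u, v, w)\<leftarrow>t'. f u v w)"
    by (simp add: linear_sum_list[OF \<phi>] case_prod_unfold)
qed

section \<open>Homogeneous components of a grafting bialgebra\<close>

locale grafting_bialg =
  fixes sc :: "'k::field \<Rightarrow> 'a::ab_group_add \<Rightarrow> 'a"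
    and G :: "nat \<Rightarrow> 'a set"
    and B :: "nat \<Rightarrow> 'a \<Rightarrow> 'a \<Rightarrow> 'a"
    and D :: "'a \<Rightarrow> ('a \<times> 'a) list"
  assumes grafting_bialgebra: "grafting_bialgebra sc G B D"
begin

lemma grafting: "grafting_algebra sc G B" and preshuffle: "preshuffle_bialgebra sc G B D"
  using grafting_bialgebra by (auto simp: grafting_bialgebra_def)

lemma graded: "graded_vs sc G" and products: "graded_products sc G B"
  using grafting by (auto simp: grafting_algebra_def preshuffle_algebra_def)

lemma G_0: "G 0 = {0}" and D_coproduct: "coproduct sc D" and D_coassoc: "coassoc sc D"
  and D_graded: "coproduct_graded sc G D"
  using preshuffle by (auto simp: preshuffle_bialgebra_def)

sublocale vector_space sc using graded by (simp add: graded_vs_def)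

lemma G_zero: "0 \<in> G n" and G_add: "x \<in> G n \<Longrightarrow> y \<in> G n \<Longrightarrow> x + y \<in> G n"
  and G_scale: "x \<in> G n \<Longrightarrow> sc c x \<in> G n"
  using graded by (auto simp: graded_vs_def)

lemma B_in: "i \<le> m \<Longrightarrow> x \<in> G n \<Longrightarrow> y \<in> G m \<Longrightarrow> B i x y \<in> G (n + m)"
  using products by (auto simp: graded_products_def)

lemma B_lin1: "i \<le> m \<Longrightarrow> y \<in> G m \<Longrightarrow> lin_on sc sc (G n) (\<lambda>x. B i x y)"
  and B_lin2: "i \<le> m \<Longrightarrow> x \<in> G n \<Longrightarrow> lin_on sc sc (G m) (B i x)"
  using products by (auto simp: graded_products_def lin_on_def)

lemma B_zero1: "i \<le> m \<Longrightarrow> y \<in> G m \<Longrightarrow> B i 0 y = 0"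
  using lin_onD[OF B_lin1[of i m y 0], of 0 0 0 0] G_zero by simp

lemma B_zero2: "i \<le> m \<Longrightarrow> x \<in> G n \<Longrightarrow> B i x 0 = 0"
  using lin_onD[OF B_lin2[of i m x n], of 0 0 0 0] G_zero by simp

lemma B_assoc: "x \<in> G n \<Longrightarrow> y \<in> G m \<Longrightarrow> z \<in> G p \<Longrightarrow> i \<le> m \<Longrightarrow> j \<le> p \<Longrightarrow>
    B j (B i x y) z = B (i + j) x (B j y z)"
  using grafting unfolding grafting_algebra_def preshuffle_algebra_def by blast

lemma B_graft: "x \<in> G n \<Longrightarrow> y \<in> G m \<Longrightarrow> z \<in> G p \<Longrightarrow> i < j \<Longrightarrow> j \<le> p \<Longrightarrow>
    B i x (B j y z) = B (j + n) y (B i x z)"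
  using grafting unfolding grafting_algebra_def by blast

abbreviation pr :: "nat \<Rightarrow> 'a \<Rightarrow> 'a" where "pr \<equiv> proj G"

lemma decomposition_unique:
  assumes "\<And>k. d k \<in> G k" "finite {k. d k \<noteq> 0}" "a = sum d {k. d k \<noteq> 0}"
  shows "pr k a = d k"
proof -
  have "\<exists>!d. (\<forall>k. d k \<in> G k) \<and> finite {k. d k \<noteq> 0} \<and> a = sum d {k. d k \<noteq> 0}"
    using graded by (simp add: graded_vs_def)
  then have "(THE d. (\<forall>k. d k \<in> G k) \<and> finite {k. d k \<noteq> 0} \<and> a = sum d {k. d k \<noteq> 0}) = d"
    by (rule the1_equality) (use assms in blast)
  then show ?thesis by (simp add: proj_def)
qed

lemma decomposition_unique':
  assumes "\<And>k. d k \<in> G k" "finite S" "\<And>k. k \<notin> S \<Longrightarrow> d k = 0" "a = sum d S"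
  shows "pr k a = d k"
proof (rule decomposition_unique)
  have sub: "{k. d k \<noteq> 0} \<subseteq> S" using assms(3) by auto
  then show "finite {k. d k \<noteq> 0}" using assms(2) finite_subset by blast
  show "a = sum d {k. d k \<noteq> 0}" using assms(2,4) sub
    by (simp add: sum.mono_neutral_right)
qed (fact assms(1))

lemma pr_decomposition:
  "(\<forall>k. pr k a \<in> G k) \<and> finite {k. pr k a \<noteq> 0} \<and> a = (\<Sum>k\<in>{k. pr k a \<noteq> 0}. pr k a)"
proof -
  have "\<exists>!d. (\<forall>k. d k \<in> G k) \<and> finite {k. d k \<noteq> 0} \<and> a = sum d {k. d k \<noteq> 0}"
    using graded by (simp add: graded_vs_def)
  then obtain d where d: "\<forall>k. d k \<in> G k" "finite {k. d k \<noteq> 0}" "a = sum d {k. d k \<noteq> 0}"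
    by (blast dest: ex1_implies_ex)
  have eq: "pr k a = d k" for k by (rule decomposition_unique[OF _ d(2,3)]) (use d(1) in blast)
  show ?thesis unfolding eq using d by blast
qed

lemma pr_in [simp]: "pr k a \<in> G k" and finite_pr: "finite {k. pr k a \<noteq> 0}"
  and sum_pr: "(\<Sum>k\<in>{k. pr k a \<noteq> 0}. pr k a) = a"
  using pr_decomposition[of a] by auto

lemma pr_homogeneous:
  assumes "a \<in> G n" shows "pr k a = (if k = n then a else 0)"
  using assms G_zero by (intro decomposition_unique'[of _ "{n}"]) auto

lemma pr_lin: "lin_on sc sc UNIV (pr k)"
  unfolding lin_on_def
proof (intro ballI allI)
  fix x y c d
  \<comment> \<open>A common finite support lets x, y and their combination be summed over the same
    degrees.\<close>
  let ?S = "{k. pr k x \<noteq> 0} \<union> {k. pr k y \<noteq> 0}"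
  have fin: "finite ?S" by (simp only: finite_Un finite_pr)
  have sum: "(\<Sum>k\<in>?S. pr k z) = z" if "{k. pr k z \<noteq> 0} \<subseteq> ?S" for z
    using sum.mono_neutral_left[OF fin that, of "\<lambda>k. pr k z"] sum_pr[of z] by simp
  show "pr k (sc c x + sc d y) = sc c (pr k x) + sc d (pr k y)"
  proof (rule decomposition_unique'[OF _ fin])
    have "sc c x + sc d y = sc c (\<Sum>k\<in>?S. pr k x) + sc d (\<Sum>k\<in>?S. pr k y)"
      using sum[of x] sum[of y] by simp
    then show "sc c x + sc d y = (\<Sum>k\<in>?S. sc c (pr k x) + sc d (pr k y))"
      by (simp only: scale_sum_right sum.distrib)
  qed (auto simp: G_add G_scale)
qed

text \<open>A pair \<open>(c, a)\<close> stands for c 1 + a in \<open>K 1 + A\<close>.\<close>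

definition sV :: "'k \<Rightarrow> 'k \<times> 'a \<Rightarrow> 'k \<times> 'a" where
  "sV c x = (c * fst x, sc c (snd x))"

sublocale V: vector_space sV
  by unfold_locales (auto simp: sV_def scale_right_distrib scale_left_distrib algebra_simps)

text \<open>Values in \<open>K 1 + A\<close> serve two purposes: scalar forms live in the first
  coordinate, products of elements of A in the second.\<close>

definition bilV :: "nat \<Rightarrow> nat \<Rightarrow> ('a \<Rightarrow> 'a \<Rightarrow> 'k \<times> 'a) \<Rightarrow> bool" where
  "bilV k l f \<longleftrightarrow> (\<forall>u\<in>G k. lin_on sc sV (G l) (f u)) \<and> (\<forall>v\<in>G l. lin_on sc sV (G k) (\<lambda>u. f u v))"

lemma bilV_zero:
  assumes "bilV k l f"
  shows "v \<in> G l \<Longrightarrow> f 0 v = 0" "u \<in> G k \<Longrightarrow> f u 0 = 0"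
proof -
  assume "v \<in> G l"
  then have "lin_on sc sV (G k) (\<lambda>u. f u v)" using assms by (simp add: bilV_def)
  from lin_onD[OF this, of 0 0 0 0] show "f 0 v = 0" using G_zero by simp
next
  assume "u \<in> G k"
  then have "lin_on sc sV (G l) (f u)" using assms by (simp add: bilV_def)
  from lin_onD[OF this, of 0 0 0 0] show "f u 0 = 0" using G_zero by simp
qed

text \<open>Projecting both arguments makes a map that is bilinear only on components bilinear on
  all of A, as \<open>teq\<close> demands.\<close>

definition wsum :: "nat \<Rightarrow> nat \<Rightarrow> ('a \<Rightarrow> 'a \<Rightarrow> 'k \<times> 'a) \<Rightarrow> ('a \<times> 'a) list \<Rightarrow> 'k \<times> 'a" where
  "wsum k l f t = (\<Sum>(u, v)\<leftarrow>t. f (pr k u) (pr l v))"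

definition dsum :: "nat \<Rightarrow> nat \<Rightarrow> ('a \<Rightarrow> 'a \<Rightarrow> 'k \<times> 'a) \<Rightarrow> 'a \<Rightarrow> 'k \<times> 'a" where
  "dsum k l f a = wsum k l f (D a)"

lemma bilV_pr:
  assumes "bilV k l f"
  shows "lin_on sc sV UNIV (\<lambda>v. f (pr k u) (pr l v))" "lin_on sc sV UNIV (\<lambda>u. f (pr k u) (pr l v))"
  using assms pr_lin by (auto simp: lin_on_def bilV_def)

lemma wsum_teq:
  assumes "bilV k l f" "teq sc t t'"
  shows "wsum k l f t = wsum k l f t'"
  unfolding wsum_def
  using teq_bilinear[OF assms(2) vector_space_axioms V.vector_space_axioms bilV_pr[OF assms(1)]] .

lemma wsum_append: "wsum k l f (t @ t') = wsum k l f t + wsum k l f t'"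
  by (simp add: wsum_def)

lemma wsum_concat: "wsum k l f (concat ts) = (\<Sum>t\<leftarrow>ts. wsum k l f t)"
  by (induction ts) (simp_all add: wsum_append, simp add: wsum_def)

lemma wsum_homogeneous:
  assumes "bilV k l f" "\<forall>(u, v)\<in>set t. u \<in> G k' \<and> v \<in> G l'" "k + l = k' + l'"
  shows "wsum k l f t = (if k' = k then \<Sum>(u, v)\<leftarrow>t. f u v else 0)"
proof (cases "k' = k")
  case True
  then have "l' = l" using assms(3) by simp
  then show ?thesis using True assms(2) unfolding wsum_def
    by (auto intro!: arg_cong[where f=sum_list] map_cong simp: pr_homogeneous)
next
  case False
  have "wsum k l f t = (\<Sum>p\<leftarrow>t. 0)"
    unfolding wsum_def
  proof (intro arg_cong[where f=sum_list] map_cong refl)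
    fix p assume "p \<in> set t"
    then have "fst p \<in> G k'" using assms(2) by auto
    then have "pr k (fst p) = 0" using False by (simp add: pr_homogeneous)
    then show "(case p of (u, v) \<Rightarrow> f (pr k u) (pr l v)) = 0"
      by (simp add: case_prod_unfold bilV_zero(1)[OF assms(1)])
  qed
  then show ?thesis using False by simp
qed

lemma dsum_lin:
  assumes "bilV k l f"
  shows "lin_on sc sV UNIV (dsum k l f)"
proof -
  have scale: "dsum k l f (sc c a) = sV c (dsum k l f a)" for c a
  proof -
    have "dsum k l f (sc c a) = wsum k l f (map (\<lambda>(u, v). (sc c u, v)) (D a))"
      using D_coproduct unfolding dsum_def coproduct_def by (intro wsum_teq[OF assms]) blast
    also have "\<dots> = (\<Sum>p\<leftarrow>D a. sV c (f (pr k (fst p)) (pr l (snd p))))"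
      unfolding wsum_def map_map o_def case_prod_unfold fst_conv snd_conv
      using lin_onD[OF bilV_pr(2)[OF assms], of _ 0 c 0] by simp
    also have "\<dots> = sV c (dsum k l f a)"
    proof -
      have "(\<Sum>p\<leftarrow>t. sV c (g p)) = sV c (\<Sum>p\<leftarrow>t. g p)" for t :: "('a \<times> 'a) list" and g
        by (induction t) (simp_all add: V.scale_right_distrib)
      then show ?thesis unfolding dsum_def wsum_def case_prod_unfold .
    qed
    finally show ?thesis .
  qed
  have add: "dsum k l f (a + b) = dsum k l f a + dsum k l f b" for a b
    using D_coproduct unfolding dsum_def coproduct_def wsum_append[symmetric]
    by (intro wsum_teq[OF assms]) blast
  show ?thesis unfolding lin_on_def by (simp add: add scale)
qed

text \<open>In a homogeneous representative the two degrees add up to n, so one of the two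
  projections kills every term.\<close>

lemma dsum_homogeneous:
  assumes "bilV k l f" "a \<in> G n" "n \<noteq> k + l"
  shows "dsum k l f a = 0"
proof -
  obtain t where t: "teq sc (D a) t"
    "\<forall>(u, v)\<in>set t. \<exists>i. 1 \<le> i \<and> i \<le> n - 1 \<and> u \<in> G i \<and> v \<in> G (n - i)"
    using D_graded assms(2) unfolding coproduct_graded_def by blast
  have "dsum k l f a = wsum k l f t" unfolding dsum_def by (rule wsum_teq[OF assms(1) t(1)])
  also have "\<dots> = (\<Sum>p\<leftarrow>t. 0)"
    unfolding wsum_def
  proof (intro arg_cong[where f=sum_list] map_cong refl)
    fix p assume p: "p \<in> set t"
    obtain u v where uv: "p = (u, v)" by force
    obtain i where i: "1 \<le> i" "i \<le> n - 1" "u \<in> G i" "v \<in> G (n - i)" using t(2) p uv by auto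
    then have "k \<noteq> i \<or> l \<noteq> n - i" using assms(3) by auto
    then have "f (pr k u) (pr l v) = 0"
      using i pr_in[of k u] pr_in[of l v] bilV_zero[OF assms(1)] by (auto simp: pr_homogeneous)
    then show "(case p of (u, v) \<Rightarrow> f (pr k u) (pr l v)) = 0" using uv by simp
  qed
  finally show ?thesis by simp
qed

text \<open>Only the part of \<open>a\<close> in degree k + l contributes. This allows projections
  between two successive coproducts to be dropped.\<close>

lemma dsum_pr:
  assumes "bilV k l f"
  shows "dsum k l f (pr (k + l) a) = dsum k l f a"
proof -
  note lin = dsum_lin[OF assms]
  have add: "dsum k l f (x + y) = dsum k l f x + dsum k l f y" for x y
    using lin_onD[OF lin, of x y 1 1] by simp
  have zero: "dsum k l f 0 = 0" using add[of 0 0] by simp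
  let ?S = "{k. pr k a \<noteq> 0}"
  have "dsum k l f (\<Sum>i\<in>?S. pr i a) = (\<Sum>i\<in>?S. dsum k l f (pr i a))"
    using finite_pr by (induction rule: finite_induct) (simp_all add: add zero)
  also have "\<dots> = (\<Sum>i\<in>?S. if i = k + l then dsum k l f (pr (k + l) a) else 0)"
    using dsum_homogeneous[OF assms pr_in] by (intro sum.cong) auto
  also have "\<dots> = dsum k l f (pr (k + l) a)"
    using finite_pr[of a] zero by (simp add: sum.delta)
  finally show ?thesis using sum_pr[of a] by simp
qed

lemma dcomp_in: "(u, v) \<in> set (dcomp G D n x j) \<Longrightarrow> u \<in> G j \<and> v \<in> G (n - j)"
  by (auto simp: dcomp_def)

lemma sum_dcomp: "(\<Sum>(u, v)\<leftarrow>dcomp G D n x j. f u v) = dsum j (n - j) f x"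
  by (simp add: dcomp_def dsum_def wsum_def o_def case_prod_unfold)

lemma map_dall: "map h (dall G D n x) = concat (map (\<lambda>j. map h (dcomp G D n x j)) [1..<n])"
  by (simp add: dall_def map_concat o_def)

lemma wsum_map_dcomp:
  assumes "bilV k l f" "k + l = k' + l'"
    and "\<And>u v. u \<in> G j \<Longrightarrow> v \<in> G (n - j) \<Longrightarrow> g u v \<in> G k' \<and> h u v \<in> G l'"
  shows "wsum k l f (map (\<lambda>(u, v). (g u v, h u v)) (dcomp G D n x j)) =
    (if k' = k then dsum j (n - j) (\<lambda>u v. f (g u v) (h u v)) x else 0)"
proof -
  have "\<forall>(u, v) \<in> set (map (\<lambda>(u, v). (g u v, h u v)) (dcomp G D n x j)). u \<in> G k' \<and> v \<in> G l'"
    using dcomp_in assms(3) by fastforce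
  from wsum_homogeneous[OF assms(1) this assms(2)] show ?thesis
    by (simp add: o_def case_prod_unfold flip: sum_dcomp)
qed

text \<open>The j-th term has left degree j + d, so testing in left degree k keeps at most the term
  j = k - d.\<close>

lemma wsum_map_dcomps:
  assumes "bilV k l f"
    and "\<And>j u v. a \<le> j \<Longrightarrow> j < c \<Longrightarrow> u \<in> G j \<Longrightarrow> v \<in> G (n - j) \<Longrightarrow>
      j + d \<le> k + l \<and> g j u v \<in> G (j + d) \<and> h j u v \<in> G (k + l - (j + d))"
  shows "wsum k l f (concat (map (\<lambda>j. map (\<lambda>(u, v). (g j u v, h j u v)) (dcomp G D n x j)) [a..<c])) =
    (if a + d \<le> k \<and> k < c + d
     then dsum (k - d) (n - (k - d)) (\<lambda>u v. f (g (k - d) u v) (h (k - d) u v)) x else 0)"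
proof -
  have "wsum k l f (map (\<lambda>(u, v). (g j u v, h j u v)) (dcomp G D n x j)) =
      (if j + d = k then dsum j (n - j) (\<lambda>u v. f (g j u v) (h j u v)) x else 0)"
    if "j \<in> set [a..<c]" for j
  proof (rule wsum_map_dcomp[OF assms(1), where l'="k + l - (j + d)"])
    show "k + l = j + d + (k + l - (j + d))"
      using assms(2)[of j 0 0] that G_zero by simp
  qed (use assms(2) that in auto)
  then have "(\<Sum>j\<leftarrow>[a..<c]. wsum k l f (map (\<lambda>(u, v). (g j u v, h j u v)) (dcomp G D n x j))) =
      (\<Sum>j\<leftarrow>[a..<c]. if j + d = k then dsum j (n - j) (\<lambda>u v. f (g j u v) (h j u v)) x else 0)"
    by (intro arg_cong[where f=sum_list] map_cong refl)
  then show ?thesis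
    unfolding wsum_concat map_map o_def sum_list_upt_delta .
qed

lemma preshuffle_bialgebra_coproducts:
  assumes "x \<in> G n" "y \<in> G m"
  shows "teq sc (D (B 0 x y))
          (map (\<lambda>(u,v). (u, B 0 v y)) (dall G D n x) @ [(x, y)] @
           map (\<lambda>(u,v). (B 0 x u, v)) (dall G D m y))"
    "1 \<le> i \<Longrightarrow> i \<le> m - 1 \<Longrightarrow> teq sc (D (B i x y))
            (concat (map (\<lambda>k. map (\<lambda>(u,v). (u, B (i - k) x v)) (dcomp G D m y k)) [1..<i+1]) @
             concat (map (\<lambda>(u,v). map (\<lambda>(u',v'). (B i u u', B 0 v v')) (dcomp G D m y i)) (dall G D n x)) @
             concat (map (\<lambda>k. map (\<lambda>(u,v). (B i x u, v)) (dcomp G D m y k)) [i..<m]))"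
    "teq sc (D (B m x y))
          (concat (map (\<lambda>k. map (\<lambda>(u,v). (u, B (m - k) x v)) (dcomp G D m y k)) [1..<m]) @ [(y, x)] @
           map (\<lambda>(u,v). (B m u y, v)) (dall G D n x))"
  using preshuffle assms unfolding preshuffle_bialgebra_def by blast+

text \<open>Axiom (1) in one bidegree. The word is x followed by y, and the left degree k decides
  whether the cut meets x, the seam or y.\<close>

lemma dsum_B_first:
  assumes xy: "x \<in> G n" "y \<in> G m" and f: "bilV k l f" and deg: "k + l = n + m"
  shows "dsum k l f (B 0 x y) =
    (if 1 \<le> k \<and> k < n then dsum k (n - k) (\<lambda>u v. f u (B 0 v y)) x else 0) +
    (if k = n then f x y else 0) +
    (if n < k \<and> k < n + m then dsum (k - n) (m - (k - n)) (\<lambda>u v. f (B 0 x u) v) y else 0)"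
proof -
  have 1: "wsum k l f (map (\<lambda>(u,v). (u, B 0 v y)) (dall G D n x)) =
      (if 1 \<le> k \<and> k < n then dsum k (n - k) (\<lambda>u v. f u (B 0 v y)) x else 0)"
    unfolding map_dall
  proof (subst wsum_map_dcomps[OF f, where d=0])
    fix j u v assume j: "1 \<le> j" "j < n" and uv: "u \<in> G j" "v \<in> G (n - j)"
    have "B 0 v y \<in> G (n - j + m)" by (intro B_in uv xy) simp
    then show "j + 0 \<le> k + l \<and> u \<in> G (j + 0) \<and> B 0 v y \<in> G (k + l - (j + 0))"
      using j uv deg by simp
  qed simp
  have 2: "wsum k l f [(x, y)] = (if k = n then f x y else 0)"
    using wsum_homogeneous[OF f, of "[(x, y)]" n m] xy deg by simp
  have 3: "wsum k l f (map (\<lambda>(u,v). (B 0 x u, v)) (dall G D m y)) =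
      (if n < k \<and> k < n + m then dsum (k - n) (m - (k - n)) (\<lambda>u v. f (B 0 x u) v) y else 0)"
    unfolding map_dall
  proof (subst wsum_map_dcomps[OF f, where d=n])
    fix j u v assume j: "1 \<le> j" "j < m" and uv: "u \<in> G j" "v \<in> G (m - j)"
    have "B 0 x u \<in> G (n + j)" by (intro B_in uv xy) simp
    then show "j + n \<le> k + l \<and> B 0 x u \<in> G (j + n) \<and> v \<in> G (k + l - (j + n))"
      using j uv deg by (simp add: add.commute)
  qed (simp add: add.commute Suc_le_eq)
  show ?thesis
    unfolding dsum_def[of k l f "B 0 x y"]
      wsum_teq[OF f preshuffle_bialgebra_coproducts(1)[OF xy]] wsum_append 1 2 3
    by (simp add: add.assoc)
qed

text \<open>Axiom (3) in one bidegree, for the word y followed by x.\<close>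

lemma dsum_B_last:
  assumes xy: "x \<in> G n" "y \<in> G m" and f: "bilV k l f" and deg: "k + l = n + m"
  shows "dsum k l f (B m x y) =
    (if 1 \<le> k \<and> k < m then dsum k (m - k) (\<lambda>u v. f u (B (m - k) x v)) y else 0) +
    (if k = m then f y x else 0) +
    (if m < k \<and> k < n + m then dsum (k - m) (n - (k - m)) (\<lambda>u v. f (B m u y) v) x else 0)"
proof -
  have 1: "wsum k l f (concat (map (\<lambda>k. map (\<lambda>(u,v). (u, B (m - k) x v)) (dcomp G D m y k)) [1..<m])) =
      (if 1 \<le> k \<and> k < m then dsum k (m - k) (\<lambda>u v. f u (B (m - k) x v)) y else 0)"
  proof (subst wsum_map_dcomps[OF f, where d=0])
    fix j u v assume j: "1 \<le> j" "j < m" and uv: "u \<in> G j" "v \<in> G (m - j)"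
    have "B (m - j) x v \<in> G (n + (m - j))" by (intro B_in uv xy) simp
    then show "j + 0 \<le> k + l \<and> u \<in> G (j + 0) \<and> B (m - j) x v \<in> G (k + l - (j + 0))"
      using j uv deg by simp
  qed simp
  have 2: "wsum k l f [(y, x)] = (if k = m then f y x else 0)"
    using wsum_homogeneous[OF f, of "[(y, x)]" m n] xy deg by simp
  have 3: "wsum k l f (map (\<lambda>(u,v). (B m u y, v)) (dall G D n x)) =
      (if m < k \<and> k < n + m then dsum (k - m) (n - (k - m)) (\<lambda>u v. f (B m u y) v) x else 0)"
    unfolding map_dall
  proof (subst wsum_map_dcomps[OF f, where d=m])
    fix j u v assume j: "1 \<le> j" "j < n" and uv: "u \<in> G j" "v \<in> G (n - j)"
    have "B m u y \<in> G (j + m)" by (intro B_in uv xy) simp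
    then show "j + m \<le> k + l \<and> B m u y \<in> G (j + m) \<and> v \<in> G (k + l - (j + m))"
      using j uv deg by simp
  qed (simp add: Suc_le_eq)
  show ?thesis
    unfolding dsum_def[of k l f "B m x y"]
      wsum_teq[OF f preshuffle_bialgebra_coproducts(3)[OF xy]] wsum_append 1 2 3
    by (simp add: add.assoc)
qed

text \<open>Axiom (2) in one bidegree. The cuts k = i and k = n + i at the two ends of x belong to
  the outer sums; the middle one cuts x properly.\<close>

lemma dsum_B_inner:
  assumes xy: "x \<in> G n" "y \<in> G m" and f: "bilV k l f" and deg: "k + l = n + m" and i: "1 \<le> i" "i < m"
  shows "dsum k l f (B i x y) =
    (if 1 \<le> k \<and> k \<le> i then dsum k (m - k) (\<lambda>u v. f u (B (i - k) x v)) y else 0) +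
    (if i < k \<and> k < n + i then dsum (k - i) (n - (k - i))
      (\<lambda>u v. dsum i (m - i) (\<lambda>u' v'. f (B i u u') (B 0 v v')) y) x else 0) +
    (if n + i \<le> k \<and> k < n + m then dsum (k - n) (m - (k - n)) (\<lambda>u v. f (B i x u) v) y else 0)"
proof -
  have 1: "wsum k l f (concat (map (\<lambda>k. map (\<lambda>(u,v). (u, B (i - k) x v)) (dcomp G D m y k)) [1..<i+1])) =
      (if 1 \<le> k \<and> k \<le> i then dsum k (m - k) (\<lambda>u v. f u (B (i - k) x v)) y else 0)"
  proof (subst wsum_map_dcomps[OF f, where d=0])
    fix j u v assume j: "1 \<le> j" "j < i + 1" and uv: "u \<in> G j" "v \<in> G (m - j)"
    have "B (i - j) x v \<in> G (n + (m - j))" by (intro B_in uv xy) (use i in simp)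
    then show "j + 0 \<le> k + l \<and> u \<in> G (j + 0) \<and> B (i - j) x v \<in> G (k + l - (j + 0))"
      using i j uv deg by simp
  qed (simp add: less_Suc_eq_le)
  have 2: "wsum k l f (concat (map (\<lambda>(u,v). map (\<lambda>(u',v'). (B i u u', B 0 v v')) (dcomp G D m y i)) (dall G D n x))) =
      (if i < k \<and> k < n + i then dsum (k - i) (n - (k - i))
        (\<lambda>u v. dsum i (m - i) (\<lambda>u' v'. f (B i u u') (B 0 v v')) y) x else 0)"
  proof -
    \<comment> \<open>A left part of x of degree j is multiplied with the first i letters of y, so
      the left degree is j + i.\<close>
    have inner: "wsum k l f (map (\<lambda>(u',v'). (B i u u', B 0 v v')) (dcomp G D m y i)) =
        (if j + i = k then dsum i (m - i) (\<lambda>u' v'. f (B i u u') (B 0 v v')) y else 0)"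
      if "1 \<le> j" "j < n" "(u, v) \<in> set (dcomp G D n x j)" for j u v
    proof (rule wsum_map_dcomp[OF f, where l'="n - j + (m - i)"])
      show "k + l = j + i + (n - j + (m - i))" using that(1,2) i deg by simp
      fix u' v' assume uv': "u' \<in> G i" "v' \<in> G (m - i)"
      have uv: "u \<in> G j" "v \<in> G (n - j)" using dcomp_in[OF that(3)] by auto
      show "B i u u' \<in> G (j + i) \<and> B 0 v v' \<in> G (n - j + (m - i))"
        by (intro conjI B_in uv uv') auto
    qed
    have "wsum k l f (concat (map (\<lambda>(u,v). map (\<lambda>(u',v'). (B i u u', B 0 v v')) (dcomp G D m y i)) (dall G D n x))) =
        (\<Sum>j\<leftarrow>[1..<n]. \<Sum>(u, v)\<leftarrow>dcomp G D n x j. wsum k l f (map (\<lambda>(u',v'). (B i u u', B 0 v v')) (dcomp G D m y i)))"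
      unfolding dall_def wsum_concat map_map o_def by (simp add: sum_list_map_concat case_prod_unfold o_def)
    also have "\<dots> = (\<Sum>j\<leftarrow>[1..<n]. if j + i = k then dsum j (n - j)
        (\<lambda>u v. dsum i (m - i) (\<lambda>u' v'. f (B i u u') (B 0 v v')) y) x else 0)"
    proof (intro arg_cong[where f=sum_list] map_cong refl)
      fix j assume j: "j \<in> set [1..<n]"
      have "(\<Sum>(u, v)\<leftarrow>dcomp G D n x j. wsum k l f (map (\<lambda>(u',v'). (B i u u', B 0 v v')) (dcomp G D m y i))) =
          (\<Sum>(u, v)\<leftarrow>dcomp G D n x j.
            if j + i = k then dsum i (m - i) (\<lambda>u' v'. f (B i u u') (B 0 v v')) y else 0)"
        using inner j by (intro arg_cong[where f=sum_list] map_cong refl) auto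
      also have "\<dots> = (if j + i = k then dsum j (n - j)
          (\<lambda>u v. dsum i (m - i) (\<lambda>u' v'. f (B i u u') (B 0 v v')) y) x else 0)"
      proof (cases "j + i = k")
        case False
        then show ?thesis by (simp add: case_prod_unfold)
      qed (simp add: sum_dcomp)
      finally show "(\<Sum>(u, v)\<leftarrow>dcomp G D n x j. wsum k l f (map (\<lambda>(u',v'). (B i u u', B 0 v v')) (dcomp G D m y i))) =
          (if j + i = k then dsum j (n - j)
          (\<lambda>u v. dsum i (m - i) (\<lambda>u' v'. f (B i u u') (B 0 v v')) y) x else 0)" .
    qed
    finally show ?thesis by (simp add: sum_list_upt_delta Suc_le_eq)
  qed
  have 3: "wsum k l f (concat (map (\<lambda>k. map (\<lambda>(u,v). (B i x u, v)) (dcomp G D m y k)) [i..<m])) =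
      (if n + i \<le> k \<and> k < n + m then dsum (k - n) (m - (k - n)) (\<lambda>u v. f (B i x u) v) y else 0)"
  proof (subst wsum_map_dcomps[OF f, where d=n])
    fix j u v assume j: "i \<le> j" "j < m" and uv: "u \<in> G j" "v \<in> G (m - j)"
    have "B i x u \<in> G (n + j)" by (intro B_in uv xy) (use j in simp)
    then show "j + n \<le> k + l \<and> B i x u \<in> G (j + n) \<and> v \<in> G (k + l - (j + n))"
      using j uv deg by (simp add: add.commute)
  qed (simp add: add.commute)
  have i': "i \<le> m - 1" using i by simp
  show ?thesis
    unfolding dsum_def[of k l f "B i x y"]
      wsum_teq[OF f preshuffle_bialgebra_coproducts(2)[OF xy i(1) i']] wsum_append 1 2 3
    by (simp add: add.assoc)
qed

section \<open>The unital algebra\<close>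

text \<open>The unital algebra \<open>K 1 \<oplus> A\<close>, whose component of degree 0 is \<open>K 1\<close> because \<open>A\<^sub>0 = 0\<close>.\<close>
definition H :: "nat \<Rightarrow> ('k \<times> 'a) set" where
  "H n = {x. snd x \<in> G n \<and> (n \<noteq> 0 \<longrightarrow> fst x = 0)}"

definition e :: "'k \<times> 'a" where "e = (1, 0)"

text \<open>The expansion of (c 1 + a) \<bullet> (d 1 + a') in which 1 acts as a unit on both
  sides.\<close>

definition b :: "nat \<Rightarrow> 'k \<times> 'a \<Rightarrow> 'k \<times> 'a \<Rightarrow> 'k \<times> 'a" where
  "b i x y = (fst x * fst y, sc (fst x) (snd y) + sc (fst y) (snd x) + B i (snd x) (snd y))"

text \<open>The component of \<open>\<Delta>_+\<close>: 1 \<otimes> x has bidegree (0, l) and x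
  \<otimes> 1 has bidegree (k, 0). In bidegree (0, 0) only 1 \<otimes> x is kept, because 1 is
  group-like.\<close>

definition T :: "nat \<Rightarrow> nat \<Rightarrow> 'k \<times> 'a \<Rightarrow> (('k \<times> 'a) \<times> ('k \<times> 'a)) list" where
  "T k l x = (if k = 0 then [(e, x)] else if l = 0 then [(x, e)]
    else map (\<lambda>(u, v). ((0, pr k u), (0, pr l v))) (D (snd x)))"

abbreviation S :: "nat \<Rightarrow> nat \<Rightarrow> ('k \<times> 'a \<Rightarrow> 'k \<times> 'a \<Rightarrow> 'k \<times> 'a) \<Rightarrow> 'k \<times> 'a \<Rightarrow> 'k \<times> 'a" where
  "S k l f x \<equiv> (\<Sum>(u, v)\<leftarrow>T k l x. f u v)"

abbreviation lin :: "('k \<times> 'a) set \<Rightarrow> ('k \<times> 'a \<Rightarrow> 'k \<times> 'a) \<Rightarrow> bool" where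
  "lin \<equiv> lin_on sV sV"

lemma H_0E:
  assumes "x \<in> H 0" obtains c where "x = (c, 0)" "x = sV c e"
  using assms G_0 by (cases x) (auto simp: H_def sV_def e_def)

lemma H_posE:
  assumes "x \<in> H n" "0 < n" obtains a where "x = (0, a)" "a \<in> G n"
  using assms by (cases x) (auto simp: H_def)

lemma in_H: "0 < n \<Longrightarrow> (c, a) \<in> H n \<longleftrightarrow> c = 0 \<and> a \<in> G n" "(c, a) \<in> H 0 \<longleftrightarrow> a = 0"
  using G_0 by (auto simp: H_def)

lemma e_in: "e \<in> H 0" by (simp add: e_def in_H)

lemma b_scalar_left: "i \<le> m \<Longrightarrow> y \<in> H m \<Longrightarrow> b i (c, 0) y = sV c y"
  by (simp add: b_def sV_def H_def B_zero1)

lemma b_scalar_right: "x \<in> H n \<Longrightarrow> b 0 x (c, 0) = sV c x"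
  using B_zero2[of 0 0 "snd x" n] by (simp add: b_def sV_def H_def mult.commute)

lemma b_e_left: "i \<le> m \<Longrightarrow> y \<in> H m \<Longrightarrow> b i e y = y"
  by (simp add: e_def b_scalar_left)

lemma b_e_right: "x \<in> H n \<Longrightarrow> b 0 x e = x"
  by (simp add: e_def b_scalar_right)

lemma b_pos: "b i (0, x) (0, y) = (0, B i x y)"
  by (simp add: b_def)

lemma H_lincomb: "x \<in> H n \<Longrightarrow> y \<in> H n \<Longrightarrow> sV c x + sV d y \<in> H n"
  by (auto simp: H_def sV_def G_add G_scale)

lemma b_in_H: "i \<le> m \<Longrightarrow> x \<in> H n \<Longrightarrow> y \<in> H m \<Longrightarrow> b i x y \<in> H (n + m)"
proof -
  assume i: "i \<le> m" and x: "x \<in> H n" and y: "y \<in> H m"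
  show ?thesis
  proof (cases "n = 0")
    case True
    then obtain c where "x = (c, 0)" using x H_0E by blast
    then show ?thesis using True b_scalar_left[OF i y] y H_lincomb[OF y y, of c 0] by simp
  next
    case n: False
    show ?thesis
    proof (cases "m = 0")
      case True
      then obtain c where "y = (c, 0)" using y H_0E by blast
      then show ?thesis using True i b_scalar_right[OF x] x H_lincomb[OF x x, of c 0] by simp
    next
      case False
      then obtain a a' where "x = (0, a)" "a \<in> G n" "y = (0, a')" "a' \<in> G m"
        using n x y H_posE by (metis not_gr_zero)
      then show ?thesis using i n by (simp add: b_pos in_H B_in)
    qed
  qed
qed

lemma b_lin_1: "i \<le> m \<Longrightarrow> y \<in> H m \<Longrightarrow> lin (H n) (\<lambda>x. b i x y)"
proof -
  assume i: "i \<le> m" and y: "y \<in> H m"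
  have B: "B i (sc c a + sc d a') (snd y) = sc c (B i a (snd y)) + sc d (B i a' (snd y))"
    if "a \<in> G n" "a' \<in> G n" for a a' c d
    using y that by (intro lin_onD[OF B_lin1[OF i]]) (auto simp: H_def)
  show ?thesis
    by (simp add: lin_on_def b_def sV_def H_def B algebra_simps scale_right_distrib scale_left_distrib)
qed

lemma b_lin_2: "i \<le> m \<Longrightarrow> x \<in> H n \<Longrightarrow> lin (H m) (b i x)"
proof -
  assume i: "i \<le> m" and x: "x \<in> H n"
  have B: "B i (snd x) (sc c a + sc d a') = sc c (B i (snd x) a) + sc d (B i (snd x) a')"
    if "a \<in> G m" "a' \<in> G m" for a a' c d
    using x that by (intro lin_onD[OF B_lin2[OF i, where n=n]]) (auto simp: H_def)
  show ?thesis
    by (simp add: lin_on_def b_def sV_def H_def B algebra_simps scale_right_distrib scale_left_distrib)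
qed

lemma lin_scale:
  assumes "lin (H n) g" "x \<in> H n" shows "g (sV c x) = sV c (g x)"
  using lin_onD[OF assms(1,2,2), of c 0] by simp

lemma b_assoc_H:
  assumes x: "x \<in> H n" and y: "y \<in> H m" and z: "z \<in> H p" and ij: "i \<le> m" "j \<le> p"
  shows "b j (b i x y) z = b (i + j) x (b j y z)"
proof -
  have yz: "b j y z \<in> H (m + p)" and xy: "b i x y \<in> H (n + m)" using b_in_H assms by auto
  consider "n = 0" | "m = 0" | "p = 0" | "0 < n" "0 < m" "0 < p" by blast
  then show ?thesis
  proof cases
    case 1
    then obtain c where "x = (c, 0)" using x H_0E by blast
    then show ?thesis
      using b_scalar_left[OF ij(1) y, of c] b_scalar_left[of "i + j" "m + p" "b j y z" c] yz ij
        lin_scale[OF b_lin_1[OF ij(2) z] y, of c] by simp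
  next
    case 2
    then obtain c where "y = (c, 0)" using y H_0E by blast
    then show ?thesis
      using 2 b_scalar_right[OF x, of c] b_scalar_left[OF ij(2) z, of c] ij
        lin_scale[OF b_lin_1[OF ij(2) z] x, of c] lin_scale[OF b_lin_2[OF ij(2) x] z, of c] by simp
  next
    case 3
    then obtain c where "z = (c, 0)" using z H_0E by blast
    then show ?thesis
      using 3 b_scalar_right[OF xy, of c] b_scalar_right[OF y, of c] ij
        lin_scale[OF b_lin_2[OF ij(1) x] y, of c] by simp
  next
    case 4
    then show ?thesis
      using x y z ij by (auto elim!: H_posE simp: b_pos B_assoc)
  qed
qed

lemma b_graft_H:
  assumes x: "x \<in> H n" and y: "y \<in> H m" and z: "z \<in> H p" and ij: "i < j" "j \<le> p"
  shows "b i x (b j y z) = b (j + n) y (b i x z)"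
proof -
  have yz: "b j y z \<in> H (m + p)" and xz: "b i x z \<in> H (n + p)" using b_in_H assms by auto
  have i: "i \<le> p" using ij by simp
  consider "n = 0" | "m = 0" | "0 < n" "0 < m" "0 < p" using ij by fastforce
  then show ?thesis
  proof cases
    case 1
    then obtain c where "x = (c, 0)" using x H_0E by blast
    then show ?thesis
      using 1 b_scalar_left[of i "m + p" "b j y z" c] b_scalar_left[OF i z, of c] yz ij
        lin_scale[OF b_lin_2[OF ij(2) y] z, of c] by simp
  next
    case 2
    then obtain c where "y = (c, 0)" using y H_0E by blast
    then show ?thesis
      using 2 b_scalar_left[OF ij(2) z, of c] b_scalar_left[of "j + n" "n + p" "b i x z" c] xz ij
        lin_scale[OF b_lin_2[OF i x] z, of c] by simp
  next
    case 3
    then show ?thesis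
      using x y z ij by (auto elim!: H_posE simp: b_pos B_graft)
  qed
qed

section \<open>The coproduct with unit and the cutting rule\<close>

lemma T_in_H: "x \<in> H (k + l) \<Longrightarrow> (u, v) \<in> set (T k l x) \<Longrightarrow> u \<in> H k \<and> v \<in> H l"
  by (auto simp: T_def e_in in_H split: if_splits)

lemma S_pos: "0 < k \<Longrightarrow> 0 < l \<Longrightarrow> S k l f x = dsum k l (\<lambda>u v. f (0, u) (0, v)) (snd x)"
  by (simp add: T_def dsum_def wsum_def o_def case_prod_unfold)

lemma S_cong:
  assumes "x \<in> H (k + l)" "\<And>u v. u \<in> H k \<Longrightarrow> v \<in> H l \<Longrightarrow> f u v = g u v"
  shows "S k l f x = S k l g x"
  using T_in_H[OF assms(1)] assms(2) by (intro arg_cong[where f=sum_list] map_cong) auto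

lemma S_scale: "S k l (\<lambda>u v. sV c (f u v)) x = sV c (S k l f x)"
proof -
  have "(\<Sum>p\<leftarrow>t. sV c (g p)) = sV c (\<Sum>p\<leftarrow>t. g p)" for t :: "(('k \<times> 'a) \<times> ('k \<times> 'a)) list" and g
    by (induction t) (simp_all add: V.scale_right_distrib)
  then show ?thesis unfolding case_prod_unfold .
qed

lemma bilV_pos:
  assumes "0 < k" "0 < l" "\<And>u. u \<in> H k \<Longrightarrow> lin (H l) (f u)"
    "\<And>v. v \<in> H l \<Longrightarrow> lin (H k) (\<lambda>u. f u v)"
  shows "bilV k l (\<lambda>u v. f (0, u) (0, v))"
proof -
  have *: "(0, sc c a + sc d a') = sV c (0, a) + sV d (0, a')" for c d a a'
    by (simp add: sV_def)
  show ?thesis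
    unfolding bilV_def lin_on_def[of sc sV] *
    using lin_onD[OF assms(3)] lin_onD[OF assms(4)] assms(1,2) by (simp add: in_H)
qed

lemma S_lin:
  assumes "\<And>u. u \<in> H k \<Longrightarrow> lin (H l) (f u)" "\<And>v. v \<in> H l \<Longrightarrow> lin (H k) (\<lambda>u. f u v)"
  shows "lin (H (k + l)) (S k l f)"
proof -
  consider "k = 0" | "l = 0" "0 < k" | "0 < k" "0 < l" by blast
  then show ?thesis
  proof cases
    case 1
    then show ?thesis using assms(1)[of e] e_in by (simp add: T_def)
  next
    case 2
    then show ?thesis using assms(2)[of e] e_in by (simp add: T_def)
  next
    case 3
    have "lin_on sc sV UNIV (dsum k l (\<lambda>u v. f (0, u) (0, v)))"
      using 3 assms by (intro dsum_lin bilV_pos)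
    then show ?thesis using 3 by (simp add: S_pos lin_on_def sV_def)
  qed
qed

lemma S_counit_right:
  assumes "x \<in> H k" "\<And>u. u \<in> H k \<Longrightarrow> lin (H 0) (f u)" "\<And>v. v \<in> H 0 \<Longrightarrow> lin (H k) (\<lambda>u. f u v)"
  shows "S k 0 f x = f x e"
proof (cases "k = 0")
  case True
  then obtain c where c: "x = sV c e" using assms(1) H_0E by blast
  \<comment> \<open>For k = 0 the first clause of \<open>T\<close> yields 1 \<otimes> c 1, which
    bilinearity identifies with c 1 \<otimes> 1.\<close>
  have "f e (sV c e) = f (sV c e) e"
    using lin_scale[OF assms(2) e_in, of e c] lin_scale[OF assms(3)[OF e_in], of e c] e_in True by simp
  then show ?thesis using True c by (simp add: T_def)
qed (simp add: T_def)

lemma S_coassoc: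
  assumes "x \<in> H (k + l + p)"
    and F1: "\<And>u v. u \<in> H k \<Longrightarrow> v \<in> H l \<Longrightarrow> lin (H p) (F u v)"
    and F2: "\<And>u w. u \<in> H k \<Longrightarrow> w \<in> H p \<Longrightarrow> lin (H l) (\<lambda>v. F u v w)"
    and F3: "\<And>v w. v \<in> H l \<Longrightarrow> w \<in> H p \<Longrightarrow> lin (H k) (\<lambda>u. F u v w)"
  shows "S (k + l) p (\<lambda>y w. S k l (\<lambda>u v. F u v w) y) x = S k (l + p) (\<lambda>u y. S l p (F u) y) x"
proof -
  consider "k = 0" | "0 < k" "l = 0" | "0 < k" "0 < l" "p = 0" | "0 < k" "0 < l" "0 < p" by blast
  then show ?thesis
  proof cases
    case 1
    then show ?thesis by (simp add: T_def)
  next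
    case 2
    have "S k p (\<lambda>y w. S k 0 (\<lambda>u v. F u v w) y) x = S k p (\<lambda>y w. F y e w) x"
      using 2 by (simp add: T_def)
    moreover have "S k p (\<lambda>u y. S 0 p (F u) y) x = S k p (\<lambda>y w. F y e w) x"
      by (simp add: T_def)
    ultimately show ?thesis using 2 by simp
  next
    case 3
    then show ?thesis by (simp add: T_def)
  next
    case 4
    let ?F = "\<lambda>u v w. F (0, u) (0, v) (0, w)"
    let ?a = "snd x"
    have *: "(0, sc c a + sc d a') = sV c (0, a) + sV d (0, a')" for c d a a'
      by (simp add: sV_def)
    have lin_F: "lin_on sc sV UNIV (\<lambda>w. ?F (pr k u) (pr l v) (pr p w))"
      "lin_on sc sV UNIV (\<lambda>v. ?F (pr k u) (pr l v) (pr p w))"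
      "lin_on sc sV UNIV (\<lambda>u. ?F (pr k u) (pr l v) (pr p w))" for u v w
      unfolding lin_on_def[of sc sV] lin_onD[OF pr_lin UNIV_I UNIV_I] *
      using 4 lin_onD[OF F1] lin_onD[OF F2] lin_onD[OF F3] by (simp_all add: in_H)
    have F12: "bilV k l (\<lambda>u v. ?F u v w)" if "w \<in> G p" for w
      using 4 that F2[of _ "(0, w)"] F3[of _ "(0, w)"]
      by (intro bilV_pos[of k l "\<lambda>u v. F u v (0, w)"]) (auto simp: in_H)
    have F23: "bilV l p (?F u)" if "u \<in> G k" for u
      using 4 that F1[of "(0, u)"] F2[of "(0, u)"]
      by (intro bilV_pos[of l p "F (0, u)"]) (auto simp: in_H)
    \<comment> \<open>The inner test already selects total degree k + l, so the projection between
      the two coproducts disappears and coassociativity of \<open>D\<close> itself applies.\<close>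
    have left: "dsum k l (\<lambda>u v. ?F u v (pr p w)) (pr (k + l) y) =
        (\<Sum>(u, v)\<leftarrow>D y. ?F (pr k u) (pr l v) (pr p w))" for y w
      using dsum_pr[OF F12[OF pr_in]] by (simp only: dsum_def wsum_def)
    have right: "dsum l p (?F (pr k u)) (pr (l + p) y) =
        (\<Sum>(v, w)\<leftarrow>D y. ?F (pr k u) (pr l v) (pr p w))" for y u
      using dsum_pr[OF F23[OF pr_in]] by (simp only: dsum_def wsum_def)
    have "S (k + l) p (\<lambda>y w. S k l (\<lambda>u v. F u v w) y) x =
        dsum (k + l) p (\<lambda>y w. dsum k l (\<lambda>u v. ?F u v w) y) ?a"
      using 4 by (simp add: S_pos)
    also have "\<dots> = (\<Sum>(y, w)\<leftarrow>D ?a. \<Sum>(u, v)\<leftarrow>D y. ?F (pr k u) (pr l v) (pr p w))"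
      unfolding dsum_def[of "k + l"] wsum_def left ..
    also have "\<dots> = (\<Sum>(u, v, w)\<leftarrow>concat (map (\<lambda>(y, w). map (\<lambda>(u, v). (u, v, w)) (D y)) (D ?a)).
        ?F (pr k u) (pr l v) (pr p w))"
      by (simp add: sum_list_map_concat o_def case_prod_unfold)
    also have "\<dots> = (\<Sum>(u, v, w)\<leftarrow>concat (map (\<lambda>(u, y). map (\<lambda>(v, w). (u, v, w)) (D y)) (D ?a)).
        ?F (pr k u) (pr l v) (pr p w))"
      using D_coassoc unfolding coassoc_def
      by (intro teq3_trilinear[OF _ vector_space_axioms V.vector_space_axioms] lin_F) blast
    also have "\<dots> = (\<Sum>(u, y)\<leftarrow>D ?a. \<Sum>(v, w)\<leftarrow>D y. ?F (pr k u) (pr l v) (pr p w))"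
      by (simp add: sum_list_map_concat o_def case_prod_unfold)
    also have "\<dots> = dsum k (l + p) (\<lambda>u y. dsum l p (?F u) y) ?a"
      unfolding dsum_def[of k "l + p"] wsum_def right ..
    also have "\<dots> = S k (l + p) (\<lambda>u y. S l p (F u) y) x"
      using 4 by (simp add: S_pos)
    finally show ?thesis .
  qed
qed

text \<open>In the essential cases, q = 0 is the term y \<otimes> x of axiom (3); otherwise the
  first sum is used, of axiom (3) if x stands at the end (i = q) and of axiom (2) if not. A scalar x
  passes through by linearity.\<close>

lemma S_b_left:
  assumes x: "x \<in> H n" and y: "y \<in> H (p + q)" and i: "i \<le> q"
    and f: "\<And>u. u \<in> H p \<Longrightarrow> lin (H (n + q)) (f u)" "\<And>v. v \<in> H (n + q) \<Longrightarrow> lin (H p) (\<lambda>u. f u v)"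
  shows "S p (n + q) f (b (p + i) x y) = S p q (\<lambda>u v. f u (b i x v)) y"
proof -
  consider "p = 0" | "n = 0" | "0 < n" "0 < p" "q = 0" | "0 < n" "0 < p" "0 < q" by blast
  then show ?thesis
  proof cases
    case 1
    then show ?thesis by (simp add: T_def)
  next
    case 2
    then obtain c where c: "x = (c, 0)" using x H_0E by blast
    have "S p q f (b (p + i) x y) = S p q f (sV c y)"
      using b_scalar_left[of "p + i" "p + q" y c] y i c by simp
    also have "\<dots> = sV c (S p q f y)"
      using S_lin[of p q f] f 2 y by (intro lin_scale[where n="p + q"]) auto
    also have "\<dots> = S p q (\<lambda>u v. f u (b i x v)) y"
      unfolding S_scale[symmetric]
      using f(1) 2 i c lin_scale[of q] b_scalar_left[of i q _ c] by (intro S_cong[OF y]) simp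
    finally show ?thesis using 2 by simp
  next
    case 3
    then obtain a a' where a: "x = (0, a)" "a \<in> G n" "y = (0, a')" "a' \<in> G p"
      using x y by (auto elim!: H_posE)
    have "S p n f (b p x y) = dsum p n (\<lambda>u v. f (0, u) (0, v)) (B p a a')"
      using 3 a by (simp add: S_pos b_pos)
    also have "\<dots> = f y x"
      using 3 a f by (subst dsum_B_last[OF a(2,4) bilV_pos]) (auto simp: add.commute)
    finally show ?thesis using 3 a i b_e_right[OF x] by (simp add: T_def)
  next
    case 4
    then obtain a a' where a: "x = (0, a)" "a \<in> G n" "y = (0, a')" "a' \<in> G (p + q)"
      using x y by (auto elim!: H_posE)
    have bil: "bilV p (n + q) (\<lambda>u v. f (0, u) (0, v))" using 4 f by (intro bilV_pos) auto
    have "dsum p (n + q) (\<lambda>u v. f (0, u) (0, v)) (B (p + i) a a') =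
        dsum p q (\<lambda>u v. f (0, u) (0, B i a v)) a'"
    proof (cases "i = q")
      case True
      then show ?thesis using 4 by (simp add: dsum_B_last[OF a(2,4) bil])
    next
      case False
      then show ?thesis using 4 i by (simp add: dsum_B_inner[OF a(2,4) bil])
    qed
    then show ?thesis using 4 a by (simp add: S_pos b_pos)
  qed
qed

text \<open>In the essential cases, p = 0 is the term x \<otimes> y of axiom (1); otherwise the last
  sum is used, of axiom (1) if i = 0 and of axiom (2) if not.\<close>

lemma S_b_right:
  assumes x: "x \<in> H n" and y: "y \<in> H (p + q)" and i: "i \<le> p"
    and f: "\<And>u. u \<in> H (n + p) \<Longrightarrow> lin (H q) (f u)" "\<And>v. v \<in> H q \<Longrightarrow> lin (H (n + p)) (\<lambda>u. f u v)"
  shows "S (n + p) q f (b i x y) = S p q (\<lambda>u v. f (b i x u) v) y"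
proof -
  consider "q = 0" | "n = 0" | "0 < n" "p = 0" "0 < q" | "0 < n" "0 < p" "0 < q" by blast
  then show ?thesis
  proof cases
    case 1
    have "S (n + p) 0 f (b i x y) = f (b i x y) e"
      using f 1 b_in_H[OF i x] y by (intro S_counit_right) auto
    moreover have "S p 0 (\<lambda>u v. f (b i x u) v) y = f (b i x y) e"
    proof (rule S_counit_right)
      fix v assume v: "v \<in> H 0"
      show "lin (H p) (\<lambda>u. f (b i x u) v)"
        using lin_onD[OF f(2)[unfolded 1, OF v]] lin_onD[OF b_lin_2[OF i x]] b_in_H[OF i x]
        by (simp add: lin_on_def)
    qed (use f 1 y b_in_H[OF i x] in auto)
    ultimately show ?thesis using 1 by simp
  next
    case 2
    then obtain c where c: "x = (c, 0)" using x H_0E by blast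
    have "S p q f (b i x y) = S p q f (sV c y)"
      using b_scalar_left[of i "p + q" y c] y i c by simp
    also have "\<dots> = sV c (S p q f y)"
      using S_lin[of p q f] f 2 y by (intro lin_scale[where n="p + q"]) auto
    also have "\<dots> = S p q (\<lambda>u v. f (b i x u) v) y"
      unfolding S_scale[symmetric]
    proof (rule S_cong[OF y])
      fix u v assume uv: "u \<in> H p" "v \<in> H q"
      have "lin (H p) (\<lambda>u. f u v)" using f(2)[OF uv(2)] 2 by simp
      from lin_scale[OF this uv(1)] show "sV c (f u v) = f (b i x u) v"
        using b_scalar_left[OF i uv(1), of c] c by simp
    qed
    finally show ?thesis using 2 by simp
  next
    case 3
    then obtain a a' where a: "x = (0, a)" "a \<in> G n" "y = (0, a')" "a' \<in> G q"
      using x y by (auto elim!: H_posE)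
    have "S n q f (b 0 x y) = dsum n q (\<lambda>u v. f (0, u) (0, v)) (B 0 a a')"
      using 3 a by (simp add: S_pos b_pos)
    also have "\<dots> = f x y"
      using 3 a f by (subst dsum_B_first[OF a(2,4) bilV_pos]) auto
    finally show ?thesis using 3 a i b_e_right[OF x] by (simp add: T_def)
  next
    case 4
    then obtain a a' where a: "x = (0, a)" "a \<in> G n" "y = (0, a')" "a' \<in> G (p + q)"
      using x y by (auto elim!: H_posE)
    have bil: "bilV (n + p) q (\<lambda>u v. f (0, u) (0, v))" using 4 f by (intro bilV_pos) auto
    have "dsum (n + p) q (\<lambda>u v. f (0, u) (0, v)) (B i a a') =
        dsum p q (\<lambda>u v. f (0, B i a u) (0, v)) a'"
    proof (cases "i = 0")
      case True
      then show ?thesis using 4 by (simp add: dsum_B_first[OF a(2,4) bil])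
    next
      case False
      then show ?thesis using 4 i by (simp add: dsum_B_inner[OF a(2,4) bil])
    qed
    then show ?thesis using 4 a by (simp add: S_pos b_pos)
  qed
qed

text \<open>An improper cut of x (k = 0 or l = 0) is a cut before or after x. For a proper cut the
  first sum of axiom (1) serves p = 0 < q, the last sum of axiom (3) serves q = 0 < p, and the
  middle sum of axiom (2) the rest; for p = q = 0 the element y is a scalar.\<close>

lemma S_b_middle:
  assumes x: "x \<in> H (k + l)" and y: "y \<in> H (p + q)"
    and f: "\<And>u. u \<in> H (k + p) \<Longrightarrow> lin (H (l + q)) (f u)"
      "\<And>v. v \<in> H (l + q) \<Longrightarrow> lin (H (k + p)) (\<lambda>u. f u v)"
  shows "S (k + p) (l + q) f (b p x y) =
    S k l (\<lambda>u v. S p q (\<lambda>u' v'. f (b p u u') (b 0 v v')) y) x"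
proof -
  consider "k = 0" | "0 < k" "l = 0" | "0 < k" "0 < l" "p = 0" "q = 0" | "0 < k" "0 < l" "p = 0" "0 < q"
    | "0 < k" "0 < l" "0 < p" "q = 0" | "0 < k" "0 < l" "0 < p" "0 < q" by blast
  then show ?thesis
  proof cases
    case 1
    have "S p (l + q) f (b (p + 0) x y) = S p q (\<lambda>u v. f u (b 0 x v)) y"
      using x y f 1 by (intro S_b_left) auto
    also have "\<dots> = S p q (\<lambda>u' v'. f (b p e u') (b 0 x v')) y"
      by (intro S_cong[OF y]) (simp add: b_e_left[OF order_refl])
    finally show ?thesis using 1 by (simp add: T_def)
  next
    case 2
    have "S (k + p) q f (b p x y) = S p q (\<lambda>u v. f (b p x u) v) y"
      using x y f 2 by (intro S_b_right) auto
    also have "\<dots> = S p q (\<lambda>u' v'. f (b p x u') (b 0 e v')) y"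
      by (intro S_cong[OF y]) (simp add: b_e_left)
    finally show ?thesis using 2 by (simp add: T_def)
  next
    case 3
    then have "y \<in> H 0" using y by simp
    then obtain c where c: "y = (c, 0)" using H_0E by blast
    have "S k l f (b 0 x y) = S k l f (sV c x)"
      using b_scalar_right[OF x] c by simp
    also have "\<dots> = sV c (S k l f x)"
      using S_lin[of k l f] f 3 x by (intro lin_scale[where n="k + l"]) auto
    also have "\<dots> = S k l (\<lambda>u v. f (b 0 u e) (b 0 v y)) x"
      unfolding S_scale[symmetric]
      using f(1) 3 c lin_scale[of l] b_scalar_right b_e_right by (intro S_cong[OF x]) simp
    finally show ?thesis using 3 by (simp add: T_def)
  next
    case 4
    then obtain a a' where a: "x = (0, a)" "a \<in> G (k + l)" "y = (0, a')" "a' \<in> G q"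
      using x y by (auto elim!: H_posE)
    have bil: "bilV k (l + q) (\<lambda>u v. f (0, u) (0, v))" using 4 f by (intro bilV_pos) auto
    have "S k (l + q) f (b 0 x y) = S k l (\<lambda>u v. f u (b 0 v y)) x"
      using 4 a by (simp add: S_pos b_pos dsum_B_first[OF a(2,4) bil])
    also have "\<dots> = S k l (\<lambda>u v. f (b 0 u e) (b 0 v y)) x"
      by (intro S_cong[OF x]) (simp add: b_e_right)
    finally show ?thesis using 4 by (simp add: T_def)
  next
    case 5
    then obtain a a' where a: "x = (0, a)" "a \<in> G (k + l)" "y = (0, a')" "a' \<in> G p"
      using x y by (auto elim!: H_posE)
    have bil: "bilV (k + p) l (\<lambda>u v. f (0, u) (0, v))" using 5 f by (intro bilV_pos) auto
    have "S (k + p) l f (b p x y) = S k l (\<lambda>u v. f (b p u y) v) x"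
      using 5 a by (simp add: S_pos b_pos dsum_B_last[OF a(2,4) bil])
    also have "\<dots> = S k l (\<lambda>u v. f (b p u y) (b 0 v e)) x"
      by (intro S_cong[OF x]) (simp add: b_e_right)
    finally show ?thesis using 5 by (simp add: T_def)
  next
    case 6
    then obtain a a' where a: "x = (0, a)" "a \<in> G (k + l)" "y = (0, a')" "a' \<in> G (p + q)"
      using x y by (auto elim!: H_posE)
    have bil: "bilV (k + p) (l + q) (\<lambda>u v. f (0, u) (0, v))" using 6 f by (intro bilV_pos) auto
    show ?thesis
      using 6 a by (simp add: S_pos b_pos dsum_B_inner[OF a(2,4) bil])
  qed
qed

sublocale U: unital_grafting sV H e b T
proof (unfold_locales, goal_cases)
  case (1 n)
  then show ?case using G_zero by (simp add: H_def)
next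
  case (2 x n y)
  then show ?case using H_lincomb[of x n y 1 1] by simp
next
  case 3
  then show ?case by (rule e_in)
next
  case (4 x)
  then show ?case using H_0E by blast
next
  case (5 i m x n y)
  then show ?case by (rule b_in_H)
next
  case (6 i m y n)
  then show ?case by (rule b_lin_1)
next
  case (7 i m x n)
  then show ?case by (rule b_lin_2)
next
  case (8 i m y)
  then show ?case by (rule b_e_left)
next
  case (9 x n y m z p i j)
  then show ?case by (rule b_assoc_H)
next
  case (10 x n y m z p i j)
  then show ?case by (rule b_graft_H)
next
  case (11 x k l u v)
  then show ?case by (rule T_in_H)
next
  case (12 k l f)
  then show ?case by (rule S_lin)
next
  case (13 x l f)
  then show ?case by (simp add: T_def)
next
  case (14 x k f)
  then show ?case by (rule S_counit_right)
next
  case (15 x k l p F)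
  then show ?case by (rule S_coassoc)
next
  case (16 x n y p q i f)
  then show ?case by (rule S_b_left)
next
  case (17 x k l y p q f)
  then show ?case by (rule S_b_middle)
next
  case (18 x n y p q i f)
  then show ?case by (rule S_b_right)
qed

subsection \<open>The shuffle products\<close>

text \<open>Since \<open>icop_comp\<close> is empty for \<open>[]\<close>, this recursion can start
  only from one block.\<close>

lemma icop_comp_snoc:
  assumes "ns \<noteq> []"
  shows "icop_comp G D (ns @ [n]) x =
    concat (map (\<lambda>(u, v). map (\<lambda>t. t @ [pr n v]) (icop_comp G D ns u)) (D x))"
proof -
  obtain k where k: "length ns = Suc k" using assms by (cases ns) auto
  have step: "map (map2 pr (ns @ [n])) (map (\<lambda>t. t @ [v]) (icop D k u)) =
      map (\<lambda>t. t @ [pr n v]) (map (map2 pr ns) (icop D k u))" for u v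
    using k by (auto simp: zip_append dest!: length_icop)
  have "icop_comp G D (ns @ [n]) x = map (map2 pr (ns @ [n])) (icop D (Suc k) x)"
    using k by (simp add: icop_comp_def del: icop.simps)
  also have "\<dots> = concat (map (\<lambda>(u, v). map (map2 pr (ns @ [n])) (map (\<lambda>t. t @ [v]) (icop D k u))) (D x))"
    unfolding icop_Suc_last map_concat map_map by (intro arg_cong[where f=concat] map_cong refl) auto
  also have "\<dots> = concat (map (\<lambda>(u, v). map (\<lambda>t. t @ [pr n v]) (icop_comp G D ns u)) (D x))"
    unfolding step using assms k by (simp add: icop_comp_def)
  finally show ?thesis .
qed

text \<open>Induction on the last block, which is multiplied onto y first. The remaining blocks then
  act on an element of larger degree, hence y and m are arbitrary and \<open>sum_list ms\<close> is
  only bounded by m; \<open>a\<close> need not be homogeneous because the factors of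
  \<open>D a\<close> are not.\<close>

lemma sum_nest_eq_P:
  assumes "proper_runs ns ms" "ns \<noteq> []" "y \<in> G m" "sum_list ms \<le> m"
  shows "(0, \<Sum>t\<leftarrow>icop_comp G D ns a. nest B ms 0 t y) =
    U.P 0 (comps (runs_path ns ms)) (0, pr (sum_list ns) a) (0, y)"
  using assms
proof (induction ns arbitrary: ms a y m rule: rev_induct)
  case (snoc n ns)
  obtain ms' m' where ms: "ms = ms' @ [m']" and len: "length ms' = Suc (length ns)"
    using snoc.prems(1) by (cases ms rule: rev_cases) (auto simp: proper_runs_def)
  note proper = proper_runs_snocD[OF snoc.prems(1)[unfolded ms]]
  have n: "0 < n" using snoc.prems(1) by (auto simp: proper_runs_def nth_append dest!: spec[of _ "length ns"])
  have y: "(0, y) \<in> H m" using snoc.prems(3) by (simp add: H_def)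
  have le: "sum_list ms' + m' \<le> m" using snoc.prems(4) ms by simp
  have path: "runs_path (ns @ [n]) ms = runs_path ns ms' @ replicate n True @ replicate m' False"
    unfolding ms by (rule runs_path_snoc[OF len])
  show ?case
  proof (cases "ns = []")
    case True
    then obtain m1 where m1: "ms' = [m1]" using len by (cases ms') auto
    have x: "(0, pr n a) \<in> H n" by (simp add: H_def)
    have "comps (runs_path (ns @ [n]) ms) = replicate m1 0 @ n # replicate m' 0"
      unfolding path using True m1 by (simp add: comps_replicate_False comps_block)
    moreover have "U.P 0 (replicate m1 0 @ n # replicate m' 0) (0, pr n a) (0, y) =
        U.P m1 ([n] @ replicate m' 0) (0, pr n a) (0, y)"
      using U.P_zeros_append[of "(0, pr n a)" "n # replicate m' 0" "(0, y)" m 0 m1] x y le m1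
      by (simp add: sum_list_replicate)
    moreover have "\<dots> = U.P m1 [n] (0, pr n a) (0, y)"
      using x y le m1 by (intro U.P_append_zeros[where m=m]) (auto simp: sum_list_replicate)
    moreover have "\<dots> = (0, B m1 (pr n a) y)"
      using U.P_single[OF x y, of m1] le m1 by (simp add: b_pos del: U.P.simps)
    ultimately show ?thesis using True ms m1 by (simp add: icop_comp_def del: U.P.simps)
  next
    case False
    let ?N = "sum_list ns" and ?M = "sum_list ms'"
    have pos: "0 < ?N" using proper(1) False len by (cases ns; cases ms') auto
    \<comment> \<open>Letters of y separate the last two blocks, so the encoding of the earlier part
      ends in 0, and the last block takes over that entry.\<close>
    obtain c where c: "comps (runs_path ns ms') = c @ [0]"
      using comps_runs_path_last[OF len] proper(2) False by blast
    have lc: "length c = ?M" "sum_list c = ?N"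
      using comps_sums[of "runs_path ns ms'"] path_runs_path[of ms' ns] len c by (auto simp: path_def)
    have C: "comps (runs_path (ns @ [n]) ms) = c @ n # replicate m' 0"
      unfolding path using comps_append[OF c comps_block] by simp
    let ?F = "\<lambda>u v. U.P 0 (c @ [0]) u (b ?M v (0, y))"
    have bv: "b ?M v (0, y) \<in> H (n + m)" if "v \<in> H n" for v
      using that y le by (intro b_in_H) auto
    have bil: "bilV ?N n (\<lambda>u v. ?F (0, u) (0, v))"
    proof (rule bilV_pos[OF pos n])
      fix u assume u: "u \<in> H ?N"
      show "lin (H n) (?F u)"
        by (rule U.lin_comp_P2[OF b_lin_1[OF _ y] bv]) (use u lc le in auto)
    next
      fix v assume v: "v \<in> H n"
      show "lin (H ?N) (\<lambda>u. ?F u v)"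
        using U.P_lin1[OF bv[OF v], of 0 "c @ [0]"] lc le by simp
    qed
    have "(0 :: 'k, \<Sum>t\<leftarrow>icop_comp G D (ns @ [n]) a. nest B ms 0 t y) =
        (\<Sum>(u, v)\<leftarrow>D a. (0, \<Sum>t\<leftarrow>icop_comp G D ns u. nest B ms 0 (t @ [pr n v]) y))"
    proof -
      have "(\<Sum>p\<leftarrow>t. (0 :: 'k, g p)) = (0, \<Sum>p\<leftarrow>t. g p)" for t :: "('a \<times> 'a) list" and g :: "'a \<times> 'a \<Rightarrow> 'a"
        by (induction t) (auto simp: zero_prod_def)
      then show ?thesis
        unfolding icop_comp_snoc[OF False] by (simp add: sum_list_map_concat o_def case_prod_unfold)
    qed
    also have "\<dots> = (\<Sum>(u, v)\<leftarrow>D a. ?F (0, pr ?N u) (0, pr n v))"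
    proof (intro arg_cong[where f=sum_list] map_cong refl, clarify)
      fix u v
      \<comment> \<open>The last block is inserted after the \<open>sum_list ms'\<close> letters of
        y preceding it; the final entry of \<open>ms\<close> is never read by
        \<open>nest\<close>.\<close>
      have "(\<Sum>t\<leftarrow>icop_comp G D ns u. nest B ms 0 (t @ [pr n v]) y) =
          (\<Sum>t\<leftarrow>icop_comp G D ns u. nest B ms' 0 t (B ?M (pr n v) y))"
      proof (intro arg_cong[where f=sum_list] map_cong refl)
        fix t assume "t \<in> set (icop_comp G D ns u)"
        then have "length t = length ns"
          using False by (cases ns) (auto simp: icop_comp_def dest!: length_icop)
        then show "nest B ms 0 (t @ [pr n v]) y = nest B ms' 0 t (B ?M (pr n v) y)"
          using len ms by (simp add: nest_snoc nest_append)
      qed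
      moreover have "B ?M (pr n v) y \<in> G (n + m)"
        using le snoc.prems(3) by (intro B_in) auto
      ultimately show "(0, \<Sum>t\<leftarrow>icop_comp G D ns u. nest B ms 0 (t @ [pr n v]) y) =
          ?F (0, pr ?N u) (0, pr n v)"
        using snoc.IH[OF proper(1) False, of "B ?M (pr n v) y" "n + m" u] le c
        by (simp add: b_pos)
    qed
    also have "\<dots> = dsum ?N n (\<lambda>u v. ?F (0, u) (0, v)) a" by (simp add: dsum_def wsum_def)
    also have "\<dots> = dsum ?N n (\<lambda>u v. ?F (0, u) (0, v)) (pr (?N + n) a)"
      by (rule dsum_pr[OF bil, symmetric])
    also have "\<dots> = U.Sig ?N n ?F (0, pr (?N + n) a)"
      using pos n by (simp add: U.Sig_def S_pos)
    also have "\<dots> = U.P 0 (c @ n # replicate m' 0) (0, pr (?N + n) a) (0, y)"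
      using U.P_snoc[of "(0, pr (?N + n) a)" c n "(0, y)" m 0 m'] lc y le by (simp add: H_def)
    finally show ?thesis using C by simp
  qed
qed simp

lemma sum_list_pair_cong:
  assumes "\<And>a b. (a, b) \<in> set ps \<Longrightarrow> f a b = g a b"
  shows "(\<Sum>(a, b)\<leftarrow>ps. f a b) = (\<Sum>(a, b)\<leftarrow>ps. g a b)"
  using assms by (intro arg_cong[where f=sum_list] map_cong) auto

abbreviation graft :: "nat \<Rightarrow> nat \<Rightarrow> nat list \<Rightarrow> 'a \<Rightarrow> 'a \<Rightarrow> 'a" where
  "graft \<equiv> graft_shuffle G B D"

lemma Pair_0_in_H: "a \<in> G n \<Longrightarrow> (0, a) \<in> H n"
  by (simp add: H_def)

lemma comps_path:
  assumes "path n m bs"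
  shows "sum_list (comps bs) = n" "length (comps bs) = Suc m"
  using comps_sums[of bs] assms by (auto simp: path_def)

text \<open>Identifies the product of the statement with \<open>P\<close> under a \<mapsto> (0, a),
  so that linearity, associativity and the coproduct formula can be transported from the unital
  algebra.\<close>

lemma graft_eq_P:
  assumes bs: "path n m bs" and x: "x \<in> G n" and y: "y \<in> G m"
  shows "(0, graft n m (shuffle_word n m bs) x y) = U.P 0 (comps bs) (0, x) (0, y)"
proof -
  obtain ns ms where r: "runs bs = (ns, ms)" by force
  have rp: "proper_runs ns ms" "runs_path ns ms = bs" using runs_proper[of bs] r by auto
  have sums: "sum_list ns = n" "sum_list ms = m"
    using path_runs_path[of ms ns] rp bs by (auto simp: path_def proper_runs_def)
  have graft: "graft n m (shuffle_word n m bs) x y = (\<Sum>t\<leftarrow>icop_comp G D ns x. nest B ms 0 t y)"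
    by (simp add: graft_shuffle_def shuffle_comps_shuffle_word[OF bs] r)
  show ?thesis
  proof (cases "ns = []")
    case True
    \<comment> \<open>Without blocks the defining sum is empty and equals 0; this is correct because
      x = 0 by \<open>A_0 = 0\<close>.\<close>
    then have "n = 0" using sums by simp
    then have "x = 0" using x G_0 by simp
    have "lin (H n) (\<lambda>x. U.P 0 (comps bs) x (0, y))"
      using U.P_lin1[OF Pair_0_in_H[OF y], of 0 "comps bs"] comps_path[OF bs] by simp
    from lin_scale[OF this Pair_0_in_H[OF x], of 0] show ?thesis
      using True \<open>x = 0\<close> graft by (simp add: icop_comp_def sV_def zero_prod_def)
  next
    case False
    then show ?thesis
      using sum_nest_eq_P[OF rp(1) False y, of x] sums rp(2) graft x by (simp add: pr_homogeneous)
  qed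
qed

lemma graft_in:
  assumes "path n m bs" "x \<in> G n" "y \<in> G m"
  shows "graft n m (shuffle_word n m bs) x y \<in> G (n + m)"
proof -
  have "U.P 0 (comps bs) (0, x) (0, y) \<in> H (sum_list (comps bs) + m)"
    using comps_path[OF assms(1)] assms(2,3) by (intro U.P_in Pair_0_in_H) auto
  then show ?thesis
    unfolding graft_eq_P[OF assms, symmetric] comps_path[OF assms(1)] by (simp add: H_def)
qed

lemma Pair_0_lincomb: "(0, sc c a + sc d a') = sV c (0, a) + sV d (0, a')"
  by (simp add: sV_def)

lemma graft_lin1:
  assumes bs: "path n m bs" and x: "x1 \<in> G n" "x2 \<in> G n" and y: "y \<in> G m"
  shows "graft n m (shuffle_word n m bs) (sc c x1 + sc d x2) y =
    sc c (graft n m (shuffle_word n m bs) x1 y) + sc d (graft n m (shuffle_word n m bs) x2 y)"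
proof -
  have "lin (H n) (\<lambda>x. U.P 0 (comps bs) x (0, y))"
    using U.P_lin1[OF Pair_0_in_H[OF y], of 0 "comps bs"] comps_path[OF bs] by simp
  from lin_onD[OF this Pair_0_in_H[OF x(1)] Pair_0_in_H[OF x(2)], of c d]
  have "(0 :: 'k, graft n m (shuffle_word n m bs) (sc c x1 + sc d x2) y) =
    (0, sc c (graft n m (shuffle_word n m bs) x1 y) + sc d (graft n m (shuffle_word n m bs) x2 y))"
    using x by (simp only: Pair_0_lincomb[symmetric] G_add G_scale flip: graft_eq_P[OF bs _ y])
  then show ?thesis by simp
qed

lemma graft_lin2:
  assumes bs: "path n m bs" and x: "x \<in> G n" and y: "y1 \<in> G m" "y2 \<in> G m"
  shows "graft n m (shuffle_word n m bs) x (sc c y1 + sc d y2) =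
    sc c (graft n m (shuffle_word n m bs) x y1) + sc d (graft n m (shuffle_word n m bs) x y2)"
proof -
  have "lin (H m) (U.P 0 (comps bs) (0, x))"
    using U.P_lin2[of "(0, x)" "comps bs" 0 m] comps_path[OF bs] Pair_0_in_H[OF x] by simp
  from lin_onD[OF this Pair_0_in_H[OF y(1)] Pair_0_in_H[OF y(2)], of c d]
  have "(0 :: 'k, graft n m (shuffle_word n m bs) x (sc c y1 + sc d y2)) =
    (0, sc c (graft n m (shuffle_word n m bs) x y1) + sc d (graft n m (shuffle_word n m bs) x y2))"
    using y by (simp only: Pair_0_lincomb[symmetric] G_add G_scale flip: graft_eq_P[OF bs x])
  then show ?thesis by simp
qed

lemma graft_assoc:
  assumes xyz: "x \<in> G n" "y \<in> G m" "z \<in> G r"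
    and g: "g \<in> Sh [n, m + r]" and d: "d \<in> Sh [m, r]" and s: "s \<in> Sh [n, m]" and l: "l \<in> Sh [n + m, r]"
    and eq: "comp_word (cross_word (id_word n) d) g = comp_word (cross_word s (id_word r)) l"
  shows "graft n (m + r) g x (graft m r d y z) = graft (n + m) r l (graft n m s x y) z"
proof -
  obtain gb where gb: "path n (m + r) gb" "g = shuffle_word n (m + r) gb" using g by (rule Sh_two_shuffle_word)
  obtain db where db: "path m r db" "d = shuffle_word m r db" using d by (rule Sh_two_shuffle_word)
  obtain sb where sb: "path n m sb" "s = shuffle_word n m sb" using s by (rule Sh_two_shuffle_word)
  obtain lb where lb: "path (n + m) r lb" "l = shuffle_word (n + m) r lb" using l by (rule Sh_two_shuffle_word)
  have yz: "graft m r d y z \<in> G (m + r)" and xy: "graft n m s x y \<in> G (n + m)"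
    using graft_in xyz db sb by auto
  have f: "factorizations (comps sb) (comps lb) (comps db) (comps gb)"
    using factorizations_Sh[OF gb(1) db(1) sb(1) lb(1)] eq gb db sb lb by simp
  have "(0 :: 'k, graft n (m + r) g x (graft m r d y z)) =
      U.P 0 (comps gb) (0, x) (U.P 0 (comps db) (0, y) (0, z))"
    using graft_eq_P[OF gb(1) xyz(1) yz] graft_eq_P[OF db(1) xyz(2,3)] gb db by simp
  also have "\<dots> = U.P 0 (comps lb) (U.P 0 (comps sb) (0, x) (0, y)) (0, z)"
    using Pair_0_in_H[OF xyz(1)] Pair_0_in_H[OF xyz(2)] comps_path[OF sb(1)] comps_path[OF db(1)]
      comps_path[OF lb(1)]
    by (intro U.P_assoc[OF f _ _ Pair_0_in_H[OF xyz(3)], symmetric]) auto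
  also have "\<dots> = (0, graft (n + m) r l (graft n m s x y) z)"
    using graft_eq_P[OF lb(1) xy xyz(3)] graft_eq_P[OF sb(1) xyz(1,2)] lb sb by simp
  finally show ?thesis by simp
qed

lemma shuffle_algebra_graft: "shuffle_algebra sc G graft"
  unfolding shuffle_algebra_def
proof (intro conjI allI impI graded)
  fix n m g assume "g \<in> Sh [n, m]"
  then obtain bs where bs: "path n m bs" and g: "g = shuffle_word n m bs" by (rule Sh_two_shuffle_word)
  show "\<forall>x\<in>G n. \<forall>y\<in>G m. graft n m g x y \<in> G (n + m)"
    using graft_in[OF bs] g by blast
  show "\<forall>x\<in>G n. \<forall>y1\<in>G m. \<forall>y2\<in>G m. \<forall>c d. graft n m g x (sc c y1 + sc d y2) =
      sc c (graft n m g x y1) + sc d (graft n m g x y2)"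
    using graft_lin2[OF bs] g by blast
  show "\<forall>x1\<in>G n. \<forall>x2\<in>G n. \<forall>y\<in>G m. \<forall>c d. graft n m g (sc c x1 + sc d x2) y =
      sc c (graft n m g x1 y) + sc d (graft n m g x2 y)"
    using graft_lin1[OF bs] g by blast
qed (blast intro: graft_assoc)

section \<open>Compatibility of the coproduct with the shuffle products\<close>

primrec emb :: "'a option \<Rightarrow> 'k \<times> 'a" where
  "emb None = e"
| "emb (Some a) = (0, a)"

text \<open>\<open>T\<close> agrees with the components of \<open>\<Delta>_+\<close> in the
  statement even as lists, with \<open>None\<close> read as the unit.\<close>

lemma T_eq_dplus_comp:
  "T k l (0, x) = map (\<lambda>(u, v). (emb u, emb v)) (dplus_comp G D (k + l) x k)"
  by (auto simp: T_def dplus_comp_def dcomp_def)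

lemma emb_in_H: "emb None \<in> H n \<longleftrightarrow> n = 0" "emb (Some a) \<in> H n \<longleftrightarrow> a \<in> G n"
  using e_in by (auto simp: H_def e_def G_zero)

lemma dplus_comp_in:
  assumes "x \<in> G (k + l)" "(u, v) \<in> set (dplus_comp G D (k + l) x k)"
  shows "emb u \<in> H k" "emb v \<in> H l"
  using T_in_H[OF Pair_0_in_H[OF assms(1)], of "emb u" "emb v"] assms(2)
  by (force simp: T_eq_dplus_comp)+

text \<open>Positive total degree excludes two units, where \<open>unit_prod\<close> returns 0 but
  \<open>P\<close> the unit.\<close>

lemma unit_prod_eq_P:
  assumes bs: "path n m bs" and uv: "emb u \<in> H n" "emb v \<in> H m" and pos: "0 < n + m"
  shows "U.P 0 (comps bs) (emb u) (emb v) = (0, unit_prod graft n m (shuffle_word n m bs) u v)"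
proof (cases u)
  case None
  then have "n = 0" using uv emb_in_H by simp
  then obtain a where "v = Some a" using uv pos emb_in_H by (cases v) auto
  then show ?thesis
    using None U.P_unit[OF _ uv(2), of "comps bs" 0] comps_path[OF bs] \<open>n = 0\<close> by simp
next
  case (Some a)
  then have a: "a \<in> G n" using uv emb_in_H by simp
  show ?thesis
  proof (cases v)
    case None
    then have "m = 0" using uv emb_in_H by simp
    then have "comps bs = [n]" using comps_path[OF bs] by (cases "comps bs") auto
    then show ?thesis
      using None Some U.P_single[OF uv(1) e_in, of 0] b_e_right[OF uv(1)] by (simp del: U.P.simps)
  next
    case (Some a')
    then have "a' \<in> G m" using uv emb_in_H by simp
    then show ?thesis using Some \<open>u = Some a\<close> graft_eq_P[OF bs a] by simp
  qed
qed

text \<open>By \<open>coproduct_graded\<close> a homogeneous representative exists, and each of its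
  terms is seen by exactly one bidegree (r, n - r). The scalar values sit in the first
  coordinate.\<close>

lemma coproduct_components:
  assumes f: "bilinear_form sc f" and z: "z \<in> G n"
  shows "((\<Sum>(u, v)\<leftarrow>D z. f u v), 0) = (\<Sum>r\<leftarrow>[1..<n]. dsum r (n - r) (\<lambda>u v. (f u v, 0)) z)"
proof -
  obtain t where t: "teq sc (D z) t"
    "\<forall>(u, v)\<in>set t. \<exists>i. 1 \<le> i \<and> i \<le> n - 1 \<and> u \<in> G i \<and> v \<in> G (n - i)"
    using D_graded z unfolding coproduct_graded_def by blast
  have lin: "lin_on sc (*) UNIV (f u)" "lin_on sc (*) UNIV (\<lambda>u. f u v)" for u v
    using f by (auto simp: bilinear_form_def linear_iff_lin_on)
  have bil: "bilV k l (\<lambda>u v. (f u v, 0))" for k l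
    unfolding bilV_def lin_on_def sV_def using lin_onD[OF lin(1)] lin_onD[OF lin(2)] by simp
  have f0: "f 0 v = 0" "f u 0 = 0" for u v
  proof -
    have "f (sc 0 0 + sc 0 0) v = 0 * f 0 v + 0 * f 0 v" by (rule lin_onD[OF lin(2)]) auto
    then show "f 0 v = 0" by simp
    have "f u (sc 0 0 + sc 0 0) = 0 * f u 0 + 0 * f u 0" by (rule lin_onD[OF lin(1)]) auto
    then show "f u 0 = 0" by simp
  qed
  have comp: "(\<Sum>r\<leftarrow>[1..<n]. (f (pr r (fst p)) (pr (n - r) (snd p)), 0 :: 'a)) = (f (fst p) (snd p), 0)"
    if p: "p \<in> set t" for p
  proof -
    obtain u v where uv: "p = (u, v)" by force
    obtain i where i: "1 \<le> i" "i \<le> n - 1" "u \<in> G i" "v \<in> G (n - i)" using bspec[OF t(2) p] uv by auto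
    have "i < n" using i by linarith
    have "(\<Sum>r\<leftarrow>[1..<n]. (f (pr r u) (pr (n - r) v), 0 :: 'a)) =
        (\<Sum>r\<leftarrow>[1..<n]. if r + 0 = i then (f u v, 0) else 0)"
      using i by (intro arg_cong[where f=sum_list] map_cong) (auto simp: pr_homogeneous f0 zero_prod_def)
    also have "\<dots> = (f u v, 0)" unfolding sum_list_upt_delta using i \<open>i < n\<close> by simp
    finally show ?thesis using uv by simp
  qed
  have pair: "(\<Sum>p\<leftarrow>t. (g p :: 'k, 0 :: 'a)) = ((\<Sum>p\<leftarrow>t. g p), 0)" for t :: "('a \<times> 'a) list" and g
    by (induction t) (auto simp: zero_prod_def)
  have "(\<Sum>r\<leftarrow>[1..<n]. dsum r (n - r) (\<lambda>u v. (f u v, 0)) z) =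
      (\<Sum>r\<leftarrow>[1..<n]. \<Sum>p\<leftarrow>t. (f (pr r (fst p)) (pr (n - r) (snd p)), 0))"
    unfolding dsum_def wsum_teq[OF bil t(1)] unfolding wsum_def case_prod_unfold ..
  also have "\<dots> = (\<Sum>p\<leftarrow>t. \<Sum>r\<leftarrow>[1..<n]. (f (pr r (fst p)) (pr (n - r) (snd p)), 0))"
    by (rule sum_list_swap)
  also have "\<dots> = (\<Sum>p\<leftarrow>t. (f (fst p) (snd p), 0))"
    by (intro arg_cong[where f=sum_list] map_cong refl comp)
  also have "\<dots> = ((\<Sum>(u, v)\<leftarrow>t. f u v), 0)" unfolding pair case_prod_unfold ..
  also have "(\<Sum>(u, v)\<leftarrow>t. f u v) = (\<Sum>(u, v)\<leftarrow>D z. f u v)"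
    using t(1) f unfolding teq_def by simp
  finally show ?thesis by simp
qed

text \<open>Cutting the path of \<open>\<gamma>\<close> after r letters gives the paths of its two
  components, so \<open>Sig_P\<close> in this bidegree is the r-th summand of the required
  formula.\<close>

lemma graft_coproduct_component:
  assumes f: "bilinear_form sc f" and x: "x \<in> G n" and y: "y \<in> G m" and bs: "path n m bs"
    and r: "1 \<le> r" "r < n + m" and g: "g = shuffle_word n m bs"
  shows "dsum r (n + m - r) (\<lambda>u v. (f u v, 0)) (graft n m g x y) =
    ((\<Sum>(u, v)\<leftarrow>(let n1 = dec_n1 n g r; m1 = r - n1; (g1, g2) = shuffle_dec n m g r in
             concat (map (\<lambda>(x1, x2). map (\<lambda>(y1, y2).
                 (unit_prod graft n1 m1 g1 x1 y1, unit_prod graft (n - n1) (m - m1) g2 x2 y2))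
               (dplus_comp G D m y m1))
               (dplus_comp G D n x n1))). f u v), 0)"
proof -
  let ?b1 = "take r bs" and ?b2 = "drop r bs"
  define n1 m1 n2 m2 where n1: "n1 = count_list ?b1 True" and m1: "m1 = count_list ?b1 False"
    and n2: "n2 = count_list ?b2 True" and m2: "m2 = count_list ?b2 False"
  have len: "length bs = n + m" by (rule path_length[OF bs])
  have b1: "path n1 m1 ?b1" and b2: "path n2 m2 ?b2" by (simp_all add: path_def n1 m1 n2 m2)
  have "count_list (?b1 @ ?b2) True = n1 + n2" "count_list (?b1 @ ?b2) False = m1 + m2"
    unfolding n1 n2 m1 m2 by (simp_all del: append_take_drop_id)
  then have n: "n = n1 + n2" and m: "m = m1 + m2" using bs by (simp_all add: path_def)
  have r': "r = n1 + m1" "n + m - r = n2 + m2"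
    using path_length[OF b1] len r n m by auto
  then have pos: "0 < n1 + m1" "0 < n2 + m2" using r by linarith+
  obtain c k where c: "comps ?b1 = c @ [k]" by (metis comps_not_Nil rev_exhaust)
  obtain l c' where c': "comps ?b2 = l # c'" by (metis comps_not_Nil neq_Nil_conv)
  \<comment> \<open>The cut divides the letters of x standing after exactly \<open>m1\<close>
    letters of y; k of them lie before it and l after it, and either number may be 0.\<close>
  have cs: "comps bs = c @ (k + l) # c'" using comps_append[OF c c'] by simp
  have sums: "n1 = sum_list c + k" "m1 = length c" "n2 = l + sum_list c'" "m2 = length c'"
    using comps_path[OF b1] comps_path[OF b2] c c' by simp_all
  have dec: "dec_n1 n g r = n1" "shuffle_dec n m g r = (shuffle_word n1 m1 ?b1, shuffle_word n2 m2 ?b2)"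
  proof -
    show "dec_n1 n g r = n1" unfolding g n1 using r by (intro dec_n1_shuffle_word[OF bs]) simp
    show "shuffle_dec n m g r = (shuffle_word n1 m1 ?b1, shuffle_word n2 m2 ?b2)"
      using shuffle_dec_shuffle_word[OF b1 b2] unfolding n[symmetric] m[symmetric] r'(1)[symmetric] append_take_drop_id g .
  qed
  let ?F = "\<lambda>u v :: 'k \<times> 'a. (f (snd u) (snd v), 0 :: 'a)"
  have lin_f: "lin_on sc (*) UNIV (f u)" "lin_on sc (*) UNIV (\<lambda>u. f u v)" for u v
    using f by (auto simp: bilinear_form_def linear_iff_lin_on)
  have bil: "U.bil k l ?F" for k l
    unfolding U.bil_def lin_on_def using lin_onD[OF lin_f(1)] lin_onD[OF lin_f(2)] by (simp add: sV_def)
  have xH: "(0, x) \<in> H (n1 + n2)" and yH: "(0, y) \<in> H (m1 + m2)"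
    using x y n m by (simp_all add: Pair_0_in_H)
  have "dsum r (n + m - r) (\<lambda>u v. (f u v, 0)) (graft n m g x y) =
      U.Sig (n1 + m1) (n2 + m2) ?F (0, graft n m g x y)"
    unfolding r' using S_pos[of "n1 + m1" "n2 + m2" ?F] r r' by (simp only: U.Sig_def snd_conv)
  also have "\<dots> = U.Sig (n1 + m1) (n2 + m2) ?F (U.P 0 (c @ (k + l) # c') (0, x) (0, y))"
    using graft_eq_P[OF bs x y] cs g by simp
  also have "\<dots> = U.Sig n1 n2 (\<lambda>u v. U.Sig m1 m2 (\<lambda>y z.
      ?F (U.P 0 (comps ?b1) u y) (U.P 0 (comps ?b2) v z)) (0, y)) (0, x)"
    using U.Sig_P[of "(0, x)" c k l c' "(0, y)" m1 m2 0 ?F] xH yH bil sums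
    unfolding c c' by (simp add: add.assoc)
  also have "\<dots> = (\<Sum>(x1, x2)\<leftarrow>dplus_comp G D n x n1. \<Sum>(y1, y2)\<leftarrow>dplus_comp G D m y m1.
      ?F (U.P 0 (comps ?b1) (emb x1) (emb y1)) (U.P 0 (comps ?b2) (emb x2) (emb y2)))"
    unfolding U.Sig_def T_eq_dplus_comp n m by (simp add: o_def case_prod_unfold)
  also have "\<dots> = (\<Sum>(x1, x2)\<leftarrow>dplus_comp G D n x n1. \<Sum>(y1, y2)\<leftarrow>dplus_comp G D m y m1.
      (f (unit_prod graft n1 m1 (shuffle_word n1 m1 ?b1) x1 y1) (unit_prod graft n2 m2 (shuffle_word n2 m2 ?b2) x2 y2), 0))"
  proof (intro sum_list_pair_cong)
    fix x1 x2 y1 y2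
    assume "(x1, x2) \<in> set (dplus_comp G D n x n1)" "(y1, y2) \<in> set (dplus_comp G D m y m1)"
    then have "emb x1 \<in> H n1" "emb x2 \<in> H n2" "emb y1 \<in> H m1" "emb y2 \<in> H m2"
      using dplus_comp_in x y n m by blast+
    note unit_prod_eq_P[OF b1 this(1,3) pos(1)] unit_prod_eq_P[OF b2 this(2,4) pos(2)]
    then show "?F (U.P 0 (comps ?b1) (emb x1) (emb y1)) (U.P 0 (comps ?b2) (emb x2) (emb y2)) =
        (f (unit_prod graft n1 m1 (shuffle_word n1 m1 ?b1) x1 y1) (unit_prod graft n2 m2 (shuffle_word n2 m2 ?b2) x2 y2), 0)"
      by simp
  qed
  also have "\<dots> = ((\<Sum>(x1, x2)\<leftarrow>dplus_comp G D n x n1. \<Sum>(y1, y2)\<leftarrow>dplus_comp G D m y m1.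
      f (unit_prod graft n1 m1 (shuffle_word n1 m1 ?b1) x1 y1) (unit_prod graft n2 m2 (shuffle_word n2 m2 ?b2) x2 y2)), 0)"
  proof -
    have pair: "(\<Sum>p\<leftarrow>t. (h p :: 'k, 0 :: 'a)) = ((\<Sum>p\<leftarrow>t. h p), 0)" for t :: "('a option \<times> 'a option) list" and h
      by (induction t) (auto simp: zero_prod_def)
    show ?thesis unfolding case_prod_unfold pair ..
  qed
  finally show ?thesis
    unfolding dec Let_def prod.case using n m r'
    by (simp add: sum_list_map_concat o_def case_prod_unfold)
qed

theorem shuffle_bialgebra_graft: "shuffle_bialgebra sc G graft D"
  unfolding shuffle_bialgebra_def
proof (intro conjI allI impI shuffle_algebra_graft G_0 D_coproduct D_coassoc D_graded; elim conjE)
  fix n m x y g assume x: "x \<in> G n" and y: "y \<in> G m" and "g \<in> Sh [n, m]"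
  then obtain bs where bs: "path n m bs" and g: "g = shuffle_word n m bs" by (auto elim: Sh_two_shuffle_word)
  let ?t = "\<lambda>r. let n1 = dec_n1 n g r; m1 = r - n1; (g1, g2) = shuffle_dec n m g r in
             concat (map (\<lambda>(x1, x2). map (\<lambda>(y1, y2).
                 (unit_prod graft n1 m1 g1 x1 y1, unit_prod graft (n - n1) (m - m1) g2 x2 y2))
               (dplus_comp G D m y m1))
               (dplus_comp G D n x n1))"
  have z: "graft n m g x y \<in> G (n + m)" unfolding g by (rule graft_in[OF bs x y])
  show "teq sc (D (graft n m g x y)) (concat (map ?t [1..<n + m]))"
    unfolding teq_def
  proof (intro allI impI)
    fix f assume f: "bilinear_form sc f"
    have pair: "(\<Sum>r\<leftarrow>t. (h r :: 'k, 0 :: 'a)) = ((\<Sum>r\<leftarrow>t. h r), 0)" for t :: "nat list" and h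
      by (induction t) (auto simp: zero_prod_def)
    have "((\<Sum>(u, v)\<leftarrow>D (graft n m g x y). f u v), 0 :: 'a) =
        (\<Sum>r\<leftarrow>[1..<n + m]. ((\<Sum>(u, v)\<leftarrow>?t r. f u v), 0))"
      unfolding coproduct_components[OF f z]
      by (intro arg_cong[where f=sum_list] map_cong refl graft_coproduct_component[OF f x y bs _ _ g]) auto
    then show "(\<Sum>(u, v)\<leftarrow>D (graft n m g x y). f u v) = (\<Sum>(u, v)\<leftarrow>concat (map ?t [1..<n + m]). f u v)"
      unfolding pair sum_list_map_concat map_map o_def by (simp only: prod.inject)
  qed
qed

end

theorem mainTheorem17:
  fixes sc :: "'k::field \<Rightarrow> 'a::ab_group_add \<Rightarrow> 'a"
    and G :: "nat \<Rightarrow> 'a set"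
    and B :: "nat \<Rightarrow> 'a \<Rightarrow> 'a \<Rightarrow> 'a"
    and D :: "'a \<Rightarrow> ('a \<times> 'a) list"
  assumes "grafting_bialgebra sc G B D"
  shows "shuffle_bialgebra sc G (graft_shuffle G B D) D"
proof -
  interpret grafting_bialg sc G B D by unfold_locales (fact assms)
  show ?thesis by (rule shuffle_bialgebra_graft)
qed

end
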